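(* Suppose $F$ is an algebraically closed field of prime characteristic $p>0$, and let $n\ge1$. Then the sign module $S^{(1^n)}$ has vertex $\mathfrak S_\lambda$ as an $\mathcal H_n$-module, where $\mathfrak S_\lambda$ is the standard maximal $e$-$p$-parabolic subgroup of $\mathfrak S_n$.
   Context: Let $q\in F^\times$ and let $\mathcal H_n=\mathcal H_n(F,q)$ be the unital associative $F$-algebra with generators $T_1,\dots,T_{n-1}$ and relations $(T_i-q)(T_i+1)=0$, $T_iT_j=T_jT_i$ for $|i-j|>1$, $T_iT_{i+1}T_i=T_{i+1}T_iT_{i+1}$. It has $F$-basis $\{T_w:w\in\mathfrak S_n\}$, where $T_w=T_{i_1}\cdots T_{i_t}$ for a reduced expression $w=s_{i_1}\cdots s_{i_t}$, $s_i=(i,i+1)$. The quantum characteristic $e$ is the smallest positive integer with $1+q+\dots+q^{e-1}=0$ in $F$; assume it exists and $e>1$ (so either $\gcd(e,p)=1$ and $q$ is a primitive $e$-th root of unity, or $e=p$ and $q=1$). For a composition $\lambda=(\lambda_1,\dots,\lambda_s)$ of $n$ (tuple of positive integers with sum $n$), $\mathfrak S_\lambda\cong\mathfrak S_{\lambda_1}\times\cdots\times\mathfrak S_{\lambda_s}$ is the standard parabolic subgroup of $\mathfrak S_n$ preserving the successive intervals of lengths $\lambda_1,\dots,\lambda_s$, and $\mathcal H_\lambda=\langle T_w:w\in\mathfrak S_\lambda\rangle_F$. The $e$-$p$-adic expansion of $n$ is the unique expression $n=a_{-1}+a_0e+a_1ep+\dots+a_tep^t$ with $0\le a_{-1}<e$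 and $0\le a_i<p$ for $i\ge 0$. The standard maximal $e$-$p$-parabolic subgroup of $\mathfrak S_n$ is $\mathfrak S_\lambda$ for $\lambda=(1^{a_{-1}},e^{a_0},(ep)^{a_1},\dots,(ep^t)^{a_t})$ (exponents denote multiplicities of parts). $S^{(1^n)}$ is the one-dimensional right $\mathcal H_n$-module on which every $T_i$ acts as $-1$ (it is the Specht module of the partition $(1^n)$). A right $\mathcal H_n$-module $M$ is relatively $\mathfrak S_\lambda$-projective if it is isomorphic to a direct summand of $M\otimes_{\mathcal H_\lambda}\mathcal H_n$. $\mathfrak S_\lambda$ is a vertex of $M$ if $M$ is relatively $\mathfrak S_\lambda$-projective and, for every composition $\mu$ of $n$ such that $M$ is relatively $\mathfrak S_\mu$-projective, some $\mathfrak S_n$-conjugate of $\mathfrak S_\lambda$ is contained in $\mathfrak S_\mu$. *)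

theory Defs
  imports
    "HOL-Computational_Algebra.Polynomial"
    "HOL-Computational_Algebra.Primes"
    "HOL-Combinatorics.Permutations"
    "HOL-Library.Poly_Mapping"
    "HOL-Algebra.QuotRing"
    "HOL-Algebra.Generated_Groups"
    "HOL-Algebra.Free_Abelian_Groups"
begin

section \<open>Right modules over a ring\<close>

text \<open>HOL-Algebra's modules are left modules over commutative rings.  As there, the
  multiplicative fields of the record are not used.\<close>

record ('r, 'm) right_module = "'m ring" +
  ract :: "'m \<Rightarrow> 'r \<Rightarrow> 'm"  (infixl \<open>\<star>\<index>\<close> 70)

locale right_module = R?: ring R + M?: abelian_group M for R (structure) and M (structure) +
  assumes ract_closed: "\<lbrakk>x \<in> carrier M; r \<in> carrier R\<rbrakk> \<Longrightarrow> x \<star>\<^bsub>M\<^esub> r \<in> carrier M"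
    and ract_l_distr: "\<lbrakk>x \<in> carrier M; y \<in> carrier M; r \<in> carrier R\<rbrakk>
          \<Longrightarrow> (x \<oplus>\<^bsub>M\<^esub> y) \<star>\<^bsub>M\<^esub> r = x \<star>\<^bsub>M\<^esub> r \<oplus>\<^bsub>M\<^esub> y \<star>\<^bsub>M\<^esub> r"
    and ract_r_distr: "\<lbrakk>x \<in> carrier M; r \<in> carrier R; s \<in> carrier R\<rbrakk>
          \<Longrightarrow> x \<star>\<^bsub>M\<^esub> (r \<oplus>\<^bsub>R\<^esub> s) = x \<star>\<^bsub>M\<^esub> r \<oplus>\<^bsub>M\<^esub> x \<star>\<^bsub>M\<^esub> s"
    and ract_assoc: "\<lbrakk>x \<in> carrier M; r \<in> carrier R; s \<in> carrier R\<rbrakk>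
          \<Longrightarrow> x \<star>\<^bsub>M\<^esub> (r \<otimes>\<^bsub>R\<^esub> s) = (x \<star>\<^bsub>M\<^esub> r) \<star>\<^bsub>M\<^esub> s"
    and ract_one: "x \<in> carrier M \<Longrightarrow> x \<star>\<^bsub>M\<^esub> \<one>\<^bsub>R\<^esub> = x"

definition right_submodule ::
  "('r, 'x) ring_scheme \<Rightarrow> ('r, 'm) right_module \<Rightarrow> 'm set \<Rightarrow> bool"
  where "right_submodule R M K \<longleftrightarrow>
    additive_subgroup K M \<and> (\<forall>x\<in>K. \<forall>r\<in>carrier R. x \<star>\<^bsub>M\<^esub> r \<in> K)"

definition right_module_iso ::
  "('r, 'x) ring_scheme \<Rightarrow> ('r, 'm) right_module \<Rightarrow> ('r, 'n) right_module \<Rightarrow> bool"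
  where "right_module_iso R M N \<longleftrightarrow>
    (\<exists>f. bij_betw f (carrier M) (carrier N) \<and>
         (\<forall>x\<in>carrier M. \<forall>y\<in>carrier M. f (x \<oplus>\<^bsub>M\<^esub> y) = f x \<oplus>\<^bsub>N\<^esub> f y) \<and>
         (\<forall>x\<in>carrier M. \<forall>r\<in>carrier R. f (x \<star>\<^bsub>M\<^esub> r) = f x \<star>\<^bsub>N\<^esub> r))"

definition iso_direct_summand ::
  "('r, 'x) ring_scheme \<Rightarrow> ('r, 'm) right_module \<Rightarrow> ('r, 'n) right_module \<Rightarrow> bool"
  where "iso_direct_summand R M N \<longleftrightarrow>
    (\<exists>K L. right_submodule R N K \<and> right_submodule R N L \<and>
           K \<inter> L = {\<zero>\<^bsub>N\<^esub>} \<and> K <+>\<^bsub>N\<^esub> L = carrier N \<and>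
           right_module_iso R M (N\<lparr>carrier := K\<rparr>))"

text \<open>For a subring with carrier \<open>B\<close> of \<open>R\<close> and a right \<open>R\<close>-module \<open>M\<close>, the tensor product
  of \<open>M\<close> (restricted to \<open>B\<close>) with \<open>R\<close> over \<open>B\<close>: the free abelian group on the
  pairs \<open>(x, r)\<close> modulo the relations below, with \<open>R\<close> acting on the second factor.\<close>

definition tensor_relators ::
  "('r, 'x) ring_scheme \<Rightarrow> 'r set \<Rightarrow> ('r, 'm) right_module \<Rightarrow> ('m \<times> 'r \<Rightarrow>\<^sub>0 int) set"
  where "tensor_relators R B M =
      {frag_of (x \<oplus>\<^bsub>M\<^esub> y, r) - frag_of (x, r) - frag_of (y, r) | x y r.
         x \<in> carrier M \<and> y \<in> carrier M \<and> r \<in> carrier R}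
    \<union> {frag_of (x, r \<oplus>\<^bsub>R\<^esub> s) - frag_of (x, r) - frag_of (x, s) | x r s.
         x \<in> carrier M \<and> r \<in> carrier R \<and> s \<in> carrier R}
    \<union> {frag_of (x \<star>\<^bsub>M\<^esub> b, r) - frag_of (x, b \<otimes>\<^bsub>R\<^esub> r) | x b r.
         x \<in> carrier M \<and> b \<in> B \<and> r \<in> carrier R}"

definition induced_module ::
  "('r, 'x) ring_scheme \<Rightarrow> 'r set \<Rightarrow> ('r, 'm) right_module
     \<Rightarrow> ('r, ('m \<times> 'r \<Rightarrow>\<^sub>0 int) set) right_module"
  where "induced_module R B M =
    (let G = free_Abelian_group (carrier M \<times> carrier R);
         N = generate G (tensor_relators R B M)
     in \<lparr>carrier = carrier (G Mod N),
         mult = undefined, one = undefined,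
         ring.zero = \<one>\<^bsub>G Mod N\<^esub>,
         add = mult (G Mod N),
         ract = (\<lambda>X r. \<Union>a\<in>X. N #>\<^bsub>G\<^esub> frag_extend (\<lambda>(x, s). frag_of (x, s \<otimes>\<^bsub>R\<^esub> r)) a)\<rparr>)"


section \<open>The Iwahori--Hecke algebra of the symmetric group\<close>

text \<open>Words in the generators; a type of its own, since addition on it is concatenation,
  which makes \<open>gen_word \<Rightarrow>\<^sub>0 'a\<close> the (noncommutative) monoid algebra.\<close>

datatype gen_word = Word (letters: "nat list")

instantiation gen_word :: monoid_add
begin

definition zero_gen_word :: gen_word where "0 = Word []"

definition plus_gen_word :: "gen_word \<Rightarrow> gen_word \<Rightarrow> gen_word"
  where "u + v = Word (letters u @ letters v)"

instance
  by standard (simp_all add: zero_gen_word_def plus_gen_word_def)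

end

text \<open>The free unital associative algebra on generators indexed by \<open>1, \<dots>, n - 1\<close>.\<close>

definition free_algebra :: "nat \<Rightarrow> (gen_word \<Rightarrow>\<^sub>0 'a::field) ring"
  where "free_algebra n =
    \<lparr>carrier = {x. \<forall>w\<in>Poly_Mapping.keys x. set (letters w) \<subseteq> {1..<n}},
     mult = (*), one = 1, ring.zero = 0, add = (+)\<rparr>"

definition free_gen :: "nat \<Rightarrow> (gen_word \<Rightarrow>\<^sub>0 'a::field)"
  where "free_gen i = Poly_Mapping.single (Word [i]) 1"

definition free_const :: "'a::field \<Rightarrow> (gen_word \<Rightarrow>\<^sub>0 'a)"
  where "free_const c = Poly_Mapping.single 0 c"

definition hecke_relators :: "nat \<Rightarrow> 'a::field \<Rightarrow> (gen_word \<Rightarrow>\<^sub>0 'a) set"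
  where "hecke_relators n q =
      {(free_gen i - free_const q) * (free_gen i + 1) | i. i \<in> {1..<n}}
    \<union> {free_gen i * free_gen j - free_gen j * free_gen i | i j.
         i \<in> {1..<n} \<and> j \<in> {1..<n} \<and> \<bar>int i - int j\<bar> > 1}
    \<union> {free_gen i * free_gen (i + 1) * free_gen i
         - free_gen (i + 1) * free_gen i * free_gen (i + 1) | i.
         i \<in> {1..<n} \<and> i + 1 \<in> {1..<n}}"

definition hecke_ideal :: "nat \<Rightarrow> 'a::field \<Rightarrow> (gen_word \<Rightarrow>\<^sub>0 'a) set"
  where "hecke_ideal n q = genideal (free_algebra n) (hecke_relators n q)"

definition hecke_algebra :: "nat \<Rightarrow> 'a::field \<Rightarrow> (gen_word \<Rightarrow>\<^sub>0 'a) set ring"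
  where "hecke_algebra n q = free_algebra n Quot hecke_ideal n q"

text \<open>The images in the Hecke algebra of the generators and of the scalars.  The latter
  map is the structure map of the Hecke algebra as an algebra over the field.\<close>

definition hecke_gen :: "nat \<Rightarrow> 'a::field \<Rightarrow> nat \<Rightarrow> (gen_word \<Rightarrow>\<^sub>0 'a) set"
  where "hecke_gen n q i = hecke_ideal n q +>\<^bsub>free_algebra n\<^esub> free_gen i"

definition hecke_scalar :: "nat \<Rightarrow> 'a::field \<Rightarrow> 'a \<Rightarrow> (gen_word \<Rightarrow>\<^sub>0 'a) set"
  where "hecke_scalar n q c = hecke_ideal n q +>\<^bsub>free_algebra n\<^esub> free_const c"

text \<open>Permutations are composed as functions.  The opposite convention replaces \<open>w\<close> by its
  inverse, which does not affect the span of the \<open>T\<close>'s over a parabolic subgroup.\<close>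

definition expr_perm :: "nat list \<Rightarrow> nat \<Rightarrow> nat"
  where "expr_perm is = foldr (\<lambda>i w. transpose i (i + 1) \<circ> w) is id"

definition reduced_expr :: "nat \<Rightarrow> (nat \<Rightarrow> nat) \<Rightarrow> nat list \<Rightarrow> bool"
  where "reduced_expr n w is \<longleftrightarrow>
    is_arg_min length (\<lambda>js. set js \<subseteq> {1..<n} \<and> expr_perm js = w) is"

definition hecke_T :: "nat \<Rightarrow> 'a::field \<Rightarrow> (nat \<Rightarrow> nat) \<Rightarrow> (gen_word \<Rightarrow>\<^sub>0 'a) set"
  where "hecke_T n q w =
    foldr (\<lambda>i h. hecke_gen n q i \<otimes>\<^bsub>hecke_algebra n q\<^esub> h)
      (SOME is. reduced_expr n w is) \<one>\<^bsub>hecke_algebra n q\<^esub>"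


section \<open>Parabolic subgroups, relative projectivity and vertices\<close>

definition composition :: "nat \<Rightarrow> nat list \<Rightarrow> bool"
  where "composition n \<nu> \<longleftrightarrow> (\<forall>k\<in>set \<nu>. 0 < k) \<and> sum_list \<nu> = n"

definition block :: "nat list \<Rightarrow> nat \<Rightarrow> nat set"
  where "block \<nu> j = {sum_list (take j \<nu>)<..sum_list (take (Suc j) \<nu>)}"

definition parabolic :: "nat list \<Rightarrow> (nat \<Rightarrow> nat) set"
  where "parabolic \<nu> =
    {w. w permutes {1..sum_list \<nu>} \<and> (\<forall>j<length \<nu>. w ` block \<nu> j = block \<nu> j)}"

definition hecke_parabolic :: "nat \<Rightarrow> 'a::field \<Rightarrow> nat list \<Rightarrow> (gen_word \<Rightarrow>\<^sub>0 'a) set set"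
  where "hecke_parabolic n q \<nu> =
    {(\<Oplus>\<^bsub>hecke_algebra n q\<^esub>w\<in>parabolic \<nu>.
        hecke_scalar n q (c w) \<otimes>\<^bsub>hecke_algebra n q\<^esub> hecke_T n q w) | c. True}"

type_synonym ('a, 'm) hecke_module = "((gen_word \<Rightarrow>\<^sub>0 'a) set, 'm) right_module"

definition relatively_projective ::
  "nat \<Rightarrow> 'a::field \<Rightarrow> nat list \<Rightarrow> ('a, 'm) hecke_module \<Rightarrow> bool"
  where "relatively_projective n q \<nu> M \<longleftrightarrow>
    iso_direct_summand (hecke_algebra n q) M
      (induced_module (hecke_algebra n q) (hecke_parabolic n q \<nu>) M)"

definition has_vertex ::
  "nat \<Rightarrow> 'a::field \<Rightarrow> ('a, 'm) hecke_module \<Rightarrow> nat list \<Rightarrow> bool"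
  where "has_vertex n q M \<nu> \<longleftrightarrow>
    relatively_projective n q \<nu> M \<and>
    (\<forall>\<kappa>. composition n \<kappa> \<and> relatively_projective n q \<kappa> M \<longrightarrow>
      (\<exists>g. g permutes {1..n} \<and> (\<lambda>w. g \<circ> w \<circ> Hilbert_Choice.inv g) ` parabolic \<nu> \<subseteq> parabolic \<kappa>))"


section \<open>The sign module and the standard maximal parabolic\<close>

text \<open>The vector space structure of a module over the Hecke algebra is the one given by
  \<^const>\<open>hecke_scalar\<close>; the second conjunct says that its dimension is one.\<close>

definition sign_module :: "nat \<Rightarrow> 'a::field \<Rightarrow> ('a, 'm) hecke_module \<Rightarrow> bool"
  where "sign_module n q M \<longleftrightarrow>
    right_module (hecke_algebra n q) M \<and>
    (\<exists>v\<in>carrier M. v \<noteq> \<zero>\<^bsub>M\<^esub> \<and> carrier M = {v \<star>\<^bsub>M\<^esub> hecke_scalar n q c | c. True}) \<and>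
    (\<forall>i\<in>{1..<n}. \<forall>x\<in>carrier M. x \<star>\<^bsub>M\<^esub> hecke_gen n q i = \<ominus>\<^bsub>M\<^esub> x)"

definition quantum_characteristic :: "'a::field \<Rightarrow> nat \<Rightarrow> bool"
  where "quantum_characteristic q e \<longleftrightarrow>
    is_arg_min id (\<lambda>k. 0 < k \<and> (\<Sum>i<k. q ^ i) = 0) e"

text \<open>\<open>a\<close> is the coefficient with index \<open>-1\<close>, and \<open>as ! i\<close> the one with
  index \<open>i\<close>; the expansion is unique up to trailing zeros of \<open>as\<close>.\<close>

definition ep_adic_expansion :: "nat \<Rightarrow> nat \<Rightarrow> nat \<Rightarrow> nat \<Rightarrow> nat list \<Rightarrow> bool"
  where "ep_adic_expansion e p n a as \<longleftrightarrow>
    a < e \<and> (\<forall>d\<in>set as. d < p) \<and> n = a + (\<Sum>i<length as. as ! i * (e * p ^ i))"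

definition standard_ep_composition :: "nat \<Rightarrow> nat \<Rightarrow> nat \<Rightarrow> nat list \<Rightarrow> nat list"
  where "standard_ep_composition e p a as =
    replicate a 1 @ concat (map (\<lambda>i. replicate (as ! i) (e * p ^ i)) [0..<length as])"

end

theory Submission imports Defs begin

text \<open>Write $M$ for the sign module, spanned by $v$.  The module $M \otimes_{\mathcal{H}_\nu} \mathcal{H}_n$
has a basis $v \otimes T_d$, with $d$ running over the minimal right coset representatives of
$\mathfrak{S}_\nu$, and its vectors on which every $T_i$ acts as $-1$ form the line spanned by
$\sum_d (-1)^{\ell(d)} q^{N-\ell(d)} \, v \otimes T_d$, where $N$ is the greatest length of such a $d$.
The evaluation map $x \otimes h \mapsto xh$ sends this vector to $\sum_d q^{N-\ell(d)}$ times $v$,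
which is the Gaussian multinomial coefficient of $\nu$ at $q$.  Homomorphisms from the induced module
to $M$ are the multiples of evaluation, so $M$ is relatively $\mathfrak{S}_\nu$-projective if and only
if this multinomial coefficient is nonzero in $F$ (\<open>relatively_projective_sign_module_iff\<close>).

By the Lucas theorem for Gaussian binomials at a root of unity, together with the classical one,
the coefficient is nonzero if and only if the parts of $\nu$ can be added without carry in the
$e$-$p$-adic system (\<open>gauss_list_nonzero_iff_digits\<close>).  The parts of the standard composition
$\lambda$ add without carry by its very definition.  Conversely, if the parts of $\kappa$ add without
carry, then the digits of $n$ are the sums of the digits of the parts $\kappa_m$, so the parts of
$\lambda$ can be distributed over the parts of $\kappa$ in such a way that those given to $\kappa_m$
have sum $\kappa_m$; a permutation that carries the blocks of $\lambda$ into blocks of $\kappa$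
accordingly conjugates $\mathfrak{S}_\lambda$ into $\mathfrak{S}_\kappa$
(\<open>standard_parabolic_conj_subset\<close>).

For sufficiency, the coset sum is written as an explicit element of $\mathcal{H}_n$
(\<open>multishuffle\<close>), built by merging the
blocks one at a time and, for two blocks, by a recursion that mirrors the Pascal rule of Gaussian
binomials.  The defining relations of the Hecke algebra show that it turns a vector that is of sign type for
$\mathfrak{S}_\nu$ into one that is of sign type for $\mathfrak{S}_n$ (\<open>sign_on_multishuffle\<close>).
For necessity, a lower bound on the size of the induced module is needed, and the action of
$\mathcal{H}_n$ on functions of words provides it: the induced module maps to this module, with
$v \otimes 1$ going to the indicator $\delta_u$ of the sorted word $u$ with $\nu_j$ letters $j$.  For a
form that makes the $T_i$ self-adjoint, pairing any $\varphi h$ with a sign vector $\psi$ gives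
$\varepsilon(h) \langle \varphi, \psi \rangle$, where $\varepsilon(T_i) = -1$.  If $v \otimes h$ is a
sign vector of the induced module and $z$ is the explicit element, then both $\delta_u h$ and
$\delta_u z$ are sign vectors, and computing their pairing in two ways gives
$\varepsilon(h) \cdot (\delta_u z)(u) = \varepsilon(z) \cdot (\delta_u h)(u)$.  Here
$(\delta_u z)(u) \neq 0$, and $\varepsilon(z)$ is the multinomial coefficient; if it vanishes, so does
$\varepsilon(h)$, and evaluation kills the image of every homomorphism from $M$
(\<open>gauss_if_relatively_projective\<close>).\<close>

section \<open>Gaussian binomial coefficients at a root of unity\<close>

lemma all_nat_split: "(\<forall>i. P i) \<longleftrightarrow> P 0 \<and> (\<forall>i. P (Suc i))"
  by (metis not0_implies_Suc)

text \<open>The Gaussian binomial coefficient as an element of the ring, by its Pascal rule: quotients of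
  quantum factorials would be of the form $0/0$ at a root of unity.\<close>

fun gauss :: "'a::comm_ring_1 \<Rightarrow> nat \<Rightarrow> nat \<Rightarrow> 'a" where
  "gauss q n 0 = 1"
| "gauss q 0 (Suc k) = 0"
| "gauss q (Suc n) (Suc k) = gauss q n k + q ^ Suc k * gauss q n (Suc k)"

lemma gauss_eq_0: "n < k \<Longrightarrow> gauss q n k = 0"
  by (induction q n k rule: gauss.induct) auto

lemma gauss_self [simp]: "gauss q n n = 1"
  by (induction n) (auto simp: gauss_eq_0)

lemma gauss_one: "gauss 1 n k = of_nat (n choose k)"
  by (induction "1::'a" n k rule: gauss.induct) (auto simp: add.commute)

definition qint :: "'a::comm_ring_1 \<Rightarrow> nat \<Rightarrow> 'a" where
  "qint q n = (\<Sum>i<n. q ^ i)"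

definition qfact :: "'a::comm_ring_1 \<Rightarrow> nat \<Rightarrow> 'a" where
  "qfact q n = (\<Prod>i<n. qint q (Suc i))"

lemma qint_add: "qint q (m + n) = qint q m + q ^ m * qint q n"
  by (induction n) (auto simp: qint_def algebra_simps power_add)

text \<open>Division-free form of the factorial formula.  It decides which coefficients with upper index
  at most the quantum characteristic $e$ vanish, since the quantum integers below $e$ are units and
  $[e] = 0$.\<close>

lemma gauss_qfact: "gauss q (a + b) a * qfact q a * qfact q b = qfact q (a + b)"
proof (induction "a + b" arbitrary: a b)
  case 0
  then show ?case by (simp add: qfact_def)
next
  case (Suc n)
  have F: "qfact q (Suc m) = qfact q m * qint q (Suc m)" for m
    by (simp add: qfact_def)
  show ?case
  proof (cases "a = 0 \<or> b = 0")
    case True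
    then show ?thesis by (auto simp: qfact_def)
  next
    case False
    then obtain c d where cd: "a = Suc c" "b = Suc d" by (metis not0_implies_Suc)
    have 1: "gauss q (c + Suc d) c * qfact q c * qfact q (Suc d) = qfact q (c + Suc d)"
      and 2: "gauss q (Suc c + d) (Suc c) * qfact q (Suc c) * qfact q d = qfact q (Suc c + d)"
      using Suc.hyps(1)[of c "Suc d"] Suc.hyps(1)[of "Suc c" d] Suc.hyps(2) cd by simp_all
    have "gauss q (a + b) a * qfact q a * qfact q b
       = qint q (Suc c) * (gauss q (c + Suc d) c * qfact q c * qfact q (Suc d))
        + q ^ Suc c * qint q (Suc d) * (gauss q (Suc c + d) (Suc c) * qfact q (Suc c) * qfact q d)"
      by (simp add: cd F algebra_simps)
    also have "\<dots> = qfact q (c + Suc d) * qint q (Suc c + Suc d)"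
      unfolding 1 2 qint_add by (simp add: algebra_simps)
    finally show ?thesis by (simp add: cd F)
  qed
qed

context
  fixes q :: "'a::field" and e :: nat
  assumes qe: "quantum_characteristic q e"
begin

lemma qc_pos: "0 < e" and qc_zero: "qint q e = 0"
  and qc_min: "\<And>k. 0 < k \<Longrightarrow> k < e \<Longrightarrow> qint q k \<noteq> 0"
  using qe unfolding quantum_characteristic_def is_arg_min_def qint_def by auto

lemma qfact_nonzero: "k < e \<Longrightarrow> qfact q k \<noteq> 0"
  using qc_min by (auto simp: qfact_def)

lemma gauss_nonzero: "a + b < e \<Longrightarrow> gauss q (a + b) a \<noteq> 0"
  using gauss_qfact[of q a b] qfact_nonzero[of "a + b"] by auto

lemma gauss_qc: 
  assumes "0 < k" "k < e" shows "gauss q e k = 0"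
proof -
  have "gauss q (k + (e - k)) k * qfact q k * qfact q (e - k) = qfact q e"
    using gauss_qfact[of q k "e - k"] assms by simp
  moreover have "qfact q e = 0"
    using qc_zero qc_pos unfolding qfact_def by (auto intro!: bexI[of _ "e - 1"])
  ultimately show ?thesis
    using assms qfact_nonzero[of k] qfact_nonzero[of "e - k"] by auto
qed

lemma power_qc: "q ^ e = 1"
  using qc_zero qint_add[of q 1 e] qint_add[of q e 1] by (simp add: qint_def)

text \<open>The shadow of $(X+Y)^{m+e} = (X+Y)^m (X^e + Y^e)$ for variables with $YX = qXY$.  The Pascal
  rule propagates the identity from $m$ to $m + 1$ because $q^e = 1$, and $m = 0$ is the vanishing
  of the inner coefficients with upper index $e$.\<close>

lemma gauss_add_qc:
  "gauss q (m + e) k = gauss q m k + (if k < e then 0 else gauss q m (k - e))"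
proof (induction m arbitrary: k)
  case 0
  then show ?case
    using gauss_qc[of k] qc_pos by (cases k "0::nat" rule: linorder_cases; cases k e rule: linorder_cases)
      (auto simp: gauss_eq_0)
next
  case (Suc m)
  show ?case
  proof (cases k)
    case 0
    then show ?thesis using qc_pos by simp
  next
    case (Suc j)
    have I: "gauss q (Suc m + e) (Suc j)
       = gauss q (Suc m) (Suc j) + (if j < e then 0 else gauss q m (j - e))
         + q ^ Suc j * (if Suc j < e then 0 else gauss q m (Suc j - e))"
    proof -
      have "gauss q (Suc m + e) (Suc j) = gauss q (m + e) j + q ^ Suc j * gauss q (m + e) (Suc j)"
        by simp
      then show ?thesis unfolding Suc.IH by (simp add: algebra_simps)
    qed
    consider "Suc j < e" | "Suc j = e" | "j \<ge> e" by linarith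
    then show ?thesis
    proof cases
      case 3
      then have "q ^ Suc j = q ^ Suc (j - e)"
        using power_qc power_add[of q "Suc (j - e)" e] by simp
      with 3 show ?thesis unfolding Suc I by (simp add: Suc_diff_le)
    next
      case 1
      then show ?thesis unfolding Suc I by simp
    next
      case 2
      then show ?thesis unfolding Suc I using power_qc by (simp flip: 2)
    qed
  qed
qed

text \<open>Adding $e$ to the upper index acts on the quotients by $e$ as the ordinary Pascal rule, so the
  quotients contribute an ordinary binomial coefficient.\<close>

lemma q_Lucas:
  assumes "r < e" "s < e"
  shows "gauss q (x * e + r) (y * e + s) = of_nat (x choose y) * gauss q r s"
proof (induction x arbitrary: y)
  case 0
  then show ?case using assms qc_pos
    by (cases y) (auto simp: gauss_eq_0)
next
  case (Suc x)
  show ?case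
  proof (cases y)
    case 0
    then show ?thesis using Suc.IH[of 0] assms gauss_add_qc[of "x * e + r" s]
      by (simp add: algebra_simps)
  next
    case (Suc z)
    have "gauss q (Suc x * e + r) (y * e + s) = gauss q (x * e + r + e) (Suc z * e + s)"
      by (simp add: Suc algebra_simps)
    also have "\<dots> = gauss q (x * e + r) (Suc z * e + s) + gauss q (x * e + r) (z * e + s)"
      by (subst gauss_add_qc) simp
    finally show ?thesis unfolding Suc.IH by (simp add: Suc algebra_simps)
  qed
qed

text \<open>A carry in the last digit makes the remainder of $a + b$ smaller than that of $a$, and the
  Gaussian factor of the Lucas formula then vanishes.\<close>

lemma gauss_nonzero_iff:
  "gauss q (a + b) a \<noteq> 0 \<longleftrightarrow>
     a mod e + b mod e < e \<and> (of_nat ((a div e + b div e) choose (a div e)) :: 'a) \<noteq> 0"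
proof -
  have r: "a mod e < e" "b mod e < e" using qc_pos by auto
  have a: "a = a div e * e + a mod e" and b: "b = b div e * e + b mod e" by auto
  show ?thesis
  proof (cases "a mod e + b mod e < e")
    case True
    have "gauss q (a + b) a = gauss q ((a div e + b div e) * e + (a mod e + b mod e)) (a div e * e + a mod e)"
    proof -
      have "a + b = (a div e + b div e) * e + (a mod e + b mod e)"
        unfolding add_mult_distrib by (subst add.assoc, subst add.left_commute[of _ "a mod e"]) (simp flip: add.assoc)
      then show ?thesis by simp
    qed
    also have "\<dots> = of_nat ((a div e + b div e) choose (a div e)) * gauss q (a mod e + b mod e) (a mod e)"
      by (rule q_Lucas) (use True r in auto)
    finally show ?thesis using True gauss_nonzero[OF True] by simp
  next
    case False
    define t where "t = a mod e + b mod e - e"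
    have t: "a mod e + b mod e = e + t" "t < a mod e" using False r by (auto simp: t_def)
    have "gauss q (a + b) a = gauss q ((a div e + b div e + 1) * e + t) (a div e * e + a mod e)"
    proof -
      have "a + b = (a div e + b div e) * e + (a mod e + b mod e)"
        unfolding add_mult_distrib by (subst add.assoc, subst add.left_commute[of _ "a mod e"]) (simp flip: add.assoc)
      then show ?thesis unfolding t by (simp add: algebra_simps)
    qed
    also have "\<dots> = 0"
      using gauss_eq_0[OF t(2), of q] by (subst q_Lucas[OF less_trans[OF t(2) r(1)] r(1)]) simp
    finally show ?thesis using False by simp
  qed
qed

end

text \<open>This makes the classical theorem of Lucas an instance of the quantum one.\<close>

lemma quantum_characteristic_one:
  assumes "prime p" "CHAR('a::field) = p"
  shows "quantum_characteristic (1::'a) p"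
proof -
  have "(of_nat k :: 'a) = 0 \<longleftrightarrow> p dvd k" for k
    using assms(2) of_nat_eq_0_iff_char_dvd by blast
  then show ?thesis
    using assms(1) prime_gt_0_nat[of p] unfolding quantum_characteristic_def is_arg_min_def
    by (auto dest: nat_dvd_not_less)
qed

text \<open>Digit $0$ is the coefficient with index $-1$ of the $e$-$p$-adic expansion, and digit $i + 1$
  is the one with index $i$.\<close>

definition ep_digit :: "nat \<Rightarrow> nat \<Rightarrow> nat \<Rightarrow> nat \<Rightarrow> nat" where
  "ep_digit e p d n = (case d of 0 \<Rightarrow> n mod e | Suc i \<Rightarrow> n div e div p ^ i mod p)"

definition ep_base :: "nat \<Rightarrow> nat \<Rightarrow> nat \<Rightarrow> nat" where
  "ep_base e p d = (case d of 0 \<Rightarrow> e | Suc i \<Rightarrow> p)"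

lemma choose_nonzero_iff:
  assumes "prime p" "CHAR('a::field) = p"
  shows "(of_nat ((a + b) choose a) :: 'a) \<noteq> 0 \<longleftrightarrow> (\<forall>i. a div p ^ i mod p + b div p ^ i mod p < p)"
proof (induction "a + b" arbitrary: a b rule: less_induct)
  case less
  have p: "p > 1" using assms(1) by (rule prime_gt_1_nat)
  show ?case
  proof (cases "a + b = 0")
    case True
    then show ?thesis using p by simp
  next
    case False
    have split: "(\<forall>i. a div p ^ i mod p + b div p ^ i mod p < p) \<longleftrightarrow>
      a mod p + b mod p < p \<and> (\<forall>i. a div p div p ^ i mod p + b div p div p ^ i mod p < p)"
      by (subst all_nat_split) (simp add: div_mult2_eq)
    have "a div p + b div p < a + b"
    proof (cases "a = 0")
      case True
      then show ?thesis using False p by simp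
    next
      case False
      then have "a div p < a" using p by simp
      moreover have "b div p \<le> b" by simp
      ultimately show ?thesis by linarith
    qed
    from less[OF this] show ?thesis
      using gauss_nonzero_iff[OF quantum_characteristic_one[OF assms], of a b]
      unfolding gauss_one split by blast
  qed
qed

lemma add_div_mod_power:
  fixes x y p :: nat
  assumes "p > 0" and "\<And>i. x div p ^ i mod p + y div p ^ i mod p < p"
  shows "(x + y) div p ^ i = x div p ^ i + y div p ^ i"
proof (induction i)
  case (Suc i)
  have "(x + y) div p ^ Suc i = (x + y) div p ^ i div p"
    by (simp only: power_Suc2 div_mult2_eq)
  also have "\<dots> = x div p ^ i div p + y div p ^ i div p"
    unfolding Suc using assms(2)[of i] by (subst div_add1_eq) simp
  finally show ?case by (simp only: power_Suc2 div_mult2_eq)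
qed simp

lemma ep_digit_add:
  assumes "e > 0" "p > 0" and nc: "\<And>d. ep_digit e p d x + ep_digit e p d y < ep_base e p d"
  shows "ep_digit e p d (x + y) = ep_digit e p d x + ep_digit e p d y"
proof (cases d)
  case 0
  then show ?thesis
    using nc[of 0] mod_less[of "x mod e + y mod e" e] by (simp add: ep_digit_def ep_base_def mod_add_eq)
next
  case (Suc i)
  have 0: "(x + y) div e = x div e + y div e"
    using nc[of 0] by (subst div_add1_eq) (simp add: ep_digit_def ep_base_def)
  have nc': "x div e div p ^ i mod p + y div e div p ^ i mod p < p" for i
    using nc[of "Suc i"] by (simp add: ep_digit_def ep_base_def)
  show ?thesis
    using add_div_mod_power[OF assms(2) nc', of i] mod_less[OF nc'[of i]]
    by (simp add: Suc ep_digit_def 0 mod_add_eq)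
qed

lemma gauss_nonzero_iff_digits:
  assumes "prime p" "CHAR('a::field) = p" "quantum_characteristic (q::'a) e"
  shows "gauss q (a + b) a \<noteq> 0 \<longleftrightarrow>
    (\<forall>d. ep_digit e p d a + ep_digit e p d b < ep_base e p d)"
  unfolding gauss_nonzero_iff[OF assms(3)] choose_nonzero_iff[OF assms(1,2)]
  by (subst (2) all_nat_split) (simp add: ep_digit_def ep_base_def)

text \<open>The Gaussian multinomial coefficient of the parts \<open>m, k, ...\<close>, as a product of binomial
  coefficients that join the parts to the first one from left to right.\<close>

fun gauss_list :: "'a::comm_ring_1 \<Rightarrow> nat \<Rightarrow> nat list \<Rightarrow> 'a" where
  "gauss_list q m [] = 1"
| "gauss_list q m (k # ks) = gauss q (m + k) m * gauss_list q (m + k) ks"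

text \<open>If no column of the whole list overflows, then none overflows at an intermediate sum; if one
  factor has a carry, then so has the list, as digit sums only grow.\<close>

lemma gauss_list_nonzero_iff_digits:
  assumes "prime p" "CHAR('a::field) = p" "quantum_characteristic (q::'a) e"
  shows "gauss_list q m ks \<noteq> 0 \<longleftrightarrow>
    (\<forall>d. ep_digit e p d m + (\<Sum>k\<leftarrow>ks. ep_digit e p d k) < ep_base e p d)"
    and "gauss_list q m ks \<noteq> 0 \<Longrightarrow>
    ep_digit e p d (m + sum_list ks) = ep_digit e p d m + (\<Sum>k\<leftarrow>ks. ep_digit e p d k)"
proof -
  have e: "e > 0" using qc_pos[OF assms(3)] .
  have p: "p > 0" using assms(1) by (rule prime_gt_0_nat)
  have base: "ep_digit e p d x < ep_base e p d" for d x
    using e p by (auto simp: ep_digit_def ep_base_def split: nat.split)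
  have add: "ep_digit e p d (m + k) = ep_digit e p d m + ep_digit e p d k"
    if "gauss q (m + k) m \<noteq> 0" for d m k
    using that ep_digit_add[OF e p] unfolding gauss_nonzero_iff_digits[OF assms] by blast
  show "gauss_list q m ks \<noteq> 0 \<longleftrightarrow>
    (\<forall>d. ep_digit e p d m + (\<Sum>k\<leftarrow>ks. ep_digit e p d k) < ep_base e p d)"
  proof (induction ks arbitrary: m)
    case Nil
    then show ?case using base by simp
  next
    case (Cons k ks)
    show ?case
    proof (cases "gauss q (m + k) m = 0")
      case False
      then show ?thesis using Cons[of "m + k"] by (simp add: add[OF False] add.assoc)
    next
      case True
      then obtain d where "\<not> ep_digit e p d m + ep_digit e p d k < ep_base e p d"
        using gauss_nonzero_iff_digits[OF assms, of m k] by blast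
      then have "\<not> ep_digit e p d m + (\<Sum>k\<leftarrow>k # ks. ep_digit e p d k) < ep_base e p d"
        by simp
      then show ?thesis using True by force
    qed
  qed
  show "ep_digit e p d (m + sum_list ks) = ep_digit e p d m + (\<Sum>k\<leftarrow>ks. ep_digit e p d k)"
    if "gauss_list q m ks \<noteq> 0"
    using that
  proof (induction ks arbitrary: m)
    case (Cons k ks)
    then show ?case using Cons.IH[of "m + k"] add[of m k] by (auto simp: add.assoc)
  qed simp
qed

section \<open>Inversions and reduced expressions\<close>

text \<open>Defined for arbitrary words on the positions $1, \dots, n$, not only for permutations: applied
  to inverses of permutations it is the Coxeter length, and applied to words with repeated letters it
  gives the weights of an invariant form.\<close>

definition word_inversions :: "nat \<Rightarrow> (nat \<Rightarrow> nat) \<Rightarrow> nat" where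
  "word_inversions n g = card {(i, j). 1 \<le> i \<and> i < j \<and> j \<le> n \<and> g j < g i}"

lemma word_inversions_id [simp]: "word_inversions n id = 0"
proof -
  have "{(i, j). 1 \<le> i \<and> i < j \<and> j \<le> n \<and> id j < id i} = {}" by auto
  then show ?thesis unfolding word_inversions_def by (simp only: card.empty)
qed

text \<open>Swapping two adjacent positions permutes all pairs of positions other than these two.\<close>

lemma word_inversions_swap:
  assumes "k \<in> {1..<n}" "g k < g (k + 1)"
  shows "word_inversions n (g \<circ> transpose k (k + 1)) = Suc (word_inversions n g)"
proof -
  let ?s = "transpose k (k + 1)"
  define A where "A h = {(i, j). 1 \<le> i \<and> i < j \<and> j \<le> n \<and> h j < h i}" for h :: "nat \<Rightarrow> nat"
  have fin: "finite (A h)" for h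
    by (rule finite_subset[of _ "{..n} \<times> {..n}"]) (auto simp: A_def)
  have s: "?s i < ?s j" if "i < j" "(i, j) \<noteq> (k, k + 1)" for i j
    using that by (auto simp: transpose_def)
  have r: "1 \<le> ?s i \<and> ?s i \<le> n" if "1 \<le> i" "i \<le> n" for i
    using that assms(1) by (auto simp: transpose_def)
  have ss: "?s (?s i) = i" for i
    by simp
  have "A (g \<circ> ?s) = insert (k, k + 1) (map_prod ?s ?s ` A g)"
  proof (intro equalityI subsetI)
    fix x assume "x \<in> A (g \<circ> ?s)"
    then obtain i j where x: "x = (i, j)" "1 \<le> i" "i < j" "j \<le> n" "g (?s j) < g (?s i)"
      by (auto simp: A_def)
    show "x \<in> insert (k, k + 1) (map_prod ?s ?s ` A g)"
    proof (cases "x = (k, k + 1)")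
      case False
      then have "(?s i, ?s j) \<in> A g" using x s[of i j] r[of i] r[of j] by (auto simp: A_def)
      moreover have "x = map_prod ?s ?s (?s i, ?s j)" by (simp add: x)
      ultimately show ?thesis by blast
    qed simp
  next
    fix x assume x: "x \<in> insert (k, k + 1) (map_prod ?s ?s ` A g)"
    show "x \<in> A (g \<circ> ?s)"
    proof (cases "x = (k, k + 1)")
      case True
      then show ?thesis using assms by (auto simp: A_def)
    next
      case False
      then obtain i j where ij: "(i, j) \<in> A g" "x = (?s i, ?s j)" using x by auto
      have "(i, j) \<noteq> (k, k + 1)" using ij(1) assms(2) by (auto simp: A_def)
      then have "?s i < ?s j" using s[of i j] ij(1) by (auto simp: A_def)
      then show ?thesis
        using ij r[of i] r[of j] by (auto simp: A_def)
    qed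
  qed
  moreover have "(k, k + 1) \<notin> map_prod ?s ?s ` A g"
  proof
    assume "(k, k + 1) \<in> map_prod ?s ?s ` A g"
    then obtain i j where ij: "(i, j) \<in> A g" "k = ?s i" "k + 1 = ?s j" by auto
    then have "i = k + 1" "j = k" by (metis ss transpose_apply_first, metis ss transpose_apply_second)
    then show False using ij(1) unfolding A_def by simp
  qed
  moreover have "inj_on (map_prod ?s ?s) (A g)"
    by (rule inj_on_subset[OF prod.inj_map]) auto
  ultimately have "card (A (g \<circ> ?s)) = Suc (card (A g))"
    using fin by (simp add: card_image)
  then show ?thesis
    unfolding A_def word_inversions_def .
qed

lemma word_inversions_swap_le:
  assumes "k \<in> {1..<n}" "inj g"
  shows "word_inversions n (g \<circ> transpose k (k + 1)) \<le> Suc (word_inversions n g)"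
proof (cases "g k < g (k + 1)")
  case True
  then show ?thesis using word_inversions_swap[OF assms(1)] by simp
next
  case False
  then have "g (k + 1) < g k" using assms(2) by (metis injD n_not_Suc_n Suc_eq_plus1 linorder_neqE_nat)
  then show ?thesis
    using word_inversions_swap[OF assms(1), of "g \<circ> transpose k (k + 1)"] by (simp add: comp_assoc)
qed

lemma ex_descent:
  assumes v: "v permutes {1..n::nat}" and "v \<noteq> id"
  shows "\<exists>k\<in>{1..<n}. v (k + 1) < v k"
proof (rule ccontr)
  assume "\<not> ?thesis"
  then have asc: "v k < v (k + 1)" if "k \<in> {1..<n}" for k
    using that permutes_inj[OF v] by (metis injD n_not_Suc_n Suc_eq_plus1 linorder_neqE_nat)
  have range: "v i \<in> {1..n}" if "i \<in> {1..n}" for i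
    using permutes_in_image[OF v] that by blast
  have lower: "i \<le> v i" if "1 \<le> i" "i \<le> n" for i
    using that
  proof (induction i rule: dec_induct)
    case (step m)
    then show ?case using asc[of m] by simp
  qed (use range in auto)
  have upper: "v i \<le> i" if "i \<le> n" "1 \<le> i" for i
    using that
  proof (induction i rule: inc_induct)
    case (step m)
    then show ?case using asc[of m] by simp
  qed (use range in auto)
  have "v i = i" for i
    using lower[of i] upper[of i] permutes_not_in[OF v, of i] by (cases "i \<in> {1..n}") auto
  then show False using assms(2) by auto
qed

lemma expr_perm_Nil: "expr_perm [] = id"
  unfolding expr_perm_def by (simp add: fun_eq_iff)

lemma expr_perm_Cons: "expr_perm (i # is) = transpose i (i + 1) \<circ> expr_perm is"
  by (simp add: expr_perm_def)

lemma expr_perm_permutes: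
  "set is \<subseteq> {1..<n} \<Longrightarrow> expr_perm is permutes {1..n}"
proof (induction "is")
  case Nil
  show ?case unfolding expr_perm_Nil by (rule permutes_id)
next
  case (Cons i "is")
  then show ?case
    unfolding expr_perm_Cons by (intro permutes_compose permutes_swap_id) auto
qed

lemma inv_expr_perm_Cons:
  assumes "set is \<subseteq> {1..<n}"
  shows "Hilbert_Choice.inv (expr_perm (i # is)) =
    Hilbert_Choice.inv (expr_perm is) \<circ> transpose i (i + 1)"
  using permutes_bij[OF expr_perm_permutes[OF assms]]
  unfolding expr_perm_Cons by (subst o_inv_distrib) auto

lemma word_inversions_le_length:
  "set is \<subseteq> {1..<n} \<Longrightarrow> word_inversions n (Hilbert_Choice.inv (expr_perm is)) \<le> length is"
proof (induction "is")
  case Nil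
  then show ?case unfolding expr_perm_Nil inv_id word_inversions_id by simp
next
  case (Cons i "is")
  then have "inj (Hilbert_Choice.inv (expr_perm is))"
    using expr_perm_permutes[of "is" n] permutes_inj permutes_inv by auto
  then show ?case
    using Cons word_inversions_swap_le[of i n "Hilbert_Choice.inv (expr_perm is)"]
    by (subst inv_expr_perm_Cons) auto
qed

text \<open>Bubble sort of the inverse permutation.\<close>

lemma ex_expr_length_inversions:
  "w permutes {1..n} \<Longrightarrow>
    \<exists>is. set is \<subseteq> {1..<n} \<and> expr_perm is = w \<and> length is = word_inversions n (Hilbert_Choice.inv w)"
proof (induction "word_inversions n (Hilbert_Choice.inv w)" arbitrary: w rule: less_induct)
  case less
  let ?v = "Hilbert_Choice.inv w"
  have v: "?v permutes {1..n}" using less.prems by (rule permutes_inv)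
  show ?case
  proof (cases "?v = id")
    case True
    then have "w = id" using permutes_inv_inv[OF less.prems] by (metis inv_id)
    then show ?thesis by (intro exI[of _ "[]"]) (simp only: expr_perm_Nil inv_id word_inversions_id, simp)
  next
    case False
    then obtain k where k: "k \<in> {1..<n}" "?v (k + 1) < ?v k" using ex_descent[OF v] by blast
    let ?s = "transpose k (k + 1)"
    have s: "?s permutes {1..n}" using k by (intro permutes_swap_id) auto
    have inv: "Hilbert_Choice.inv (?s \<circ> w) = ?v \<circ> ?s"
      using permutes_bij[OF less.prems] by (subst o_inv_distrib) auto
    have "Suc (word_inversions n (?v \<circ> ?s)) = word_inversions n ?v"
      using word_inversions_swap[OF k(1), of "?v \<circ> ?s"] k(2) by (simp add: comp_assoc)
    moreover have "?s \<circ> w permutes {1..n}" by (rule permutes_compose[OF less.prems s])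
    ultimately obtain "is" where "set is \<subseteq> {1..<n}" "expr_perm is = ?s \<circ> w"
      "length is = word_inversions n (?v \<circ> ?s)"
      using less.hyps[of "?s \<circ> w"] inv by auto
    then show ?thesis
      using k \<open>Suc _ = _\<close> by (intro exI[of _ "k # is"]) (auto simp: expr_perm_Cons fun_eq_iff)
  qed
qed

lemma reduced_expr_length:
  assumes "reduced_expr n w is"
  shows "length is = word_inversions n (Hilbert_Choice.inv w)"
proof -
  have w: "set is \<subseteq> {1..<n}" "expr_perm is = w"
    using assms by (auto simp: reduced_expr_def is_arg_min_def)
  then obtain js where js: "set js \<subseteq> {1..<n}" "expr_perm js = w"
    "length js = word_inversions n (Hilbert_Choice.inv w)"
    using ex_expr_length_inversions[of w n] expr_perm_permutes by blast
  then have "length is \<le> length js"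
    using assms by (auto simp: reduced_expr_def is_arg_min_def not_less)
  then show ?thesis using js(3) word_inversions_le_length[OF w(1)] unfolding w(2) by linarith
qed

lemma reduced_expr_iff:
  "reduced_expr n w is \<longleftrightarrow> set is \<subseteq> {1..<n} \<and> expr_perm is = w \<and>
     length is = word_inversions n (Hilbert_Choice.inv w)"
proof
  assume "reduced_expr n w is"
  then show "set is \<subseteq> {1..<n} \<and> expr_perm is = w \<and>
     length is = word_inversions n (Hilbert_Choice.inv w)"
    using reduced_expr_length[of n w "is"] unfolding reduced_expr_def is_arg_min_def by blast
next
  assume "set is \<subseteq> {1..<n} \<and> expr_perm is = w \<and>
     length is = word_inversions n (Hilbert_Choice.inv w)"
  then show "reduced_expr n w is"
    using word_inversions_le_length[of _ n] unfolding reduced_expr_def is_arg_min_def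
    by (metis not_less)
qed

text \<open>If the first letter did not create a new inversion, then the rest of the expression would have
  to be shorter than the number of inversions it produces.\<close>

lemma reduced_expr_Cons:
  assumes "reduced_expr n w (i # is)"
  shows "i \<in> {1..<n}" "w = transpose i (i + 1) \<circ> expr_perm is"
    and "reduced_expr n (expr_perm is) is"
    and "Hilbert_Choice.inv w (i + 1) < Hilbert_Choice.inv w i"
proof -
  let ?v = "Hilbert_Choice.inv w" and ?u = "Hilbert_Choice.inv (expr_perm is)"
  have w: "set is \<subseteq> {1..<n}" "i \<in> {1..<n}" "w = expr_perm (i # is)"
    and len: "Suc (length is) = word_inversions n ?v"
    using assms unfolding reduced_expr_iff by auto
  show "i \<in> {1..<n}" "w = transpose i (i + 1) \<circ> expr_perm is"
    using w by (auto simp: expr_perm_Cons)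
  have v: "?v = ?u \<circ> transpose i (i + 1)"
    unfolding w(3) by (rule inv_expr_perm_Cons[OF w(1)])
  have inj: "inj ?u"
    using expr_perm_permutes[OF w(1)] permutes_inj permutes_inv by blast
  have le: "word_inversions n ?u \<le> length is" by (rule word_inversions_le_length[OF w(1)])
  moreover have "word_inversions n ?v \<le> Suc (word_inversions n ?u)"
    unfolding v by (rule word_inversions_swap_le[OF w(2) inj])
  ultimately show "reduced_expr n (expr_perm is) is"
    unfolding reduced_expr_iff using w len by auto
  have ne: "?u i \<noteq> ?u (i + 1)" using inj by (metis injD n_not_Suc_n Suc_eq_plus1)
  have "\<not> ?u (i + 1) < ?u i"
  proof
    assume "?u (i + 1) < ?u i"
    then have "word_inversions n (?v \<circ> transpose i (i + 1)) = Suc (word_inversions n ?v)"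
      by (intro word_inversions_swap[OF w(2)]) (simp add: v)
    then show False using le len by (simp add: v comp_assoc)
  qed
  then show "?v (i + 1) < ?v i" using ne by (auto simp: v)
qed

lemma reduced_expr_adjacent:
  assumes "i \<in> {1..<n}"
  shows "reduced_expr n (transpose i (i + 1)) is \<longleftrightarrow> is = [i]"
proof -
  have len: "word_inversions n (transpose i (i + 1)) = 1"
  proof -
    show ?thesis
      using word_inversions_swap[of i n id] assms by simp
  qed
  have "is = [i]" if "length is = 1" "expr_perm is = transpose i (i + 1)"
  proof -
    obtain j where j: "is = [j]" using \<open>length is = 1\<close> by (auto simp: length_Suc_conv)
    have eq: "transpose j (j + 1) = transpose i (i + 1)"
      using that(2) unfolding j expr_perm_Cons expr_perm_Nil by simp
    have "transpose j (j + 1) i = i + 1"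
      unfolding eq by simp
    then have "j = i"
      by (cases "i = j"; cases "i = j + 1") (auto simp: transpose_def)
    then show ?thesis using j by simp
  qed
  then show ?thesis
    unfolding reduced_expr_iff using assms len
    by (auto simp: expr_perm_Cons expr_perm_Nil)
qed

lemma reduced_expr_id: "reduced_expr n id is \<longleftrightarrow> is = []"
  unfolding reduced_expr_iff inv_id word_inversions_id using expr_perm_Nil by auto

section \<open>Blocks and parabolic subgroups\<close>

text \<open>As a word on the positions, this is the sorted word with $\nu_j$ letters $j$ for each $j$
  (counted from $0$).  The minimum exists for positions up to the sum of $\nu$ only.\<close>

definition block_index :: "nat list \<Rightarrow> nat \<Rightarrow> nat" where
  "block_index \<nu> i = (LEAST j. i \<le> sum_list (take (Suc j) \<nu>))"

lemma sum_list_take_mono: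
  "i \<le> j \<Longrightarrow> sum_list (take i \<nu>) \<le> sum_list (take j (\<nu> :: nat list))"
  by (metis le_add1 min.absorb1 sum_list_append take_add take_take nat_le_iff_add)

lemma block_index_eq: "i \<in> block \<nu> j \<Longrightarrow> block_index \<nu> i = j"
  unfolding block_index_def
proof (rule Least_equality)
  fix k assume "i \<in> block \<nu> j" "i \<le> sum_list (take (Suc k) \<nu>)"
  then have "sum_list (take j \<nu>) < sum_list (take (Suc k) \<nu>)" by (auto simp: block_def)
  then show "j \<le> k" using sum_list_take_mono[of "Suc k" j \<nu>] by (meson not_less not_less_eq_eq)
qed (auto simp: block_def)

lemma block_index_block:
  assumes "i \<in> {1..sum_list \<nu>}"
  shows "block_index \<nu> i < length \<nu>" "i \<in> block \<nu> (block_index \<nu> i)"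
proof -
  let ?P = "\<lambda>j. i \<le> sum_list (take (Suc j) \<nu>)"
  have ne: "\<nu> \<noteq> []" using assms by auto
  then have "?P (length \<nu> - 1)" using assms by simp
  then have "?P (block_index \<nu> i)" and le: "block_index \<nu> i \<le> length \<nu> - 1"
    unfolding block_index_def by (rule LeastI, rule Least_le)
  moreover have "sum_list (take (block_index \<nu> i) \<nu>) < i"
  proof (cases "block_index \<nu> i")
    case 0
    then show ?thesis using assms by simp
  next
    case (Suc j)
    then have "\<not> ?P j" unfolding block_index_def by (intro not_less_Least) simp
    then show ?thesis using Suc by simp
  qed
  ultimately show "i \<in> block \<nu> (block_index \<nu> i)" by (simp add: block_def)
  show "block_index \<nu> i < length \<nu>" using le ne by (cases \<nu>) auto
qed

lemma block_index_mono:
  assumes "i \<le> j" "j \<le> sum_list \<nu>"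
  shows "block_index \<nu> i \<le> block_index \<nu> j"
  unfolding block_index_def[of \<nu> i]
proof (rule Least_le)
  show "i \<le> sum_list (take (Suc (block_index \<nu> j)) \<nu>)"
    using block_index_block(2)[of j \<nu>] assms by (cases "j = 0") (auto simp: block_def)
qed

lemma block_subset: "block \<nu> j \<subseteq> {1..sum_list \<nu>}"
  using sum_list_take_mono[of "Suc j" "max (Suc j) (length \<nu>)" \<nu>] by (auto simp: block_def)

lemma block_iff: "j < length \<nu> \<Longrightarrow> i \<in> block \<nu> j \<longleftrightarrow> i \<in> {1..sum_list \<nu>} \<and> block_index \<nu> i = j"
  using block_index_eq block_index_block block_subset by blast

lemma card_block: "j < length \<nu> \<Longrightarrow> card (block \<nu> j) = \<nu> ! j"
  by (simp add: block_def take_Suc_conv_app_nth)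

lemma parabolic_iff:
  "w \<in> parabolic \<nu> \<longleftrightarrow> w permutes {1..sum_list \<nu>} \<and>
     (\<forall>i\<in>{1..sum_list \<nu>}. block_index \<nu> (w i) = block_index \<nu> i)"
proof (intro iffI conjI ballI)
  fix i assume w: "w \<in> parabolic \<nu>" and i: "i \<in> {1..sum_list \<nu>}"
  then have "w i \<in> block \<nu> (block_index \<nu> i)"
    using block_index_block[OF i] by (auto simp: parabolic_def)
  then show "block_index \<nu> (w i) = block_index \<nu> i" by (rule block_index_eq)
next
  assume w: "w permutes {1..sum_list \<nu>} \<and> (\<forall>i\<in>{1..sum_list \<nu>}. block_index \<nu> (w i) = block_index \<nu> i)"
  have "w ` block \<nu> j = block \<nu> j" if j: "j < length \<nu>" for j
  proof (rule card_subset_eq)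
    show "finite (block \<nu> j)" by (simp add: block_def)
    show "w ` block \<nu> j \<subseteq> block \<nu> j"
      using w permutes_in_image[of w "{1..sum_list \<nu>}"] by (auto simp: block_iff[OF j])
    show "card (w ` block \<nu> j) = card (block \<nu> j)"
      using w by (intro card_image inj_on_subset[OF permutes_inj]) auto
  qed
  then show "w \<in> parabolic \<nu>" using w by (simp add: parabolic_def)
qed (auto simp: parabolic_def)

definition parabolic_gens :: "nat list \<Rightarrow> nat set" where
  "parabolic_gens \<nu> = {i \<in> {1..<sum_list \<nu>}. block_index \<nu> i = block_index \<nu> (i + 1)}"

text \<open>If the first letter is $i$ and $v$ is the inverse of $w$, then $v(i+1) < v(i)$.  As $v$ preserves
  the blocks, the block of $i + 1$ does not come after that of $i$, so $i$ and $i + 1$ lie in the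
  same block; the rest of the expression is then a reduced expression in the parabolic subgroup.\<close>

lemma reduced_expr_parabolic:
  assumes "w \<in> parabolic \<nu>" "reduced_expr (sum_list \<nu>) w is"
  shows "set is \<subseteq> parabolic_gens \<nu>"
  using assms
proof (induction "is" arbitrary: w)
  case (Cons i "is")
  let ?n = "sum_list \<nu>" and ?v = "Hilbert_Choice.inv w" and ?s = "transpose i (i + 1)"
  note red = reduced_expr_Cons[OF Cons.prems(2)]
  have w: "w permutes {1..?n}" and bi: "\<And>i. i \<in> {1..?n} \<Longrightarrow> block_index \<nu> (w i) = block_index \<nu> i"
    using Cons.prems(1) unfolding parabolic_iff by auto
  have v: "?v x \<in> {1..?n}" "block_index \<nu> (?v x) = block_index \<nu> x" if "x \<in> {1..?n}" for x
  proof -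
    show *: "?v x \<in> {1..?n}" using permutes_in_image[OF permutes_inv[OF w]] that by blast
    show "block_index \<nu> (?v x) = block_index \<nu> x"
      using bi[OF *] permutes_inverses(1)[OF w] by simp
  qed
  have ii: "i \<in> {1..?n}" "i + 1 \<in> {1..?n}" using red(1) by auto
  have "block_index \<nu> (i + 1) \<le> block_index \<nu> i"
    using block_index_mono[of "?v (i + 1)" "?v i" \<nu>] red(4) v[OF ii(1)] v[OF ii(2)] by auto
  then have eq: "block_index \<nu> i = block_index \<nu> (i + 1)"
    using block_index_mono[of i "i + 1" \<nu>] ii by auto
  have e: "expr_perm is = ?s \<circ> w" unfolding red(2) by (simp add: fun_eq_iff)
  have "?s \<circ> w permutes {1..?n}"
    using ii by (intro permutes_compose[OF w] permutes_swap_id)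
  moreover have "block_index \<nu> (?s x) = block_index \<nu> x" for x
    using eq by (auto simp: transpose_def)
  ultimately have "expr_perm is \<in> parabolic \<nu>"
    unfolding e parabolic_iff using bi by auto
  then show ?case
    using Cons.IH red(1,3) eq by (auto simp: parabolic_gens_def)
qed simp

lemma transpose_in_parabolic:
  "i \<in> parabolic_gens \<nu> \<Longrightarrow> transpose i (i + 1) \<in> parabolic \<nu>"
  unfolding parabolic_iff parabolic_gens_def
  by (auto intro!: permutes_swap_id simp: transpose_def)

lemma mem_parabolic_gens_iff:
  "i \<in> parabolic_gens \<nu> \<longleftrightarrow> i \<in> {1..<sum_list \<nu>} \<and> (\<forall>j. i \<noteq> sum_list (take j \<nu>))"
proof -
  have "block_index \<nu> i = block_index \<nu> (i + 1) \<longleftrightarrow> (\<forall>j. i \<noteq> sum_list (take j \<nu>))"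
    if i: "i \<in> {1..<sum_list \<nu>}"
  proof -
    have ii: "i \<in> {1..sum_list \<nu>}" "i + 1 \<in> {1..sum_list \<nu>}" using i by auto
    note b = block_index_block[OF ii(1)] block_index_block[OF ii(2)]
    let ?a = "block_index \<nu> i" and ?b = "block_index \<nu> (i + 1)"
    show ?thesis
    proof
      assume eq: "?a = ?b"
      show "\<forall>j. i \<noteq> sum_list (take j \<nu>)"
      proof (intro allI notI)
        fix j assume j: "i = sum_list (take j \<nu>)"
        show False
        proof (cases "j \<le> ?a")
          case True
          then show ?thesis using sum_list_take_mono[OF True, of \<nu>] b(2) j by (auto simp: block_def)
        next
          case False
          then have "Suc ?a \<le> j" by simp
          from sum_list_take_mono[OF this, of \<nu>] show ?thesis using b(4) j eq by (auto simp: block_def)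
        qed
      qed
    next
      assume ne: "\<forall>j. i \<noteq> sum_list (take j \<nu>)"
      have "i + 1 \<in> block \<nu> ?a"
        using b(2) ne[rule_format, of "Suc ?a"] by (auto simp: block_def)
      from block_index_eq[OF this] show "?a = ?b" by simp
    qed
  qed
  then show ?thesis unfolding parabolic_gens_def by auto
qed

text \<open>Bijections between corresponding fibres, glued.\<close>

lemma ex_bij_between_fibers:
  assumes "finite A" and "\<And>x. card {a \<in> A. f a = x} = card {a \<in> A. h a = x}"
  shows "\<exists>g. bij_betw g A A \<and> (\<forall>a\<in>A. h (g a) = f a)"
proof -
  have "\<exists>g. bij_betw g {a \<in> A. f a = x} {a \<in> A. h a = x}" for x
    by (rule finite_same_card_bij) (use assms in auto)
  then obtain G where G: "\<And>x. bij_betw (G x) {a \<in> A. f a = x} {a \<in> A. h a = x}" by metis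
  define g where "g a = G (f a) a" for a
  have g: "g a \<in> A" "h (g a) = f a" if "a \<in> A" for a
    using bij_betwE[OF G[of "f a"]] that by (auto simp: g_def)
  have "inj_on g A"
  proof (rule inj_onI)
    fix a b assume ab: "a \<in> A" "b \<in> A" "g a = g b"
    then have "f a = f b" using g by metis
    then show "a = b"
      using ab bij_betw_imp_inj_on[OF G[of "f b"]] by (auto simp: g_def inj_on_def)
  qed
  then have "bij_betw g A A"
    using g(1) endo_inj_surj[OF assms(1), of g] unfolding bij_betw_def by blast
  then show ?thesis using g(2) by blast
qed

text \<open>The map $\tau$ distributes the parts of $\nu$ over those of $\kappa$.  The functions ``$\tau$ of
  the $\nu$-block'' and ``$\kappa$-block'' on the positions have fibres of equal sizes, so some
  permutation carries one function to the other.  Conjugation by it turns permutations that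
  preserve the $\nu$-blocks into permutations that preserve the $\kappa$-blocks.\<close>

lemma parabolic_conj_subset:
  assumes "sum_list \<nu> = n" "sum_list \<kappa> = n"
    and \<tau>: "\<And>j. j < length \<nu> \<Longrightarrow> \<tau> j < length \<kappa>"
    and sums: "\<And>m. m < length \<kappa> \<Longrightarrow> (\<Sum>j | j < length \<nu> \<and> \<tau> j = m. \<nu> ! j) = \<kappa> ! m"
  shows "\<exists>g. g permutes {1..n} \<and>
    (\<lambda>w. g \<circ> w \<circ> Hilbert_Choice.inv g) ` parabolic \<nu> \<subseteq> parabolic \<kappa>"
proof -
  let ?f = "\<lambda>i. \<tau> (block_index \<nu> i)"
  have "card {a \<in> {1..n}. ?f a = x} = card {a \<in> {1..n}. block_index \<kappa> a = x}" for x
  proof (cases "x < length \<kappa>")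
    case False
    have "{a \<in> {1..n}. ?f a = x} = {}" "{a \<in> {1..n}. block_index \<kappa> a = x} = {}"
      using False block_index_block[of _ \<nu>] block_index_block[of _ \<kappa>] \<tau> assms by auto
    then show ?thesis by (simp only:)
  next
    case True
    have "{a \<in> {1..n}. ?f a = x} = (\<Union>j\<in>{j. j < length \<nu> \<and> \<tau> j = x}. block \<nu> j)"
      using block_iff[of _ \<nu>] block_index_block[of _ \<nu>] assms(1) by fastforce
    also have "card \<dots> = (\<Sum>j | j < length \<nu> \<and> \<tau> j = x. card (block \<nu> j))"
    proof (rule card_UN_disjoint)
      show "\<forall>i\<in>{j. j < length \<nu> \<and> \<tau> j = x}. \<forall>j\<in>{j. j < length \<nu> \<and> \<tau> j = x}.
        i \<noteq> j \<longrightarrow> block \<nu> i \<inter> block \<nu> j = {}"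
        using block_index_eq by blast
    qed (auto simp: block_def)
    also have "\<dots> = \<kappa> ! x" using sums[OF True] by (simp add: card_block)
    also have "\<dots> = card (block \<kappa> x)" using card_block[OF True] by simp
    also have "block \<kappa> x = {a \<in> {1..n}. block_index \<kappa> a = x}"
      using block_iff[OF True] assms(2) by auto
    finally show ?thesis .
  qed
  then obtain g0 where g0: "bij_betw g0 {1..n} {1..n}" "\<forall>a\<in>{1..n}. block_index \<kappa> (g0 a) = ?f a"
    using ex_bij_between_fibers[of "{1..n}" ?f "block_index \<kappa>"] by blast
  define g where "g a = (if a \<in> {1..n} then g0 a else a)" for a
  have g: "g permutes {1..n}"
  proof (rule bij_imp_permutes)
    show "bij_betw g {1..n} {1..n}" using g0(1) by (rule bij_betw_cong[THEN iffD1, rotated]) (simp add: g_def)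
  qed (auto simp: g_def)
  have gi: "block_index \<kappa> (g a) = ?f a" if "a \<in> {1..n}" for a
    using g0 that by (simp add: g_def)
  have "g \<circ> w \<circ> Hilbert_Choice.inv g \<in> parabolic \<kappa>" if w: "w \<in> parabolic \<nu>" for w
    unfolding parabolic_iff assms(2)
  proof (intro conjI ballI)
    have wp: "w permutes {1..n}" and wb: "\<And>i. i \<in> {1..n} \<Longrightarrow> block_index \<nu> (w i) = block_index \<nu> i"
      using w unfolding parabolic_iff assms(1) by auto
    show "g \<circ> w \<circ> Hilbert_Choice.inv g permutes {1..n}"
      by (intro permutes_compose permutes_inv g wp)
    fix i assume "i \<in> {1..n}"
    then have x: "Hilbert_Choice.inv g i \<in> {1..n}" (is "?x \<in> _")
      using permutes_in_image[OF permutes_inv[OF g]] by blast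
    then have "w ?x \<in> {1..n}" using permutes_in_image[OF wp] by blast
    then have "block_index \<kappa> (g (w ?x)) = block_index \<kappa> (g ?x)"
      using gi x wb by simp
    then show "block_index \<kappa> ((g \<circ> w \<circ> Hilbert_Choice.inv g) i) = block_index \<kappa> i"
      using permutes_inverses(1)[OF g] by simp
  qed
  then show ?thesis using g by blast
qed

text \<open>Turns an equality of multisets into a distribution of positions in a list, removing one entry
  at a time from a multiset that contains it.\<close>

lemma ex_index_partition:
  fixes B :: "nat \<Rightarrow> nat multiset"
  assumes "mset xs = (\<Sum>m<k. B m)"
  shows "\<exists>\<tau>. (\<forall>j<length xs. \<tau> j < k) \<and> (\<forall>m<k. (\<Sum>j | j < length xs \<and> \<tau> j = m. xs ! j) = \<Sum>\<^sub># (B m))"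
  using assms
proof (induction xs arbitrary: B)
  case Nil
  then show ?case by (auto simp: sum_eq_empty_iff)
next
  case (Cons x xs)
  have "x \<in># (\<Sum>m<k. B m)" by (simp flip: Cons.prems)
  then obtain m0 where m0: "m0 < k" "x \<in># B m0"
    by (auto simp: set_mset_sum)
  define B' where "B' = B(m0 := B m0 - {#x#})"
  have B: "B m0 = add_mset x (B' m0)" using m0 by (simp add: B'_def)
  have "(\<Sum>m<k. B m) = B m0 + (\<Sum>m\<in>{..<k} - {m0}. B m)"
    by (rule sum.remove) (use m0 in auto)
  also have "(\<Sum>m\<in>{..<k} - {m0}. B m) = (\<Sum>m\<in>{..<k} - {m0}. B' m)"
    by (rule sum.cong) (auto simp: B'_def)
  also have "B m0 + \<dots> = add_mset x (B' m0 + (\<Sum>m\<in>{..<k} - {m0}. B' m))"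
    unfolding B by simp
  also have "B' m0 + (\<Sum>m\<in>{..<k} - {m0}. B' m) = (\<Sum>m<k. B' m)"
    by (rule sum.remove[symmetric]) (use m0 in auto)
  finally have "mset xs = (\<Sum>m<k. B' m)" using Cons.prems by simp
  from Cons.IH[OF this] obtain \<tau> where \<tau>: "\<And>j. j < length xs \<Longrightarrow> \<tau> j < k"
    "\<And>m. m < k \<Longrightarrow> (\<Sum>j | j < length xs \<and> \<tau> j = m. xs ! j) = \<Sum>\<^sub># (B' m)" by blast
  let ?\<tau> = "case_nat m0 \<tau>"
  have "(\<Sum>j | j < length (x # xs) \<and> ?\<tau> j = m. (x # xs) ! j) = \<Sum>\<^sub># (B m)" if m: "m < k" for m
  proof -
    have F: "(\<Sum>j | j < l \<and> P j. f j) = (\<Sum>j<l. if P j then f j else 0)"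
      for l :: nat and P and f :: "nat \<Rightarrow> nat"
      using sum.inter_filter[of "{..<l}" f P] by simp
    have "(\<Sum>j | j < length (x # xs) \<and> ?\<tau> j = m. (x # xs) ! j)
      = (if m0 = m then x else 0) + (\<Sum>j | j < length xs \<and> \<tau> j = m. xs ! j)"
      unfolding F length_Cons by (subst sum.lessThan_Suc_shift) (simp cong: if_cong)
    also have "\<dots> = (if m0 = m then x else 0) + \<Sum>\<^sub># (B' m)"
      unfolding \<tau>(2)[OF m] ..
    also have "\<dots> = \<Sum>\<^sub># (B m)"
    proof (cases "m0 = m")
      case True
      then show ?thesis using B by simp
    next
      case False
      then show ?thesis by (simp add: B'_def)
    qed
    finally show ?thesis .
  qed
  moreover have "?\<tau> j < k" if "j < length (x # xs)" for j
    using that \<tau>(1) m0 by (auto split: nat.splits)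
  ultimately show ?case by blast
qed

section \<open>The standard composition and its digits\<close>

lemma mset_standard_ep_composition:
  "mset (standard_ep_composition e p a as) =
     replicate_mset a 1 + (\<Sum>i<length as. replicate_mset (as ! i) (e * p ^ i))"
proof -
  have "mset (concat (map f [0..<l])) = (\<Sum>i<l. mset (f i))" for f :: "nat \<Rightarrow> nat list" and l
    by (induction l) (auto simp: add.commute)
  then show ?thesis by (simp add: standard_ep_composition_def)
qed

lemma ep_expansion:
  assumes "p > 0" "n div e < p ^ L"
  shows "n = ep_digit e p 0 n + (\<Sum>i<L. ep_digit e p (Suc i) n * (e * p ^ i))"
proof -
  have "x = (\<Sum>i<L. x div p ^ i mod p * p ^ i) + x div p ^ L * p ^ L" for x
  proof (induction L)
    case (Suc L)
    have "y * t = y mod p * t + y div p * (t * p)" for y t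
      by (metis add_mult_distrib mod_div_mult_eq mult.assoc mult.commute)
    from this[of "x div p ^ L" "p ^ L"]
    have "x div p ^ L * p ^ L = x div p ^ L mod p * p ^ L + x div p ^ Suc L * p ^ Suc L"
      by (simp only: power_Suc2 div_mult2_eq)
    then show ?case using Suc by simp
  qed simp
  from this[of "n div e"] have "n div e = (\<Sum>i<L. n div e div p ^ i mod p * p ^ i)"
    using assms by simp
  then have "n = n mod e + e * (\<Sum>i<L. n div e div p ^ i mod p * p ^ i)"
    by (metis mod_mult_div_eq)
  then show ?thesis by (simp add: ep_digit_def sum_distrib_left mult_ac)
qed

lemma ep_digit_1: "1 < e \<Longrightarrow> ep_digit e p d 1 = (if d = 0 then 1 else 0)"
  by (auto simp: ep_digit_def split: nat.split)

lemma ep_digit_power: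
  assumes "1 < e" "1 < p"
  shows "ep_digit e p d (e * p ^ i) = (if d = Suc i then 1 else 0)"
proof (cases d)
  case (Suc j)
  have "p ^ i div p ^ j mod p = (if j = i then 1 else 0)"
  proof (cases i j rule: linorder_cases)
    case less
    then have "p ^ i < p ^ j" using assms by (intro power_strict_increasing) auto
    then show ?thesis using less by simp
  next
    case greater
    then have "p ^ i div p ^ j = p ^ (i - j)"
      using assms by (simp add: power_diff)
    then show ?thesis using greater assms by (cases "i - j") auto
  qed (use assms in auto)
  then show ?thesis using assms by (auto simp: ep_digit_def Suc)
qed (auto simp: ep_digit_def)

lemma ep_digits_standard_ep_composition:
  assumes "1 < e" "1 < p"
  shows "(\<Sum>k\<leftarrow>standard_ep_composition e p a as. ep_digit e p d k) =
    (case d of 0 \<Rightarrow> a | Suc i \<Rightarrow> if i < length as then as ! i else 0)"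
proof -
  have "(\<Sum>k\<leftarrow>standard_ep_composition e p a as. ep_digit e p d k)
     = \<Sum>\<^sub># (image_mset (ep_digit e p d) (mset (standard_ep_composition e p a as)))"
    by (metis mset_map sum_mset_sum_list)
  also have "\<dots> = a * ep_digit e p d 1 + (\<Sum>i<length as. as ! i * ep_digit e p d (e * p ^ i))"
  proof -
    have S: "\<Sum>\<^sub># (image_mset f (\<Sum>i\<in>I. A i)) = (\<Sum>i\<in>I. \<Sum>\<^sub># (image_mset f (A i)))"
      for f :: "nat \<Rightarrow> nat" and A :: "nat \<Rightarrow> nat multiset" and I
      by (induction I rule: infinite_finite_induct) auto
    show ?thesis
      unfolding mset_standard_ep_composition by (simp add: S)
  qed
  also have "\<dots> = (case d of 0 \<Rightarrow> a | Suc i \<Rightarrow> if i < length as then as ! i else 0)"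
    unfolding ep_digit_1[OF assms(1)] ep_digit_power[OF assms]
    by (cases d) (auto simp: if_distrib cong: if_cong)
  finally show ?thesis .
qed

lemma standard_ep_composition_composition:
  assumes "1 < e" "1 < p" "ep_adic_expansion e p n a as"
  shows "composition n (standard_ep_composition e p a as)"
proof -
  let ?\<nu> = "standard_ep_composition e p a as"
  have "0 < k" if "k \<in> set ?\<nu>" for k
    using that assms(1,2) by (auto simp: standard_ep_composition_def set_replicate_conv_if split: if_splits)
  moreover have "sum_list ?\<nu> = a + (\<Sum>i<length as. as ! i * (e * p ^ i))"
  proof -
    have S: "\<Sum>\<^sub># (\<Sum>i\<in>I. A i) = (\<Sum>i\<in>I. \<Sum>\<^sub># (A i))"
      for A :: "nat \<Rightarrow> nat multiset" and I
      by (induction I rule: infinite_finite_induct) auto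
    have "sum_list ?\<nu> = \<Sum>\<^sub># (mset ?\<nu>)" by (simp add: sum_mset_sum_list)
    then show ?thesis unfolding mset_standard_ep_composition by (simp add: S)
  qed
  ultimately show ?thesis
    using assms(3) by (simp add: composition_def ep_adic_expansion_def)
qed

context
  fixes p e n a :: nat and as :: "nat list" and q :: "'a::field"
  assumes p: "prime p" "CHAR('a) = p" and qe: "quantum_characteristic q e" "1 < e"
    and exp: "ep_adic_expansion e p n a as"
begin

lemma gauss_list_standard_ep_composition:
  "gauss_list q 0 (standard_ep_composition e p a as) \<noteq> 0"
  using exp qe(2) prime_gt_1_nat[OF p(1)]
  unfolding gauss_list_nonzero_iff_digits(1)[OF p qe(1)]
  by (auto simp: ep_digits_standard_ep_composition ep_adic_expansion_def ep_digit_def ep_base_def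
      split: nat.split)

text \<open>Uniqueness of the expansion.  It follows from the additivity of digits, because the parts of the
  standard composition add without carry.\<close>

lemma ep_digit_expansion:
  "ep_digit e p d n = (case d of 0 \<Rightarrow> a | Suc i \<Rightarrow> if i < length as then as ! i else 0)"
proof -
  let ?\<nu> = "standard_ep_composition e p a as"
  have p1: "1 < p" by (rule prime_gt_1_nat[OF p(1)])
  have "n = 0 + sum_list ?\<nu>"
    using standard_ep_composition_composition[OF qe(2) p1 exp] by (simp add: composition_def)
  moreover have "ep_digit e p d 0 = 0" by (simp add: ep_digit_def split: nat.split)
  ultimately show ?thesis
    using gauss_list_nonzero_iff_digits(2)[OF p qe(1) gauss_list_standard_ep_composition, of d]
    by (simp add: ep_digits_standard_ep_composition[OF qe(2) p1])
qed

text \<open>Split every part of $\kappa$ according to its own digits.  Since the digits of the parts add up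
  to those of $n$, the pieces form the same multiset as the parts of the standard composition.\<close>

lemma standard_parabolic_conj_subset:
  assumes "composition n \<kappa>" "gauss_list q 0 \<kappa> \<noteq> 0"
  shows "\<exists>g. g permutes {1..n} \<and>
    (\<lambda>w. g \<circ> w \<circ> Hilbert_Choice.inv g) ` parabolic (standard_ep_composition e p a as) \<subseteq> parabolic \<kappa>"
proof -
  let ?\<nu> = "standard_ep_composition e p a as" and ?L = "length as"
  have p1: "1 < p" by (rule prime_gt_1_nat[OF p(1)])
  have sum: "sum_list \<kappa> = n" using assms(1) by (simp add: composition_def)
  have "ep_digit e p d 0 = 0" for d by (simp add: ep_digit_def split: nat.split)
  then have digits: "ep_digit e p d n = (\<Sum>m<length \<kappa>. ep_digit e p d (\<kappa> ! m))" for d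
    using gauss_list_nonzero_iff_digits(2)[OF p qe(1) assms(2), of d] sum
    by (simp add: sum_list_sum_nth atLeast0LessThan)
  define B where "B m = mset (standard_ep_composition e p (ep_digit e p 0 (\<kappa> ! m))
    (map (\<lambda>i. ep_digit e p (Suc i) (\<kappa> ! m)) [0..<?L]))" for m
  have B: "B m = replicate_mset (ep_digit e p 0 (\<kappa> ! m)) 1 +
      (\<Sum>i<?L. replicate_mset (ep_digit e p (Suc i) (\<kappa> ! m)) (e * p ^ i))" for m
    unfolding B_def mset_standard_ep_composition by simp
  have R: "replicate_mset (\<Sum>m\<in>I. f m) x = (\<Sum>m\<in>I. replicate_mset (f m) x)"
    for f :: "nat \<Rightarrow> nat" and x :: nat and I
    by (simp add: multiset_eq_iff count_sum)
  have mset: "mset ?\<nu> = (\<Sum>m<length \<kappa>. B m)"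
  proof -
    have "(\<Sum>m<length \<kappa>. B m) = replicate_mset (ep_digit e p 0 n) 1
       + (\<Sum>i<?L. replicate_mset (ep_digit e p (Suc i) n) (e * p ^ i))"
      unfolding B sum.distrib digits R by (subst sum.swap) simp
    then show ?thesis
      unfolding mset_standard_ep_composition by (simp add: ep_digit_expansion)
  qed
  have bound: "\<kappa> ! m div e < p ^ ?L" if m: "m < length \<kappa>" for m
  proof -
    have "(\<Sum>i<l. as ! i * p ^ i) < p ^ l" if "l \<le> ?L" for l
      using that
    proof (induction l)
      case (Suc l)
      then have "as ! l < p" using exp by (auto simp: ep_adic_expansion_def)
      then have "Suc (as ! l) * p ^ l \<le> p * p ^ l" by (intro mult_right_mono) auto
      then show ?case using Suc by simp
    qed simp
    then have l: "(\<Sum>i<?L. as ! i * p ^ i) < p ^ ?L" by blast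
    have "n = a + e * (\<Sum>i<?L. as ! i * p ^ i)" and "a < e"
      using exp by (auto simp: ep_adic_expansion_def sum_distrib_left mult_ac)
    then have "n div e < p ^ ?L" using l by simp
    moreover have "\<kappa> ! m \<le> n" using m sum elem_le_sum_list by blast
    ultimately show ?thesis by (meson div_le_mono le_less_trans)
  qed
  have "\<Sum>\<^sub># (B m) = \<kappa> ! m" if m: "m < length \<kappa>" for m
  proof -
    have S: "\<Sum>\<^sub># (\<Sum>i\<in>I. A i) = (\<Sum>i\<in>I. \<Sum>\<^sub># (A i))"
      for A :: "nat \<Rightarrow> nat multiset" and I
      by (induction I rule: infinite_finite_induct) auto
    show ?thesis
      using ep_expansion[OF _ bound[OF m]] p1 unfolding B by (simp add: S)
  qed
  then show ?thesis
    using ex_index_partition[OF mset] parabolic_conj_subset[of ?\<nu> n \<kappa>] sum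
      standard_ep_composition_composition[OF qe(2) p1 exp] by (auto simp: composition_def)
qed

end

section \<open>Direct summands and induced modules\<close>

context right_module
begin

lemma ract_zero_left: "r \<in> carrier R \<Longrightarrow> \<zero>\<^bsub>M\<^esub> \<star>\<^bsub>M\<^esub> r = \<zero>\<^bsub>M\<^esub>"
  using ract_l_distr[of "\<zero>\<^bsub>M\<^esub>" "\<zero>\<^bsub>M\<^esub>" r] ract_closed[of "\<zero>\<^bsub>M\<^esub>" r]
  by (simp add: M.add.r_cancel_one')

lemma ract_diff:
  assumes "x \<in> carrier M" "y \<in> carrier M" "r \<in> carrier R"
  shows "(x \<ominus>\<^bsub>M\<^esub> y) \<star>\<^bsub>M\<^esub> r = x \<star>\<^bsub>M\<^esub> r \<ominus>\<^bsub>M\<^esub> y \<star>\<^bsub>M\<^esub> r"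
proof -
  have "(\<ominus>\<^bsub>M\<^esub> y) \<star>\<^bsub>M\<^esub> r \<oplus>\<^bsub>M\<^esub> y \<star>\<^bsub>M\<^esub> r = \<zero>\<^bsub>M\<^esub>"
    using assms by (simp add: ract_l_distr[symmetric] M.l_neg ract_zero_left)
  then have "\<ominus>\<^bsub>M\<^esub> (y \<star>\<^bsub>M\<^esub> r) = (\<ominus>\<^bsub>M\<^esub> y) \<star>\<^bsub>M\<^esub> r"
    using assms by (intro M.minus_equality) (auto simp: ract_closed)
  then show ?thesis using assms by (simp add: M.minus_eq ract_l_distr)
qed

end

definition module_hom ::
  "('r, 'x) ring_scheme \<Rightarrow> ('r, 'm) right_module \<Rightarrow> ('r, 'n) right_module \<Rightarrow> ('m \<Rightarrow> 'n) \<Rightarrow> bool"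
  where "module_hom R M N f \<longleftrightarrow>
    f \<in> carrier M \<rightarrow> carrier N \<and>
    (\<forall>x\<in>carrier M. \<forall>y\<in>carrier M. f (x \<oplus>\<^bsub>M\<^esub> y) = f x \<oplus>\<^bsub>N\<^esub> f y) \<and>
    (\<forall>x\<in>carrier M. \<forall>r\<in>carrier R. f (x \<star>\<^bsub>M\<^esub> r) = f x \<star>\<^bsub>N\<^esub> r)"

lemma module_homD:
  assumes "module_hom R M N f"
  shows "x \<in> carrier M \<Longrightarrow> f x \<in> carrier N"
    and "x \<in> carrier M \<Longrightarrow> y \<in> carrier M \<Longrightarrow> f (x \<oplus>\<^bsub>M\<^esub> y) = f x \<oplus>\<^bsub>N\<^esub> f y"
    and "x \<in> carrier M \<Longrightarrow> r \<in> carrier R \<Longrightarrow> f (x \<star>\<^bsub>M\<^esub> r) = f x \<star>\<^bsub>N\<^esub> r"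
  using assms by (auto simp: module_hom_def)

lemma module_hom_group_hom:
  assumes "right_module R M" "right_module R N" "module_hom R M N f"
  shows "abelian_group_hom M N f"
  using assms
  by (intro abelian_group_homI right_module.axioms(2) group_hom.intro group_hom_axioms.intro
      abelian_group.a_group)
    (auto simp: module_hom_def hom_def)

lemma right_submoduleI:
  assumes "right_module R M" "K \<subseteq> carrier M" "\<zero>\<^bsub>M\<^esub> \<in> K"
    and "\<And>x y. x \<in> K \<Longrightarrow> y \<in> K \<Longrightarrow> x \<oplus>\<^bsub>M\<^esub> y \<in> K"
    and "\<And>x. x \<in> K \<Longrightarrow> \<ominus>\<^bsub>M\<^esub> x \<in> K"
    and "\<And>x r. x \<in> K \<Longrightarrow> r \<in> carrier R \<Longrightarrow> x \<star>\<^bsub>M\<^esub> r \<in> K"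
  shows "right_submodule R M K"
proof -
  interpret right_module R M by fact
  have "subgroup K (add_monoid M)"
    by (rule M.add.subgroupI) (use assms in \<open>auto simp: a_inv_def\<close>)
  then show ?thesis
    using assms by (auto simp: right_submodule_def intro: additive_subgroupI)
qed

lemma iso_direct_summandI:
  assumes M: "right_module R M" and N: "right_module R N"
    and f: "module_hom R M N f" and g: "module_hom R N M g"
    and gf: "\<And>x. x \<in> carrier M \<Longrightarrow> g (f x) = x"
  shows "iso_direct_summand R M N"
proof -
  interpret M: right_module R M by fact
  interpret N: right_module R N by fact
  interpret f: abelian_group_hom M N f by (rule module_hom_group_hom[OF M N f])
  interpret g: abelian_group_hom N M g by (rule module_hom_group_hom[OF N M g])
  note fD = module_homD[OF f] and gD = module_homD[OF g]
  define K where "K = f ` carrier M"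
  define L where "L = {y \<in> carrier N. g y = \<zero>\<^bsub>M\<^esub>}"
  have "right_submodule R N K"
  proof (rule right_submoduleI[OF N])
    show "\<zero>\<^bsub>N\<^esub> \<in> K" unfolding K_def using f.hom_zero by (metis M.M.zero_closed imageI)
    show "x \<oplus>\<^bsub>N\<^esub> y \<in> K" if "x \<in> K" "y \<in> K" for x y
      using that fD(2) unfolding K_def by (metis (no_types, lifting) M.M.add.m_closed image_iff)
    show "\<ominus>\<^bsub>N\<^esub> x \<in> K" if "x \<in> K" for x
      using that f.hom_a_inv unfolding K_def by (metis (no_types, lifting) M.M.a_inv_closed image_iff)
    show "x \<star>\<^bsub>N\<^esub> r \<in> K" if "x \<in> K" "r \<in> carrier R" for x r
      using that fD(3) unfolding K_def by (metis (no_types, lifting) M.ract_closed image_iff)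
  qed (auto simp: K_def fD(1))
  moreover have "right_submodule R N L"
  proof -
    have "\<zero>\<^bsub>M\<^esub> \<star>\<^bsub>M\<^esub> r = \<zero>\<^bsub>M\<^esub>" if "r \<in> carrier R" for r
      using M.ract_l_distr[of "\<zero>\<^bsub>M\<^esub>" "\<zero>\<^bsub>M\<^esub>" r] M.ract_closed[of "\<zero>\<^bsub>M\<^esub>" r] that
      by (simp add: M.M.add.r_cancel_one')
    then show ?thesis
      by (intro right_submoduleI[OF N]) (auto simp: L_def gD N.ract_closed)
  qed
  moreover have "K \<inter> L = {\<zero>\<^bsub>N\<^esub>}"
  proof
    show "K \<inter> L \<subseteq> {\<zero>\<^bsub>N\<^esub>}" using gf f.hom_zero by (auto simp: K_def L_def)
    show "{\<zero>\<^bsub>N\<^esub>} \<subseteq> K \<inter> L"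
      using calculation by (auto simp: right_submodule_def dest: additive_subgroup.zero_closed)
  qed
  moreover have "K <+>\<^bsub>N\<^esub> L = carrier N"
  proof (intro equalityI subsetI)
    fix y assume y: "y \<in> carrier N"
    let ?k = "f (g y)"
    have k: "?k \<in> K" "?k \<in> carrier N" using y gD(1) fD(1) by (auto simp: K_def)
    moreover have "g (y \<ominus>\<^bsub>N\<^esub> ?k) = \<zero>\<^bsub>M\<^esub>"
      using y k gD gf by (simp add: N.M.minus_eq M.M.r_neg)
    then have "y \<ominus>\<^bsub>N\<^esub> ?k \<in> L" using y k by (simp add: L_def N.M.minus_eq)
    moreover have "y = ?k \<oplus>\<^bsub>N\<^esub> (y \<ominus>\<^bsub>N\<^esub> ?k)"
      using y k by (simp add: N.M.minus_eq N.M.a_lcomm N.M.r_neg)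
    ultimately show "y \<in> K <+>\<^bsub>N\<^esub> L" unfolding set_add_def' by blast
  qed (auto simp: set_add_def' K_def L_def fD(1))
  moreover have "right_module_iso R M (N\<lparr>carrier := K\<rparr>)"
    unfolding right_module_iso_def
  proof (intro exI conjI)
    show "bij_betw f (carrier M) (carrier (N\<lparr>carrier := K\<rparr>))"
      unfolding bij_betw_def K_def by (auto intro: inj_on_inverseI[of _ g] gf)
  qed (auto simp: fD)
  ultimately show ?thesis unfolding iso_direct_summand_def by blast
qed

text \<open>The projection along the complement, followed by the inverse of the isomorphism, is a left inverse
  of the inclusion.\<close>

lemma iso_direct_summandE:
  assumes M: "right_module R M" and N: "right_module R N"
    and "iso_direct_summand R M N"
  obtains f g where "module_hom R M N f" "module_hom R N M g" "\<And>x. x \<in> carrier M \<Longrightarrow> g (f x) = x"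
proof -
  interpret M: right_module R M by fact
  interpret N: right_module R N by fact
  obtain K L f where K: "right_submodule R N K" and L: "right_submodule R N L"
    and KL: "K \<inter> L = {\<zero>\<^bsub>N\<^esub>}" "K <+>\<^bsub>N\<^esub> L = carrier N"
    and bij: "bij_betw f (carrier M) K"
    and f: "\<And>x y. x \<in> carrier M \<Longrightarrow> y \<in> carrier M \<Longrightarrow> f (x \<oplus>\<^bsub>M\<^esub> y) = f x \<oplus>\<^bsub>N\<^esub> f y"
    "\<And>x r. x \<in> carrier M \<Longrightarrow> r \<in> carrier R \<Longrightarrow> f (x \<star>\<^bsub>M\<^esub> r) = f x \<star>\<^bsub>N\<^esub> r"
    using assms(3) unfolding iso_direct_summand_def right_module_iso_def by auto
  interpret K: additive_subgroup K N using K by (simp add: right_submodule_def)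
  interpret L: additive_subgroup L N using L by (simp add: right_submodule_def)
  have fK: "f x \<in> K" if "x \<in> carrier M" for x using bij that by (auto simp: bij_betw_def)
  have hom: "module_hom R M N f"
    unfolding module_hom_def using f fK K.a_subset by blast
  have unique: "x = x'"
    if "x \<in> carrier M" "x' \<in> carrier M" "l \<in> L" "l' \<in> L" "f x \<oplus>\<^bsub>N\<^esub> l = f x' \<oplus>\<^bsub>N\<^esub> l'" for x x' l l'
  proof -
    have c: "f x \<in> carrier N" "f x' \<in> carrier N" "l \<in> carrier N" "l' \<in> carrier N"
      using that fK K.a_subset L.a_subset by auto
    have "f x \<ominus>\<^bsub>N\<^esub> f x' = l' \<ominus>\<^bsub>N\<^esub> l"
    proof -
      have "f x \<ominus>\<^bsub>N\<^esub> f x' = (f x \<oplus>\<^bsub>N\<^esub> l) \<oplus>\<^bsub>N\<^esub> (\<ominus>\<^bsub>N\<^esub> l \<oplus>\<^bsub>N\<^esub> \<ominus>\<^bsub>N\<^esub> f x')"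
        using c by (simp add: N.M.minus_eq N.M.a_assoc N.M.r_neg1 N.M.r_neg2)
      also have "\<dots> = l' \<ominus>\<^bsub>N\<^esub> l"
        unfolding that(5) using c
        by (simp add: N.M.minus_eq N.M.a_assoc N.M.a_comm[of "\<ominus>\<^bsub>N\<^esub> l"] N.M.a_lcomm[of "f x'"] N.M.r_neg1)
      finally show ?thesis .
    qed
    moreover have "f x \<ominus>\<^bsub>N\<^esub> f x' \<in> K" "l' \<ominus>\<^bsub>N\<^esub> l \<in> L"
      using that fK by (auto simp: N.M.minus_eq)
    ultimately have "f x \<ominus>\<^bsub>N\<^esub> f x' = \<zero>\<^bsub>N\<^esub>" using KL(1) by auto
    then have "f x = f x'"
      using c N.M.minus_equality[of "f x" "\<ominus>\<^bsub>N\<^esub> f x'"] by (simp add: N.M.minus_eq)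
    then show ?thesis using bij that by (auto simp: bij_betw_def inj_on_def)
  qed
  define g where "g y = (SOME x. x \<in> carrier M \<and> (\<exists>l\<in>L. y = f x \<oplus>\<^bsub>N\<^esub> l))" for y
  have ex: "\<exists>x. x \<in> carrier M \<and> (\<exists>l\<in>L. y = f x \<oplus>\<^bsub>N\<^esub> l)" if "y \<in> carrier N" for y
  proof -
    have "y \<in> K <+>\<^bsub>N\<^esub> L" using that KL(2) by simp
    then obtain k l where "k \<in> K" "l \<in> L" "y = k \<oplus>\<^bsub>N\<^esub> l"
      unfolding set_add_def' by auto
    then show ?thesis using bij by (auto simp: bij_betw_def image_iff) 
  qed
  have g: "g y = x" if "x \<in> carrier M" "l \<in> L" "y = f x \<oplus>\<^bsub>N\<^esub> l" for x y l
  proof -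
    have "g y \<in> carrier M \<and> (\<exists>l\<in>L. y = f (g y) \<oplus>\<^bsub>N\<^esub> l)"
      unfolding g_def by (rule someI_ex) (use that in blast)
    then show ?thesis using unique that by metis
  qed
  have "module_hom R N M g"
    unfolding module_hom_def
  proof (intro conjI ballI funcsetI)
    fix y assume y: "y \<in> carrier N"
    then obtain x l where x: "x \<in> carrier M" "l \<in> L" "y = f x \<oplus>\<^bsub>N\<^esub> l" using ex by blast
    have fx: "f x \<in> carrier N" "l \<in> carrier N" using x fK K.a_subset L.a_subset by auto
    show "g y \<in> carrier M" using g x by metis
    show "g (y \<star>\<^bsub>N\<^esub> r) = g y \<star>\<^bsub>M\<^esub> r" if r: "r \<in> carrier R" for r
    proof -
      have "y \<star>\<^bsub>N\<^esub> r = f (x \<star>\<^bsub>M\<^esub> r) \<oplus>\<^bsub>N\<^esub> l \<star>\<^bsub>N\<^esub> r"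
        using x fx r f by (simp add: N.ract_l_distr)
      moreover have "l \<star>\<^bsub>N\<^esub> r \<in> L" using L r x by (simp add: right_submodule_def)
      ultimately show ?thesis using g x r M.ract_closed by metis
    qed
    show "g (y \<oplus>\<^bsub>N\<^esub> y') = g y \<oplus>\<^bsub>M\<^esub> g y'" if y': "y' \<in> carrier N" for y'
    proof -
      obtain x' l' where x': "x' \<in> carrier M" "l' \<in> L" "y' = f x' \<oplus>\<^bsub>N\<^esub> l'" using ex y' by blast
      have fx': "f x' \<in> carrier N" "l' \<in> carrier N" using x' fK K.a_subset L.a_subset by auto
      have "y \<oplus>\<^bsub>N\<^esub> y' = f (x \<oplus>\<^bsub>M\<^esub> x') \<oplus>\<^bsub>N\<^esub> (l \<oplus>\<^bsub>N\<^esub> l')"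
        using x x' fx fx' f by (simp add: N.M.a_ac)
      then have "g (y \<oplus>\<^bsub>N\<^esub> y') = x \<oplus>\<^bsub>M\<^esub> x'" using x x' by (intro g) auto
      moreover have "g y = x" "g y' = x'" using g x x' by auto
      ultimately show ?thesis by simp
    qed
  qed
  moreover have "g (f x) = x" if "x \<in> carrier M" for x
    using that fK[OF that] K.a_subset by (intro g[of x "\<zero>\<^bsub>N\<^esub>"]) auto
  ultimately show ?thesis using that hom by blast
qed

text \<open>The induced module is handled through the quotient of the free abelian group by which it is
  defined.\<close>

locale induction_data = right_module R M
  for R (structure) and M :: "('r, 'm) right_module" (structure) +
  fixes B :: "'r set"
  assumes B_subset: "B \<subseteq> carrier R"
begin

abbreviation "FG \<equiv> free_Abelian_group (carrier M \<times> carrier R)"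

definition "Rel = generate FG (tensor_relators R B M)"

text \<open>Right multiplication on the second factor, before passing to the quotient.\<close>

definition translate :: "'r \<Rightarrow> ('m \<times> 'r \<Rightarrow>\<^sub>0 int) \<Rightarrow> ('m \<times> 'r \<Rightarrow>\<^sub>0 int)" where
  "translate r = frag_extend (\<lambda>(x, s). frag_of (x, s \<otimes>\<^bsub>R\<^esub> r))"

abbreviation "Ind \<equiv> induced_module R B M"

definition tens :: "'m \<Rightarrow> 'r \<Rightarrow> ('m \<times> 'r \<Rightarrow>\<^sub>0 int) set" where
  "tens x r = Rel #>\<^bsub>FG\<^esub> frag_of (x, r)"

sublocale FG: comm_group FG
  by (rule abelian_free_Abelian_group)

lemma relators_closed: "tensor_relators R B M \<subseteq> carrier FG"
proof -
  have K: "Poly_Mapping.keys (frag_of x - frag_of y - frag_of z) \<subseteq> {x, y, z}" for x y z :: "'m \<times> 'r"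
    using keys_diff[of "frag_of x - frag_of y" "frag_of z"] keys_diff[of "frag_of x" "frag_of y"]
    by (auto simp: keys_frag_of)
  have K2: "Poly_Mapping.keys (frag_of x - frag_of y) \<subseteq> {x, y}" for x y :: "'m \<times> 'r"
    using keys_diff[of "frag_of x" "frag_of y"] by (auto simp: keys_frag_of)
  show ?thesis
    unfolding tensor_relators_def carrier_free_Abelian_group_iff[abs_def] subset_iff
    using B_subset ract_closed
    by (auto dest!: subsetD[OF K] subsetD[OF K2])
qed

lemma Rel_subgroup: "subgroup Rel FG"
  unfolding Rel_def by (rule FG.generate_is_subgroup[OF relators_closed])

lemma Rel_normal: "Rel \<lhd> FG"
  by (rule FG.subgroup_imp_normal[OF Rel_subgroup])

lemma Rel_relator: "h \<in> tensor_relators R B M \<Longrightarrow> h \<in> Rel"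
  unfolding Rel_def by (rule generate.incl)

lemma Rel_closed: "a \<in> Rel \<Longrightarrow> Poly_Mapping.keys a \<subseteq> carrier M \<times> carrier R"
  using subgroup.mem_carrier[OF Rel_subgroup] by auto

lemma Rel_zero: "0 \<in> Rel" and Rel_add: "a \<in> Rel \<Longrightarrow> b \<in> Rel \<Longrightarrow> a + b \<in> Rel"
  and Rel_uminus: "a \<in> Rel \<Longrightarrow> - a \<in> Rel"
  using subgroup.one_closed[OF Rel_subgroup] subgroup.m_closed[OF Rel_subgroup, of a b]
    subgroup.m_inv_closed[OF Rel_subgroup, of a] Rel_closed by auto

lemma Rel_diff: "a \<in> Rel \<Longrightarrow> b \<in> Rel \<Longrightarrow> a - b \<in> Rel"
  using Rel_add[of a "- b"] Rel_uminus by simp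

lemma Rel_induct [consumes 1, case_names zero relator add minus]:
  assumes "a \<in> Rel" "P 0" "\<And>h. h \<in> tensor_relators R B M \<Longrightarrow> P h"
    "\<And>a b. a \<in> Rel \<Longrightarrow> b \<in> Rel \<Longrightarrow> P a \<Longrightarrow> P b \<Longrightarrow> P (a + b)"
    "\<And>h. h \<in> tensor_relators R B M \<Longrightarrow> P (- h)"
  shows "P a"
  using assms(1) unfolding Rel_def
proof (induction rule: generate.induct)
  case (inv h)
  then show ?case using assms(5) relators_closed by (auto simp: subset_iff)
qed (use assms in \<open>auto simp: Rel_def\<close>)

lemma coset_eq_iff:
  assumes "Poly_Mapping.keys a \<subseteq> carrier M \<times> carrier R" "Poly_Mapping.keys b \<subseteq> carrier M \<times> carrier R"
  shows "Rel #>\<^bsub>FG\<^esub> a = Rel #>\<^bsub>FG\<^esub> b \<longleftrightarrow> a - b \<in> Rel"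
proof
  assume "Rel #>\<^bsub>FG\<^esub> a = Rel #>\<^bsub>FG\<^esub> b"
  then have "a \<in> Rel #>\<^bsub>FG\<^esub> b" using FG.rcos_self[of a Rel] Rel_subgroup assms by auto
  then show "a - b \<in> Rel" by (auto simp: r_coset_def)
next
  assume "a - b \<in> Rel"
  then have "a \<in> Rel #>\<^bsub>FG\<^esub> b" by (auto simp: r_coset_def intro!: bexI[of _ "a - b"])
  then show "Rel #>\<^bsub>FG\<^esub> a = Rel #>\<^bsub>FG\<^esub> b"
    using FG.repr_independence[of a Rel b] Rel_subgroup assms by auto
qed

lemma translate_simps [simp]:
  "translate r 0 = 0" "translate r (frag_of (x, s)) = frag_of (x, s \<otimes>\<^bsub>R\<^esub> r)"
  "translate r (a + b) = translate r a + translate r b"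
  "translate r (a - b) = translate r a - translate r b"
  "translate r (- a) = - translate r a"
  by (simp_all add: translate_def frag_extend_add frag_extend_diff frag_extend_minus)

lemma translate_keys:
  assumes "Poly_Mapping.keys a \<subseteq> carrier M \<times> carrier R" "r \<in> carrier R"
  shows "Poly_Mapping.keys (translate r a) \<subseteq> carrier M \<times> carrier R"
  unfolding translate_def
  by (rule order_trans[OF keys_frag_extend]) (use assms in \<open>auto simp: keys_frag_of\<close>)

lemma translate_Rel:
  assumes "a \<in> Rel" "r \<in> carrier R"
  shows "translate r a \<in> Rel"
proof -
  have *: "translate r h \<in> Rel" if "h \<in> tensor_relators R B M" for h
  proof (rule Rel_relator)
    show "translate r h \<in> tensor_relators R B M"
      using that assms(2) B_subset unfolding tensor_relators_def
      apply (elim UnE CollectE exE conjE)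
      subgoal by (intro UnI1 CollectI) (auto intro!: exI)
      subgoal for x s t
        by (rule UnI1, rule UnI2, rule CollectI, rule exI[of _ x], rule exI[of _ "s \<otimes> r"],
            rule exI[of _ "t \<otimes> r"]) (auto simp: R.l_distr)
      subgoal for x b s
        by (rule UnI2, rule CollectI, rule exI[of _ x], rule exI[of _ b],
            rule exI[of _ "s \<otimes> r"]) (auto simp: R.m_assoc)
      done
  qed
  show ?thesis
    using assms(1) by (induction rule: Rel_induct) (auto simp: * Rel_zero Rel_add Rel_uminus)
qed

lemma Ind_carrier: "carrier Ind = (\<lambda>a. Rel #>\<^bsub>FG\<^esub> a) ` carrier FG"
  by (auto simp: induced_module_def Let_def Rel_def FactGroup_def RCOSETS_def)

lemma Ind_zero: "\<zero>\<^bsub>Ind\<^esub> = Rel #>\<^bsub>FG\<^esub> 0"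
  by (simp add: induced_module_def Let_def FactGroup_def r_coset_def flip: Rel_def)

lemma Ind_add:
  assumes "a \<in> carrier FG" "b \<in> carrier FG"
  shows "(Rel #>\<^bsub>FG\<^esub> a) \<oplus>\<^bsub>Ind\<^esub> (Rel #>\<^bsub>FG\<^esub> b) = Rel #>\<^bsub>FG\<^esub> (a + b)"
  using normal.rcos_sum[OF Rel_normal assms]
  by (simp add: induced_module_def Let_def FactGroup_def flip: Rel_def)

lemma Ind_act:
  assumes a: "a \<in> carrier FG" and r: "r \<in> carrier R"
  shows "(Rel #>\<^bsub>FG\<^esub> a) \<star>\<^bsub>Ind\<^esub> r = Rel #>\<^bsub>FG\<^esub> translate r a"
proof -
  have "(Rel #>\<^bsub>FG\<^esub> a) \<star>\<^bsub>Ind\<^esub> r = (\<Union>b\<in>Rel #>\<^bsub>FG\<^esub> a. Rel #>\<^bsub>FG\<^esub> translate r b)"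
    by (simp add: induced_module_def Let_def translate_def flip: Rel_def)
  also have "\<dots> = (\<Union>b\<in>Rel #>\<^bsub>FG\<^esub> a. Rel #>\<^bsub>FG\<^esub> translate r a)"
  proof (rule SUP_cong[OF refl])
    fix b assume "b \<in> Rel #>\<^bsub>FG\<^esub> a"
    then obtain n where n: "n \<in> Rel" "b = n + a" by (auto simp: r_coset_def)
    then have "Poly_Mapping.keys b \<subseteq> carrier M \<times> carrier R"
      using Rel_closed[OF n(1)] a keys_add[of n a] by auto
    from coset_eq_iff[OF translate_keys[OF this r] translate_keys[of a, OF _ r]]
    show "Rel #>\<^bsub>FG\<^esub> translate r b = Rel #>\<^bsub>FG\<^esub> translate r a"
      using n translate_Rel[OF n(1) r] a by simp
  qed
  also have "\<dots> = Rel #>\<^bsub>FG\<^esub> translate r a"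
    using FG.rcos_self[of a Rel] Rel_subgroup a by auto
  finally show ?thesis .
qed

lemma right_module_Ind: "right_module R Ind"
proof -
  have ab: "abelian_group Ind"
  proof (rule abelian_groupI)
    fix x assume "x \<in> carrier Ind"
    then obtain a where a: "x = Rel #>\<^bsub>FG\<^esub> a" "a \<in> carrier FG" unfolding Ind_carrier by auto
    have neg: "- a \<in> carrier FG" using a(2) by simp
    show "\<zero>\<^bsub>Ind\<^esub> \<oplus>\<^bsub>Ind\<^esub> x = x"
      unfolding a(1) Ind_zero using a(2) by (subst Ind_add) auto
    show "\<exists>y\<in>carrier Ind. y \<oplus>\<^bsub>Ind\<^esub> x = \<zero>\<^bsub>Ind\<^esub>"
      unfolding a(1) Ind_zero Ind_carrier
      by (intro bexI[of _ "Rel #>\<^bsub>FG\<^esub> (- a)"] imageI neg) (subst Ind_add[OF neg a(2)], simp)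
    fix y assume "y \<in> carrier Ind"
    then obtain b where b: "y = Rel #>\<^bsub>FG\<^esub> b" "b \<in> carrier FG" unfolding Ind_carrier by auto
    have ab: "a + b \<in> carrier FG" using FG.m_closed[OF a(2) b(2)] by simp
    show "x \<oplus>\<^bsub>Ind\<^esub> y \<in> carrier Ind"
      unfolding a(1) b(1) Ind_add[OF a(2) b(2)] using ab by (auto simp: Ind_carrier)
    show "x \<oplus>\<^bsub>Ind\<^esub> y = y \<oplus>\<^bsub>Ind\<^esub> x"
      unfolding a(1) b(1) Ind_add[OF a(2) b(2)] Ind_add[OF b(2) a(2)] by (simp only: add.commute)
    fix z assume "z \<in> carrier Ind"
    then obtain c where c: "z = Rel #>\<^bsub>FG\<^esub> c" "c \<in> carrier FG" unfolding Ind_carrier by auto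
    have bc: "b + c \<in> carrier FG" using FG.m_closed[OF b(2) c(2)] by simp
    show "x \<oplus>\<^bsub>Ind\<^esub> y \<oplus>\<^bsub>Ind\<^esub> z = x \<oplus>\<^bsub>Ind\<^esub> (y \<oplus>\<^bsub>Ind\<^esub> z)"
      unfolding a(1) b(1) c(1) Ind_add[OF a(2) b(2)] Ind_add[OF b(2) c(2)]
        Ind_add[OF ab c(2)] Ind_add[OF a(2) bc] by (simp only: add.assoc)
  qed (auto simp: Ind_carrier Ind_zero intro!: imageI)
  have tc: "translate r a \<in> carrier FG" if "a \<in> carrier FG" "r \<in> carrier R" for a r
    using translate_keys that by auto
  have split: "translate (r \<oplus> s) a - (translate r a + translate s a) \<in> Rel"
    if "Poly_Mapping.keys a \<subseteq> carrier M \<times> carrier R" "r \<in> carrier R" "s \<in> carrier R" for a r s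
    using that(1)
  proof (induction a rule: free_Abelian_group_induct[consumes 1])
    case (3 x)
    then obtain m t where x: "x = (m, t)" "m \<in> carrier M" "t \<in> carrier R" by auto
    have "frag_of (m, t \<otimes> r \<oplus> t \<otimes> s) - frag_of (m, t \<otimes> r) - frag_of (m, t \<otimes> s) \<in> Rel"
      by (rule Rel_relator) (use x that in \<open>auto simp: tensor_relators_def\<close>)
    then show ?case using x that by (simp add: R.r_distr diff_diff_eq)
  next
    case (2 a b)
    then show ?case using Rel_diff[OF 2(3,4)] by (simp add: algebra_simps)
  qed (simp add: Rel_zero)
  have tt: "translate (r \<otimes> s) a = translate s (translate r a)"
    if "Poly_Mapping.keys a \<subseteq> carrier M \<times> carrier R" "r \<in> carrier R" "s \<in> carrier R" for a r s
    using that(1) by (induction a rule: free_Abelian_group_induct[consumes 1]) (use that in \<open>auto simp: R.m_assoc\<close>)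
  have t1: "translate \<one> a = a" if "Poly_Mapping.keys a \<subseteq> carrier M \<times> carrier R" for a
    using that by (induction a rule: free_Abelian_group_induct[consumes 1]) auto
  have add_closed: "a + b \<in> carrier FG" if "a \<in> carrier FG" "b \<in> carrier FG" for a b
    using that FG.m_closed by simp
  show ?thesis
  proof (intro right_module.intro right_module_axioms.intro ab)
    show "ring R" ..
  next
    fix x r assume "x \<in> carrier Ind" "r \<in> carrier R"
    then show "x \<star>\<^bsub>Ind\<^esub> r \<in> carrier Ind"
      unfolding Ind_carrier using tc by (auto simp: Ind_act simp del: carrier_free_Abelian_group_iff)
  next
    fix x y r assume "x \<in> carrier Ind" "y \<in> carrier Ind" "r \<in> carrier R"
    then show "(x \<oplus>\<^bsub>Ind\<^esub> y) \<star>\<^bsub>Ind\<^esub> r = x \<star>\<^bsub>Ind\<^esub> r \<oplus>\<^bsub>Ind\<^esub> y \<star>\<^bsub>Ind\<^esub> r"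
      unfolding Ind_carrier using tc add_closed
      by (auto simp: Ind_act Ind_add simp del: carrier_free_Abelian_group_iff)
  next
    fix x r s assume "x \<in> carrier Ind" and rs: "r \<in> carrier R" "s \<in> carrier R"
    then obtain a where a: "x = Rel #>\<^bsub>FG\<^esub> a" "a \<in> carrier FG" unfolding Ind_carrier by auto
    show "x \<star>\<^bsub>Ind\<^esub> (r \<oplus> s) = x \<star>\<^bsub>Ind\<^esub> r \<oplus>\<^bsub>Ind\<^esub> x \<star>\<^bsub>Ind\<^esub> s"
      unfolding a(1) using a(2) rs tc add_closed split[of a r s]
      by (subst (1 2 3) Ind_act) (simp_all add: Ind_add coset_eq_iff)
    show "x \<star>\<^bsub>Ind\<^esub> (r \<otimes> s) = (x \<star>\<^bsub>Ind\<^esub> r) \<star>\<^bsub>Ind\<^esub> s"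
      unfolding a(1) using a(2) rs tc tt[of a r s]
      by (simp add: Ind_act translate_keys)
  next
    fix x assume "x \<in> carrier Ind"
    then show "x \<star>\<^bsub>Ind\<^esub> \<one> = x"
      unfolding Ind_carrier by (auto simp: Ind_act t1)
  qed
qed

lemma tens_closed: "x \<in> carrier M \<Longrightarrow> r \<in> carrier R \<Longrightarrow> tens x r \<in> carrier Ind"
  unfolding Ind_carrier tens_def by (auto intro!: imageI)

lemma tens_act:
  "x \<in> carrier M \<Longrightarrow> r \<in> carrier R \<Longrightarrow> s \<in> carrier R \<Longrightarrow> tens x r \<star>\<^bsub>Ind\<^esub> s = tens x (r \<otimes> s)"
  unfolding tens_def by (simp add: Ind_act)

lemma tens_add_left:
  assumes "x \<in> carrier M" "y \<in> carrier M" "r \<in> carrier R"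
  shows "tens (x \<oplus>\<^bsub>M\<^esub> y) r = tens x r \<oplus>\<^bsub>Ind\<^esub> tens y r"
proof -
  have "frag_of (x \<oplus>\<^bsub>M\<^esub> y, r) - frag_of (x, r) - frag_of (y, r) \<in> Rel"
    by (rule Rel_relator) (use assms in \<open>auto simp: tensor_relators_def\<close>)
  then show ?thesis
    unfolding tens_def using assms keys_add[of "frag_of (x, r)" "frag_of (y, r)"]
    by (subst Ind_add; (subst coset_eq_iff)?) (auto simp: diff_diff_eq keys_frag_of)
qed

lemma tens_balanced:
  assumes "x \<in> carrier M" "b \<in> B" "r \<in> carrier R"
  shows "tens (x \<star>\<^bsub>M\<^esub> b) r = tens x (b \<otimes> r)"
proof -
  have "frag_of (x \<star>\<^bsub>M\<^esub> b, r) - frag_of (x, b \<otimes> r) \<in> Rel"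
    by (rule Rel_relator) (use assms in \<open>auto simp: tensor_relators_def\<close>)
  then show ?thesis
    unfolding tens_def using assms B_subset by (subst coset_eq_iff) (auto simp: ract_closed)
qed

lemma Ind_induct [consumes 1, case_names tens diff]:
  assumes "y \<in> carrier Ind"
    and tens: "\<And>x r. x \<in> carrier M \<Longrightarrow> r \<in> carrier R \<Longrightarrow> P (tens x r)"
    and diff: "\<And>y z. y \<in> carrier Ind \<Longrightarrow> z \<in> carrier Ind \<Longrightarrow> P y \<Longrightarrow> P z \<Longrightarrow> P (y \<ominus>\<^bsub>Ind\<^esub> z)"
  shows "P y"
proof -
  interpret I: right_module R Ind by (rule right_module_Ind)
  obtain a where a: "y = Rel #>\<^bsub>FG\<^esub> a" "Poly_Mapping.keys a \<subseteq> carrier M \<times> carrier R"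
    using assms(1) unfolding Ind_carrier by auto
  have cl: "Rel #>\<^bsub>FG\<^esub> c \<in> carrier Ind" if "Poly_Mapping.keys c \<subseteq> carrier M \<times> carrier R" for c
    using that unfolding Ind_carrier by auto
  have d: "Rel #>\<^bsub>FG\<^esub> (c - d) = (Rel #>\<^bsub>FG\<^esub> c) \<ominus>\<^bsub>Ind\<^esub> (Rel #>\<^bsub>FG\<^esub> d)"
    if c: "Poly_Mapping.keys c \<subseteq> carrier M \<times> carrier R" and d: "Poly_Mapping.keys d \<subseteq> carrier M \<times> carrier R" for c d
  proof -
    have k: "Poly_Mapping.keys (c - d) \<subseteq> carrier M \<times> carrier R" using keys_diff[of c d] c d by auto
    have "(Rel #>\<^bsub>FG\<^esub> (c - d)) \<oplus>\<^bsub>Ind\<^esub> (Rel #>\<^bsub>FG\<^esub> d) = Rel #>\<^bsub>FG\<^esub> c"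
      using k d by (subst Ind_add) auto
    then show ?thesis
      using cl[OF k] cl[OF d] by (metis I.M.minus_eq I.M.a_assoc I.M.a_inv_closed I.M.r_neg I.M.r_zero)
  qed
  have "P (Rel #>\<^bsub>FG\<^esub> a)"
    using a(2)
  proof (induction a rule: free_Abelian_group_induct[consumes 1])
    case 1
    have "P (tens \<zero>\<^bsub>M\<^esub> \<zero> \<ominus>\<^bsub>Ind\<^esub> tens \<zero>\<^bsub>M\<^esub> \<zero>)" by (intro diff tens tens_closed) auto
    then show ?case using tens_closed[of "\<zero>\<^bsub>M\<^esub>" \<zero>] by (simp add: I.M.minus_eq I.M.r_neg Ind_zero)
  next
    case (2 a b)
    then show ?case using diff cl by (simp add: d)
  next
    case (3 x)
    then show ?case using tens by (cases x) (auto simp: tens_def)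
  qed
  then show ?thesis by (simp add: a)
qed

text \<open>The universal property of the tensor product: balanced biadditive maps factor through it.\<close>

lemma Ind_universal:
  assumes A: "comm_group A"
    and cl: "\<And>x r. x \<in> carrier M \<Longrightarrow> r \<in> carrier R \<Longrightarrow> \<beta> x r \<in> carrier A"
    and add_l: "\<And>x y r. x \<in> carrier M \<Longrightarrow> y \<in> carrier M \<Longrightarrow> r \<in> carrier R \<Longrightarrow>
      \<beta> (x \<oplus>\<^bsub>M\<^esub> y) r = \<beta> x r \<otimes>\<^bsub>A\<^esub> \<beta> y r"
    and add_r: "\<And>x r s. x \<in> carrier M \<Longrightarrow> r \<in> carrier R \<Longrightarrow> s \<in> carrier R \<Longrightarrow>
      \<beta> x (r \<oplus> s) = \<beta> x r \<otimes>\<^bsub>A\<^esub> \<beta> x s"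
    and bal: "\<And>x b r. x \<in> carrier M \<Longrightarrow> b \<in> B \<Longrightarrow> r \<in> carrier R \<Longrightarrow>
      \<beta> (x \<star>\<^bsub>M\<^esub> b) r = \<beta> x (b \<otimes> r)"
  obtains h where "h \<in> hom (add_monoid Ind) A"
    "\<And>x r. x \<in> carrier M \<Longrightarrow> r \<in> carrier R \<Longrightarrow> h (tens x r) = \<beta> x r"
proof -
  interpret A: comm_group A by fact
  have "case_prod \<beta> ` (carrier M \<times> carrier R) \<subseteq> carrier A" using cl by auto
  then obtain h0 where "h0 \<in> hom FG A"
    and h0: "\<And>x. x \<in> carrier M \<times> carrier R \<Longrightarrow> h0 (frag_of x) = case_prod \<beta> x"
    using A.free_Abelian_group_universal[of "case_prod \<beta>" "carrier M \<times> carrier R"] by blast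
  then interpret h0: group_hom FG A h0 by (intro group_hom.intro group_hom_axioms.intro) auto
  have h0_diff: "h0 (a - b) = h0 a \<otimes>\<^bsub>A\<^esub> inv\<^bsub>A\<^esub> h0 b"
    if "Poly_Mapping.keys a \<subseteq> carrier M \<times> carrier R" "Poly_Mapping.keys b \<subseteq> carrier M \<times> carrier R" for a b
    using h0.hom_mult[of a "- b"] h0.hom_inv[of b] that by simp
  have rel: "h0 r = \<one>\<^bsub>A\<^esub>" if "r \<in> tensor_relators R B M" for r
  proof -
    have D: "h0 (frag_of (x, r) - frag_of (y, s)) = \<beta> x r \<otimes>\<^bsub>A\<^esub> inv\<^bsub>A\<^esub> \<beta> y s"
      if "x \<in> carrier M" "y \<in> carrier M" "r \<in> carrier R" "s \<in> carrier R" for x y r s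
      using that by (subst h0_diff) (auto simp: h0)
    have D3: "h0 (frag_of (x, r) - frag_of (y, s) - frag_of (z, t))
        = \<beta> x r \<otimes>\<^bsub>A\<^esub> inv\<^bsub>A\<^esub> \<beta> y s \<otimes>\<^bsub>A\<^esub> inv\<^bsub>A\<^esub> \<beta> z t"
      if "x \<in> carrier M" "y \<in> carrier M" "z \<in> carrier M" "r \<in> carrier R" "s \<in> carrier R" "t \<in> carrier R"
      for x y z r s t
      using that keys_diff[of "frag_of (x, r)" "frag_of (y, s)"]
      by (subst h0_diff) (auto simp: h0 D keys_frag_of)
    have cancel: "u \<otimes>\<^bsub>A\<^esub> v \<otimes>\<^bsub>A\<^esub> inv\<^bsub>A\<^esub> u \<otimes>\<^bsub>A\<^esub> inv\<^bsub>A\<^esub> v = \<one>\<^bsub>A\<^esub>" if "u \<in> carrier A" "v \<in> carrier A" for u v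
      using that by (metis A.inv_mult A.m_assoc A.m_closed A.inv_closed A.r_inv)
    show ?thesis
      using that unfolding tensor_relators_def
      by (elim UnE CollectE exE conjE)
        (use cl B_subset in \<open>auto simp: D D3 add_l add_r bal ract_closed cancel subsetD\<close>)
  qed
  have Rel1: "h0 a = \<one>\<^bsub>A\<^esub>" if "a \<in> Rel" for a
    using that
  proof (induction rule: Rel_induct)
    case (minus h)
    then show ?case using h0.hom_inv[of h] rel relators_closed by (auto simp: subset_iff)
  next
    case (add a b)
    then show ?case using h0.hom_mult[of a b] Rel_closed by auto
  qed (use rel h0.hom_one in auto)
  define h where "h X = h0 (SOME a. a \<in> carrier FG \<and> X = Rel #>\<^bsub>FG\<^esub> a)" for X
  have h: "h (Rel #>\<^bsub>FG\<^esub> a) = h0 a" if a: "a \<in> carrier FG" for a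
  proof -
    define b where "b = (SOME b. b \<in> carrier FG \<and> Rel #>\<^bsub>FG\<^esub> a = Rel #>\<^bsub>FG\<^esub> b)"
    have b: "b \<in> carrier FG \<and> Rel #>\<^bsub>FG\<^esub> a = Rel #>\<^bsub>FG\<^esub> b"
      unfolding b_def by (rule someI[of _ a]) (use a in simp)
    then have "a - b \<in> Rel" using a coset_eq_iff by auto
    then have "h0 (a - b + b) = h0 b"
      using h0.hom_mult[of "a - b" b] Rel1 Rel_closed[of "a - b"] b h0.hom_closed[of b] by simp
    then show ?thesis by (simp add: h_def b_def)
  qed
  have "h \<in> hom (add_monoid Ind) A"
  proof (rule homI)
    fix X Y assume "X \<in> carrier (add_monoid Ind)" "Y \<in> carrier (add_monoid Ind)"
    then obtain a b where ab: "X = Rel #>\<^bsub>FG\<^esub> a" "a \<in> carrier FG" "Y = Rel #>\<^bsub>FG\<^esub> b" "b \<in> carrier FG"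
      unfolding partial_object.simps monoid.simps by (auto simp: Ind_carrier)
    then show "h (X \<otimes>\<^bsub>add_monoid Ind\<^esub> Y) = h X \<otimes>\<^bsub>A\<^esub> h Y"
      using FG.m_closed[OF ab(2,4)] h0.hom_mult[OF ab(2,4)] by (simp add: Ind_add h)
  qed (auto simp: Ind_carrier h)
  moreover have "h (tens x r) = \<beta> x r" if "x \<in> carrier M" "r \<in> carrier R" for x r
    using that by (simp add: tens_def h h0)
  ultimately show ?thesis using that by blast
qed

end

lemma (in induction_data) evaluation:
  obtains g where "module_hom R Ind M g"
    "\<And>x r. x \<in> carrier M \<Longrightarrow> r \<in> carrier R \<Longrightarrow> g (tens x r) = x \<star>\<^bsub>M\<^esub> r"
proof -
  interpret I: right_module R Ind by (rule right_module_Ind)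
  have "comm_group (add_monoid M)" by (rule M.a_comm_group)
  then obtain g where g: "g \<in> hom (add_monoid Ind) (add_monoid M)"
    and tens: "\<And>x r. x \<in> carrier M \<Longrightarrow> r \<in> carrier R \<Longrightarrow> g (tens x r) = x \<star>\<^bsub>M\<^esub> r"
    by (rule Ind_universal[of "add_monoid M" "\<lambda>x r. x \<star>\<^bsub>M\<^esub> r"])
      (use B_subset in \<open>auto simp: ract_closed ract_l_distr ract_r_distr ract_assoc subsetD\<close>)
  interpret g: abelian_group_hom Ind M g
    by (intro abelian_group_homI I.M.abelian_group_axioms M.abelian_group_axioms group_hom.intro
        group_hom_axioms.intro I.M.a_group M.a_group g)
  have "g (y \<star>\<^bsub>Ind\<^esub> r) = g y \<star>\<^bsub>M\<^esub> r" if "y \<in> carrier Ind" "r \<in> carrier R" for y r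
    using that(1)
  proof (induction rule: Ind_induct)
    case (tens x s)
    then show ?case using that(2) by (simp add: tens_act \<open>\<And>x r. _ \<Longrightarrow> _ \<Longrightarrow> g (tens x r) = _\<close> ract_assoc)
  next
    case (diff y z)
    then have "y \<star>\<^bsub>Ind\<^esub> r \<in> carrier Ind" "z \<star>\<^bsub>Ind\<^esub> r \<in> carrier Ind"
      using that(2) by (auto intro: I.ract_closed)
    then have "g ((y \<ominus>\<^bsub>Ind\<^esub> z) \<star>\<^bsub>Ind\<^esub> r) = g (y \<star>\<^bsub>Ind\<^esub> r) \<ominus>\<^bsub>M\<^esub> g (z \<star>\<^bsub>Ind\<^esub> r)"
      unfolding I.ract_diff[OF diff(1,2) that(2)] by (simp add: I.M.minus_eq M.minus_eq)
    also have "\<dots> = (g y \<ominus>\<^bsub>M\<^esub> g z) \<star>\<^bsub>M\<^esub> r"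
      using diff that(2) by (simp add: ract_diff)
    also have "g y \<ominus>\<^bsub>M\<^esub> g z = g (y \<ominus>\<^bsub>Ind\<^esub> z)"
      using diff(1,2) by (simp add: I.M.minus_eq M.minus_eq)
    finally show ?case .
  qed
  then have "module_hom R Ind M g"
    unfolding module_hom_def using g.hom_closed by auto
  then show ?thesis using that tens by blast
qed

section \<open>The Hecke algebra as a ring\<close>

lemma letters_simps [simp]: "letters (u + v) = letters u @ letters v" "letters 0 = []"
  by (simp_all add: plus_gen_word_def zero_gen_word_def)

lemma free_algebra_simps [simp]:
  "mult (free_algebra n) = (*)" "one (free_algebra n) = 1"
  "ring.zero (free_algebra n) = 0" "add (free_algebra n) = (+)"
  by (simp_all add: free_algebra_def)

lemma mem_free_algebra:
  "x \<in> carrier (free_algebra n) \<longleftrightarrow> (\<forall>w\<in>Poly_Mapping.keys x. set (letters w) \<subseteq> {1..<n})"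
  by (simp add: free_algebra_def)

lemma free_algebra_closed:
  fixes x y :: "gen_word \<Rightarrow>\<^sub>0 'a::field" and c :: 'a
  shows "(0 :: gen_word \<Rightarrow>\<^sub>0 'a) \<in> carrier (free_algebra n)"
    "(1 :: gen_word \<Rightarrow>\<^sub>0 'a) \<in> carrier (free_algebra n)"
    "x \<in> carrier (free_algebra n) \<Longrightarrow> y \<in> carrier (free_algebra n) \<Longrightarrow> x + y \<in> carrier (free_algebra n)"
    "x \<in> carrier (free_algebra n) \<Longrightarrow> - x \<in> carrier (free_algebra n)"
    "x \<in> carrier (free_algebra n) \<Longrightarrow> y \<in> carrier (free_algebra n) \<Longrightarrow> x - y \<in> carrier (free_algebra n)"
    "x \<in> carrier (free_algebra n) \<Longrightarrow> y \<in> carrier (free_algebra n) \<Longrightarrow> x * y \<in> carrier (free_algebra n)"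
    "set (letters w) \<subseteq> {1..<n} \<Longrightarrow> Poly_Mapping.single w c \<in> carrier (free_algebra n)"
proof -
  show "x + y \<in> carrier (free_algebra n)"
    if "x \<in> carrier (free_algebra n)" "y \<in> carrier (free_algebra n)" for x y :: "gen_word \<Rightarrow>\<^sub>0 'a"
    using that Poly_Mapping.keys_add[of x y] unfolding mem_free_algebra by blast
  show m: "- x \<in> carrier (free_algebra n)"
    if "x \<in> carrier (free_algebra n)" for x :: "gen_word \<Rightarrow>\<^sub>0 'a"
    using that unfolding mem_free_algebra by (auto simp: in_keys_iff)
  show "x - y \<in> carrier (free_algebra n)"
    if "x \<in> carrier (free_algebra n)" "y \<in> carrier (free_algebra n)" for x y :: "gen_word \<Rightarrow>\<^sub>0 'a"
    using that m[of y] Poly_Mapping.keys_add[of x "- y"] unfolding mem_free_algebra by auto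
  show "x * y \<in> carrier (free_algebra n)"
    if "x \<in> carrier (free_algebra n)" "y \<in> carrier (free_algebra n)" for x y :: "gen_word \<Rightarrow>\<^sub>0 'a"
    using that keys_mult[of x y] unfolding mem_free_algebra by fastforce
qed (auto simp: mem_free_algebra split: if_splits)

lemma free_algebra_induct [consumes 1, case_names zero single add]:
  assumes "x \<in> carrier (free_algebra n)" "P 0"
    "\<And>w c. set (letters w) \<subseteq> {1..<n} \<Longrightarrow> P (Poly_Mapping.single w c)"
    "\<And>x y. x \<in> carrier (free_algebra n) \<Longrightarrow> y \<in> carrier (free_algebra n) \<Longrightarrow> P x \<Longrightarrow> P y \<Longrightarrow> P (x + y)"
  shows "P x"
proof -
  have "x = (\<Sum>w\<in>Poly_Mapping.keys x. Poly_Mapping.single w (Poly_Mapping.lookup x w))"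
    by (rule poly_mapping_eqI) (auto simp: lookup_sum lookup_single when_def in_keys_iff)
  moreover have "(\<Sum>w\<in>S. Poly_Mapping.single w (Poly_Mapping.lookup x w)) \<in> carrier (free_algebra n) \<and>
    P (\<Sum>w\<in>S. Poly_Mapping.single w (Poly_Mapping.lookup x w))"
    if "finite S" "S \<subseteq> Poly_Mapping.keys x" for S
    using that
  proof (induction S)
    case (insert w S)
    have "set (letters w) \<subseteq> {1..<n}" using assms(1) insert.prems by (auto simp: mem_free_algebra)
    then show ?case using insert assms(3,4) by (auto simp: free_algebra_closed)
  qed (auto simp: assms(2) free_algebra_closed)
  ultimately show ?thesis using finite_keys by (metis order_refl)
qed

lemma ring_free_algebra: "ring (free_algebra n)"
proof (rule ringI)
  show "abelian_group (free_algebra n)"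
    by (rule abelian_groupI) (auto simp: free_algebra_closed algebra_simps intro!: bexI[of _ "- _"])
  show "Group.monoid (free_algebra n)"
    by (rule monoidI) (auto simp: free_algebra_closed algebra_simps)
qed (auto simp: algebra_simps)

lemma free_gen_closed: "i \<in> {1..<n} \<Longrightarrow> free_gen i \<in> carrier (free_algebra n)"
  and free_const_closed: "free_const c \<in> carrier (free_algebra n)"
  unfolding free_gen_def free_const_def by (auto intro!: free_algebra_closed)

lemma free_const_simps:
  "free_const (c + d) = free_const c + free_const d"
  "free_const (c * d) = free_const c * free_const d"
  "free_const 1 = 1" "free_const 0 = 0"
  by (simp_all add: free_const_def single_add mult_single)

lemma free_const_central: "free_const c * x = x * free_const c"
proof -
  have "free_const c * Poly_Mapping.single w d = Poly_Mapping.single w d * free_const c" for w and d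
    by (simp add: free_const_def mult_single mult.commute)
  moreover have "x = (\<Sum>w\<in>Poly_Mapping.keys x. Poly_Mapping.single w (Poly_Mapping.lookup x w))"
    by (rule poly_mapping_eqI) (auto simp: lookup_sum lookup_single when_def in_keys_iff)
  ultimately show ?thesis by (metis (no_types, lifting) sum_distrib_left sum_distrib_right sum.cong)
qed

lemma hecke_relators_closed: "hecke_relators n q \<subseteq> carrier (free_algebra n)"
  unfolding hecke_relators_def
  by (auto intro!: free_algebra_closed free_gen_closed free_const_closed)

lemma ideal_hecke_ideal: "ideal (hecke_ideal n q) (free_algebra n)"
  unfolding hecke_ideal_def
  by (rule ring.genideal_ideal[OF ring_free_algebra hecke_relators_closed])

locale hecke =
  fixes n :: nat and q :: "'a::field"
begin

abbreviation "H \<equiv> hecke_algebra n q"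
abbreviation "T \<equiv> hecke_gen n q"
abbreviation "sc \<equiv> hecke_scalar n q"
abbreviation H_mult (infixl \<open>\<cdot>\<close> 70) where "x \<cdot> y \<equiv> x \<otimes>\<^bsub>H\<^esub> y"

sublocale I: ideal "hecke_ideal n q" "free_algebra n"
  by (rule ideal_hecke_ideal)

sublocale H: ring H
  unfolding hecke_algebra_def by (rule I.quotient_is_ring)

definition proj :: "(gen_word \<Rightarrow>\<^sub>0 'a) \<Rightarrow> (gen_word \<Rightarrow>\<^sub>0 'a) set" where
  "proj x = hecke_ideal n q +>\<^bsub>free_algebra n\<^esub> x"

lemma T_eq: "T i = proj (free_gen i)" and sc_eq: "sc c = proj (free_const c)"
  by (simp_all add: hecke_gen_def hecke_scalar_def proj_def)

lemma proj_hom: "proj \<in> ring_hom (free_algebra n) H"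
  using I.rcos_ring_hom unfolding proj_def[abs_def] hecke_algebra_def .

lemma proj_closed: "x \<in> carrier (free_algebra n) \<Longrightarrow> proj x \<in> carrier H"
  by (rule ring_hom_closed[OF proj_hom])

lemma proj_add: "x \<in> carrier (free_algebra n) \<Longrightarrow> y \<in> carrier (free_algebra n) \<Longrightarrow>
    proj (x + y) = proj x \<oplus>\<^bsub>H\<^esub> proj y"
  and proj_mult: "x \<in> carrier (free_algebra n) \<Longrightarrow> y \<in> carrier (free_algebra n) \<Longrightarrow>
    proj (x * y) = proj x \<otimes>\<^bsub>H\<^esub> proj y"
  and proj_one: "proj 1 = \<one>\<^bsub>H\<^esub>"
  using ring_hom_add[OF proj_hom] ring_hom_mult[OF proj_hom] ring_hom_one[OF proj_hom] by auto

lemma carrier_H: "carrier H = proj ` carrier (free_algebra n)"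
  unfolding hecke_algebra_def FactRing_def A_RCOSETS_def' proj_def by auto

lemma proj_ideal: "x \<in> hecke_ideal n q \<Longrightarrow> proj x = \<zero>\<^bsub>H\<^esub>"
  unfolding hecke_algebra_def proj_def FactRing_def
  using I.a_rcos_zero[OF ideal_hecke_ideal] by simp

lemma proj_zero: "proj 0 = \<zero>\<^bsub>H\<^esub>"
  using additive_subgroup.zero_closed[OF ideal.axioms(1)[OF ideal_hecke_ideal]]
  by (intro proj_ideal) simp

text \<open>All relations of the Hecke algebra are obtained from this, with both sides of the relation
  written out in the free algebra.\<close>

lemma proj_relator:
  assumes "x \<in> carrier (free_algebra n)" "y \<in> carrier (free_algebra n)" "x - y \<in> hecke_relators n q"
  shows "proj x = proj y"
proof -
  have "x - y \<in> hecke_ideal n q"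
    using ring.genideal_self[OF ring_free_algebra hecke_relators_closed] assms(3)
    unfolding hecke_ideal_def by blast
  from proj_ideal[OF this] have "proj (x - y + y) = proj y"
    using assms proj_closed by (subst proj_add) (auto simp: free_algebra_closed)
  then show ?thesis by simp
qed

lemma T_closed [simp, intro]: "i \<in> {1..<n} \<Longrightarrow> T i \<in> carrier H"
  unfolding T_eq by (intro proj_closed free_gen_closed)

lemma sc_closed [simp, intro]: "sc c \<in> carrier H"
  unfolding sc_eq by (intro proj_closed free_const_closed)

lemma sc_add: "sc (c + d) = sc c \<oplus>\<^bsub>H\<^esub> sc d"
  and sc_mult: "sc (c * d) = sc c \<otimes>\<^bsub>H\<^esub> sc d"
  and sc_one: "sc 1 = \<one>\<^bsub>H\<^esub>" and sc_zero: "sc 0 = \<zero>\<^bsub>H\<^esub>"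
  by (simp_all add: sc_eq free_const_simps proj_add proj_mult proj_one proj_zero free_const_closed)

lemma sc_central: "h \<in> carrier H \<Longrightarrow> sc c \<otimes>\<^bsub>H\<^esub> h = h \<otimes>\<^bsub>H\<^esub> sc c"
  unfolding carrier_H sc_eq
  by (auto simp: proj_mult[symmetric] free_const_closed free_const_central)

lemma T_quadratic:
  assumes "i \<in> {1..<n}"
  shows "T i \<otimes>\<^bsub>H\<^esub> T i = sc (q - 1) \<otimes>\<^bsub>H\<^esub> T i \<oplus>\<^bsub>H\<^esub> sc q"
proof -
  have c: "free_const (q - 1) = free_const q - (1 :: gen_word \<Rightarrow>\<^sub>0 'a)"
    using free_const_simps(1)[of "q - 1" 1] by (simp add: free_const_simps(3))
  have "(free_gen i - free_const q) * (free_gen i + 1) \<in> hecke_relators n q"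
    using assms unfolding hecke_relators_def by blast
  then have "free_gen i * free_gen i - (free_const (q - 1) * free_gen i + free_const q) \<in> hecke_relators n q"
    unfolding c by (simp add: algebra_simps)
  from proj_relator[OF _ _ this] assms show ?thesis
    by (simp add: T_eq sc_eq proj_add proj_mult free_algebra_closed free_gen_closed free_const_closed)
qed

lemma T_commute:
  assumes "i \<in> {1..<n}" "j \<in> {1..<n}" "i + 1 < j \<or> j + 1 < i"
  shows "T i \<otimes>\<^bsub>H\<^esub> T j = T j \<otimes>\<^bsub>H\<^esub> T i"
proof -
  have "\<bar>int i - int j\<bar> > 1" using assms(3) by auto
  then have "free_gen i * free_gen j - free_gen j * free_gen i \<in> hecke_relators n q"
    using assms(1,2) unfolding hecke_relators_def by blast
  from proj_relator[OF _ _ this] assms show ?thesis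
    by (simp add: T_eq proj_mult free_algebra_closed free_gen_closed)
qed

lemma T_braid:
  assumes "i \<in> {1..<n}" "i + 1 \<in> {1..<n}"
  shows "T i \<otimes>\<^bsub>H\<^esub> T (i + 1) \<otimes>\<^bsub>H\<^esub> T i = T (i + 1) \<otimes>\<^bsub>H\<^esub> T i \<otimes>\<^bsub>H\<^esub> T (i + 1)"
proof -
  have "free_gen i * free_gen (i + 1) * free_gen i - free_gen (i + 1) * free_gen i * free_gen (i + 1)
    \<in> hecke_relators n q"
    using assms unfolding hecke_relators_def by blast
  from proj_relator[OF _ _ this] assms show ?thesis
    by (simp add: T_eq proj_mult free_algebra_closed free_gen_closed del: One_nat_def add_Suc_right)
qed

text \<open>The unital subalgebra generated by the $T_i$ with $i \in J$.  Statements about all elements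
  of the Hecke algebra or of a parabolic subalgebra are proved by induction over its rules.\<close>

inductive_set subalg :: "nat set \<Rightarrow> (gen_word \<Rightarrow>\<^sub>0 'a) set set" for J where
  sc: "sc c \<in> subalg J"
| T: "i \<in> J \<Longrightarrow> T i \<in> subalg J"
| add: "x \<in> subalg J \<Longrightarrow> y \<in> subalg J \<Longrightarrow> x \<oplus>\<^bsub>H\<^esub> y \<in> subalg J"
| mult: "x \<in> subalg J \<Longrightarrow> y \<in> subalg J \<Longrightarrow> x \<cdot> y \<in> subalg J"

lemma subalg_closed: "x \<in> subalg J \<Longrightarrow> J \<subseteq> {1..<n} \<Longrightarrow> x \<in> carrier H"
  by (induction rule: subalg.induct) auto

lemma subalg_mono: "x \<in> subalg J \<Longrightarrow> J \<subseteq> K \<Longrightarrow> x \<in> subalg K"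
  by (induction rule: subalg.induct) (auto intro: subalg.intros)

lemma subalg_one: "\<one>\<^bsub>H\<^esub> \<in> subalg J" and subalg_zero: "\<zero>\<^bsub>H\<^esub> \<in> subalg J"
  using subalg.sc[of 1 J] subalg.sc[of 0 J] by (simp_all add: sc_one sc_zero)

lemma carrier_eq_subalg: "carrier H = subalg {1..<n}"
proof (intro equalityI subsetI)
  fix h assume "h \<in> carrier H"
  then obtain x where x: "h = proj x" "x \<in> carrier (free_algebra n)" by (auto simp: carrier_H)
  have "proj x \<in> subalg {1..<n}"
    using x(2)
  proof (induction rule: free_algebra_induct)
    case (single w c)
    have "proj (Poly_Mapping.single (Word is) c) \<in> subalg {1..<n}" if "set is \<subseteq> {1..<n}" for "is"
      using that
    proof (induction "is")
      case Nil
      have "Poly_Mapping.single (Word []) c = free_const c"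
        by (simp add: free_const_def zero_gen_word_def)
      then show ?case using subalg.sc by (simp add: sc_eq[symmetric])
    next
      case (Cons i "is")
      have "Poly_Mapping.single (Word (i # is)) c = free_gen i * Poly_Mapping.single (Word is) c"
        by (simp add: free_gen_def mult_single plus_gen_word_def)
      then have "proj (Poly_Mapping.single (Word (i # is)) c) = T i \<cdot> proj (Poly_Mapping.single (Word is) c)"
        using Cons.prems by (simp add: T_eq proj_mult free_gen_closed free_algebra_closed(7))
      then show ?case using Cons by (auto intro!: subalg.mult subalg.T)
    qed
    then show ?case using single by (cases w) auto
  qed (auto simp: proj_zero proj_add subalg_zero intro: subalg.add)
  then show "h \<in> subalg {1..<n}" by (simp add: x)
qed (rule subalg_closed, auto)

lemma subalg_commute:
  assumes "x \<in> subalg J" "J \<subseteq> {1..<n}" "k \<in> {1..<n}" "\<And>i. i \<in> J \<Longrightarrow> i + 1 < k \<or> k + 1 < i"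
  shows "x \<cdot> T k = T k \<cdot> x"
  using assms(1)
proof (induction rule: subalg.induct)
  case (T i)
  then show ?case using assms(2-4) T_commute[of i k] by blast
next
  case (add x y)
  then show ?case
    using assms(2,3) subalg_closed[of x] subalg_closed[of y] by (simp add: H.l_distr H.r_distr)
next
  case (mult x y)
  note c = subalg_closed[OF mult(1) assms(2)] subalg_closed[OF mult(2) assms(2)] T_closed[OF assms(3)]
  have "x \<cdot> y \<cdot> T k = x \<cdot> (T k \<cdot> y)" using c mult by (simp add: H.m_assoc)
  also have "\<dots> = T k \<cdot> x \<cdot> y" using c mult by (simp flip: H.m_assoc)
  finally show ?case using c by (simp add: H.m_assoc)
qed (use assms sc_central in auto)

text \<open>$T_j T_{j+1} \cdots T_{j+l-1}$, which moves the letter in position $j$ of a word to position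
  $j + l$.\<close>

fun chain :: "nat \<Rightarrow> nat \<Rightarrow> (gen_word \<Rightarrow>\<^sub>0 'a) set" where
  "chain j 0 = \<one>\<^bsub>H\<^esub>"
| "chain j (Suc l) = chain j l \<cdot> T (j + l)"

lemma chain_subalg: "chain j l \<in> subalg {j..<j + l}"
  by (induction l) (auto simp: subalg_one intro!: subalg.mult subalg.T elim: subalg_mono)

lemma chain_closed: "1 \<le> j \<Longrightarrow> j + l \<le> n \<Longrightarrow> chain j l \<in> carrier H"
  by (rule subalg_closed[OF chain_subalg]) auto

lemma chain_Suc_left:
  "1 \<le> j \<Longrightarrow> j + Suc l \<le> n \<Longrightarrow> chain j (Suc l) = T j \<cdot> chain (Suc j) l"
proof (induction l)
  case (Suc l)
  then have "chain j (Suc (Suc l)) = T j \<cdot> chain (Suc j) l \<cdot> T (j + Suc l)" by simp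
  then show ?case using Suc.prems chain_closed[of "Suc j" l] by (simp add: H.m_assoc)
qed simp

text \<open>Transports a generator through a chain.  Generators at distance at least two commute, and the
  one place where this fails is handled by the braid relation.\<close>

lemma chain_shift:
  "1 \<le> j \<Longrightarrow> j + l \<le> n \<Longrightarrow> j \<le> k \<Longrightarrow> k + 1 < j + l \<Longrightarrow>
    chain j l \<cdot> T k = T (k + 1) \<cdot> chain j l"
proof (induction l)
  case (Suc l)
  have c: "chain j l \<in> carrier H" "T (j + l) \<in> carrier H" "T k \<in> carrier H" "T (k + 1) \<in> carrier H"
    using Suc.prems chain_closed[of j l] by auto
  show ?case
  proof (cases "k + 1 < j + l")
    case True
    have "T (j + l) \<cdot> T k = T k \<cdot> T (j + l)" using Suc.prems True by (intro T_commute) auto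
    then have "chain j (Suc l) \<cdot> T k = chain j l \<cdot> T k \<cdot> T (j + l)"
      using c by (simp add: H.m_assoc)
    then show ?thesis using Suc True c by (simp add: H.m_assoc)
  next
    case False
    then have k: "j + l = k + 1" using Suc.prems by simp
    then obtain l' where l': "l = Suc l'" "j + l' = k" using Suc.prems by (cases l) auto
    have c': "chain j l' \<in> carrier H" using Suc.prems l' by (intro chain_closed) auto
    have comm: "chain j l' \<cdot> T (k + 1) = T (k + 1) \<cdot> chain j l'"
      by (rule subalg_commute[OF chain_subalg]) (use Suc.prems l' in auto)
    have "chain j (Suc l) \<cdot> T k = chain j l' \<cdot> (T k \<cdot> T (k + 1) \<cdot> T k)"
      using c c' k l' by (simp add: H.m_assoc)
    also have "T k \<cdot> T (k + 1) \<cdot> T k = T (k + 1) \<cdot> T k \<cdot> T (k + 1)"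
      by (rule T_braid) (use Suc.prems in auto)
    also have "chain j l' \<cdot> \<dots> = chain j l' \<cdot> T (k + 1) \<cdot> T k \<cdot> T (k + 1)"
      using c c' by (simp add: H.m_assoc)
    also have "\<dots> = T (k + 1) \<cdot> chain j (Suc l)"
      unfolding comm using c c' k l' by (simp add: H.m_assoc)
    finally show ?thesis .
  qed
qed simp

lemma chain_chain_shift:
  "1 \<le> j \<Longrightarrow> j + Suc l \<le> n \<Longrightarrow> l' \<le> l \<Longrightarrow>
    chain (Suc j) l' \<cdot> chain j (Suc l) = chain j (Suc l) \<cdot> chain j l'"
proof (induction l')
  case 0
  then show ?case using chain_closed[of j "Suc l"] by (simp del: chain.simps(2))
next
  case (Suc l')
  have c: "chain (Suc j) l' \<in> carrier H" "chain j l' \<in> carrier H" "chain j (Suc l) \<in> carrier H"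
    "T (j + l') \<in> carrier H" "T (Suc j + l') \<in> carrier H"
    using Suc.prems by (auto intro!: chain_closed simp del: chain.simps(2))
  have "T (j + l' + 1) \<cdot> chain j (Suc l) = chain j (Suc l) \<cdot> T (j + l')"
    by (rule chain_shift[symmetric]) (use Suc.prems in auto)
  then have "chain (Suc j) (Suc l') \<cdot> chain j (Suc l)
    = chain (Suc j) l' \<cdot> chain j (Suc l) \<cdot> T (j + l')"
    using c by (simp add: H.m_assoc del: chain.simps(2)) (simp add: chain.simps(2)[of "Suc j" l'] H.m_assoc c del: chain.simps(2))
  also have "\<dots> = chain j (Suc l) \<cdot> chain j l' \<cdot> T (j + l')"
    using Suc by simp
  finally show ?case using c by (simp add: H.m_assoc del: chain.simps(2)) (simp add: chain.simps(2)[of j l'])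
qed

text \<open>The two chains move two neighbouring letters to the right end; swapping these at the end is the
  same as swapping them at the start.\<close>

lemma chain_swap:
  assumes "1 \<le> j" "j + Suc l \<le> n"
  shows "chain (Suc j) l \<cdot> chain j l \<cdot> T (j + l) = T j \<cdot> chain (Suc j) l \<cdot> chain j l"
proof -
  have c: "chain (Suc j) l \<in> carrier H" "chain j l \<in> carrier H" "T (j + l) \<in> carrier H" "T j \<in> carrier H"
    using assms by (auto intro!: chain_closed)
  have "chain (Suc j) l \<cdot> chain j l \<cdot> T (j + l) = chain (Suc j) l \<cdot> chain j (Suc l)"
    using c by (simp add: H.m_assoc)
  also have "\<dots> = chain j (Suc l) \<cdot> chain j l"
    by (rule chain_chain_shift) (use assms in auto)
  also have "\<dots> = T j \<cdot> chain (Suc j) l \<cdot> chain j l"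
    using chain_Suc_left[OF assms] by simp
  finally show ?thesis .
qed

text \<open>An expression for $\sum_d (-1)^{\ell(d)} q^{ab-\ell(d)} T_d$, with $d$ running over the minimal
  right coset representatives of $\mathfrak{S}_a \times \mathfrak{S}_b$ in $\mathfrak{S}_{a+b}$.
  These correspond to words with $a$ letters $1$ and $b$ letters $2$.  The first summand collects the
  words that end in $2$, and the second those that end in $1$, for which the last $1$ of the sorted word
  is moved to the end.  The power of $q$ clears the denominators of $(-q)^{-\ell(d)}$ and makes the recursion
  the Pascal rule for Gaussian binomials.\<close>

fun shuffle :: "nat \<Rightarrow> nat \<Rightarrow> (gen_word \<Rightarrow>\<^sub>0 'a) set" where
  "shuffle 0 b = \<one>\<^bsub>H\<^esub>"
| "shuffle (Suc a) 0 = \<one>\<^bsub>H\<^esub>"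
| "shuffle (Suc a) (Suc b) = sc (q ^ Suc a) \<cdot> shuffle (Suc a) b
    \<oplus>\<^bsub>H\<^esub> sc ((- 1) ^ Suc b) \<cdot> (chain (Suc a) (Suc b) \<cdot> shuffle a (Suc b))"

lemma shuffle_subalg: "shuffle a b \<in> subalg {1..<a + b}"
proof (induction a b rule: shuffle.induct)
  case (3 a b)
  have "chain (Suc a) (Suc b) \<in> subalg {1..<Suc a + Suc b}"
    by (rule subalg_mono[OF chain_subalg]) auto
  moreover have "shuffle (Suc a) b \<in> subalg {1..<Suc a + Suc b}"
    "shuffle a (Suc b) \<in> subalg {1..<Suc a + Suc b}"
    by (rule subalg_mono[OF 3(1)], simp, rule subalg_mono[OF 3(2)], simp)
  ultimately show ?case unfolding shuffle.simps by (intro subalg.intros)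
qed (auto simp: subalg_one)

lemma shuffle_closed: "a + b \<le> n \<Longrightarrow> shuffle a b \<in> carrier H"
  by (rule subalg_closed[OF shuffle_subalg]) auto

lemma shuffle_commute:
  "a + b < k \<Longrightarrow> k < n \<Longrightarrow> shuffle a b \<cdot> T k = T k \<cdot> shuffle a b"
  by (rule subalg_commute[OF shuffle_subalg]) auto

text \<open>Merges blocks of lengths \<open>k, ...\<close> one after the other into an initial block of length \<open>m\<close>.\<close>

fun multishuffle :: "nat \<Rightarrow> nat list \<Rightarrow> (gen_word \<Rightarrow>\<^sub>0 'a) set" where
  "multishuffle m [] = \<one>\<^bsub>H\<^esub>"
| "multishuffle m (k # ks) = shuffle m k \<cdot> multishuffle (m + k) ks"

lemma multishuffle_closed: "m + sum_list ks \<le> n \<Longrightarrow> multishuffle m ks \<in> carrier H"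
  by (induction ks arbitrary: m) (auto simp: shuffle_closed)

end

section \<open>Sign vectors\<close>

locale hecke_rep = hecke n q + N: right_module "hecke_algebra n q" N
  for n and q :: "'a::field" and N :: "('a, 'm) hecke_module" (structure)
begin

lemma act_closed [simp, intro]: "x \<in> carrier N \<Longrightarrow> h \<in> carrier H \<Longrightarrow> x \<star> h \<in> carrier N"
  by (rule N.ract_closed)

lemma act_zero: "x \<in> carrier N \<Longrightarrow> x \<star> \<zero>\<^bsub>H\<^esub> = \<zero>\<^bsub>N\<^esub>"
  using N.ract_r_distr[of x "\<zero>\<^bsub>H\<^esub>" "\<zero>\<^bsub>H\<^esub>"] by (simp add: N.M.add.r_cancel_one')

lemma scale_scale: "x \<in> carrier N \<Longrightarrow> x \<star> sc c \<star> sc d = x \<star> sc (c * d)"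
  by (simp add: sc_mult N.ract_assoc)

lemma scale_add: "x \<in> carrier N \<Longrightarrow> x \<star> sc (c + d) = x \<star> sc c \<oplus>\<^bsub>N\<^esub> x \<star> sc d"
  by (simp add: sc_add N.ract_r_distr)

lemma scale_one: "x \<in> carrier N \<Longrightarrow> x \<star> sc 1 = x"
  by (simp add: sc_one N.ract_one)

lemma scale_uminus: "x \<in> carrier N \<Longrightarrow> x \<star> sc (- 1) = \<ominus>\<^bsub>N\<^esub> x"
  using scale_add[of x "- 1" 1] by (simp add: scale_one sc_zero act_zero N.M.minus_equality)

lemma scale_act: "x \<in> carrier N \<Longrightarrow> h \<in> carrier H \<Longrightarrow> x \<star> sc c \<star> h = x \<star> h \<star> sc c"
  by (simp add: sc_central flip: N.ract_assoc)

text \<open>Vectors on which the parabolic subalgebra generated by the $T_i$ with $i \in J$ acts through the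
  sign character.\<close>

definition sign_on :: "nat set \<Rightarrow> 'm \<Rightarrow> bool" where
  "sign_on J x \<longleftrightarrow> x \<in> carrier N \<and> (\<forall>i\<in>J. x \<star> T i = x \<star> sc (- 1))"

lemma sign_on_closed: "sign_on J x \<Longrightarrow> x \<in> carrier N"
  by (simp add: sign_on_def)

lemma sign_onD: "sign_on J x \<Longrightarrow> i \<in> J \<Longrightarrow> x \<star> T i = x \<star> sc (- 1)"
  by (simp add: sign_on_def)

lemma sign_on_subset: "sign_on J x \<Longrightarrow> K \<subseteq> J \<Longrightarrow> sign_on K x"
  by (auto simp: sign_on_def)

lemma sign_on_commute:
  assumes "sign_on J x" "i \<in> J" "h \<in> carrier H" "i \<in> {1..<n}" "h \<cdot> T i = T i \<cdot> h"
  shows "x \<star> h \<star> T i = x \<star> h \<star> sc (- 1)"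
proof -
  have x: "x \<in> carrier N" using assms(1) by (rule sign_on_closed)
  have "x \<star> h \<star> T i = x \<star> T i \<star> h"
    using x assms(3-5) by (simp flip: N.ract_assoc)
  then show ?thesis using sign_onD[OF assms(1,2)] scale_act[OF x assms(3)] by simp
qed

lemma sign_on_chain:
  assumes "sign_on {1..<n} x" "1 \<le> j" "j + l \<le> n"
  shows "x \<star> chain j l = x \<star> sc ((- 1) ^ l)"
  using assms(3)
proof (induction l)
  case 0
  then show ?case using sign_on_closed[OF assms(1)] by (simp add: N.ract_one scale_one)
next
  case (Suc l)
  have x: "x \<in> carrier N" using assms(1) by (rule sign_on_closed)
  have c: "chain j l \<in> carrier H" "T (j + l) \<in> carrier H" "j + l \<in> {1..<n}"
    using Suc.prems assms by (auto intro!: chain_closed)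
  have "x \<star> chain j (Suc l) = x \<star> sc ((- 1) ^ l) \<star> T (j + l)"
    using Suc x c by (simp add: N.ract_assoc)
  also have "\<dots> = x \<star> sc (- 1) \<star> sc ((- 1) ^ l)"
    using scale_act[OF x c(2)] sign_onD[OF assms(1) c(3)] by simp
  finally show ?case using x by (simp add: scale_scale)
qed

text \<open>On a full sign vector each $T_d$ acts as $(-1)^{\ell(d)}$, so only the powers of $q$ remain.\<close>

lemma sign_on_shuffle_eq:
  assumes "sign_on {1..<n} x" "a + b \<le> n"
  shows "x \<star> shuffle a b = x \<star> sc (gauss q (a + b) a)"
  using assms(2)
proof (induction a b rule: shuffle.induct)
  case (3 a b)
  have x: "x \<in> carrier N" using assms(1) by (rule sign_on_closed)
  have c: "shuffle (Suc a) b \<in> carrier H" "shuffle a (Suc b) \<in> carrier H" "chain (Suc a) (Suc b) \<in> carrier H"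
    using 3 by (auto intro!: shuffle_closed chain_closed simp del: chain.simps)
  have ch: "x \<star> chain (Suc a) (Suc b) = x \<star> sc ((- 1) ^ Suc b)"
    by (rule sign_on_chain[OF assms(1)]) (use 3 in auto)
  have "x \<star> shuffle (Suc a) (Suc b) = x \<star> shuffle (Suc a) b \<star> sc (q ^ Suc a)
     \<oplus>\<^bsub>N\<^esub> x \<star> chain (Suc a) (Suc b) \<star> shuffle a (Suc b) \<star> sc ((- 1) ^ Suc b)"
    using x c by (simp add: N.ract_r_distr N.ract_assoc scale_act del: chain.simps power_Suc)
  also have "\<dots> = x \<star> sc (gauss q (Suc a + b) (Suc a)) \<star> sc (q ^ Suc a)
     \<oplus>\<^bsub>N\<^esub> x \<star> sc (gauss q (a + Suc b) a) \<star> sc ((- 1) ^ Suc b) \<star> sc ((- 1) ^ Suc b)"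
    unfolding ch using 3 x c by (simp add: scale_act[OF _ c(2)] del: power_Suc gauss.simps)
  also have "\<dots> = x \<star> sc (gauss q (Suc a + Suc b) (Suc a))"
    using x by (simp add: scale_scale scale_add[symmetric] power_mult_distrib[symmetric] mult.assoc
        algebra_simps flip: power_add mult_2)
  finally show ?case .
qed (use sign_on_closed[OF assms(1)] in \<open>auto simp: N.ract_one scale_one\<close>)

lemma sign_on_multishuffle_eq:
  assumes "sign_on {1..<n} x" "m + sum_list ks \<le> n"
  shows "x \<star> multishuffle m ks = x \<star> sc (gauss_list q m ks)"
  using assms(2)
proof (induction ks arbitrary: m)
  case Nil
  then show ?case using sign_on_closed[OF assms(1)] by (simp add: N.ract_one scale_one)
next
  case (Cons k ks)
  have x: "x \<in> carrier N" using assms(1) by (rule sign_on_closed)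
  have c: "shuffle m k \<in> carrier H" "multishuffle (m + k) ks \<in> carrier H"
    using Cons.prems by (auto intro!: shuffle_closed multishuffle_closed)
  have "x \<star> multishuffle m (k # ks) = x \<star> shuffle m k \<star> multishuffle (m + k) ks"
    using x c by (simp add: N.ract_assoc)
  also have "\<dots> = x \<star> multishuffle (m + k) ks \<star> sc (gauss q (m + k) m)"
    using x c Cons.prems by (subst sign_on_shuffle_eq[OF assms(1)]) (auto simp: scale_act)
  also have "\<dots> = x \<star> sc (gauss_list q m (k # ks))"
    using Cons x by (simp add: scale_scale mult.commute)
  finally show ?case .
qed

text \<open>The linear algebra behind the last generator.  In the application $t = T_m$ swaps the last two
  letters of a word; $A$ and $D$ collect the words whose last two letters agree, and $w'$ and $w$
  those for which they are in increasing and in decreasing order.\<close>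

lemma sign_combination:
  assumes cl: "A \<in> carrier N" "D \<in> carrier N" "w \<in> carrier N" "w' \<in> carrier N" "t \<in> carrier H"
    and A: "A \<star> t = A \<star> sc (- 1)" and D: "D \<star> t = D \<star> sc (- 1)"
    and w': "w' \<star> t = w" and w: "w \<star> t = w \<star> sc (q - 1) \<oplus>\<^bsub>N\<^esub> w' \<star> sc q"
    and \<alpha>: "\<alpha> = q * \<delta>" and \<gamma>: "\<gamma> = - \<beta>"
  defines "P \<equiv> (A \<oplus>\<^bsub>N\<^esub> w' \<star> sc \<beta>) \<star> sc \<alpha> \<oplus>\<^bsub>N\<^esub> (w \<star> sc \<delta> \<oplus>\<^bsub>N\<^esub> D) \<star> sc \<gamma>"
  shows "P \<star> t = P \<star> sc (- 1)"
proof -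
  have P: "P \<star> r = ((A \<star> r) \<oplus>\<^bsub>N\<^esub> (w' \<star> r \<star> sc \<beta>)) \<star> sc \<alpha>
      \<oplus>\<^bsub>N\<^esub> ((w \<star> r \<star> sc \<delta>) \<oplus>\<^bsub>N\<^esub> (D \<star> r)) \<star> sc \<gamma>" if "r \<in> carrier H" for r
    using that cl unfolding P_def by (simp add: N.ract_l_distr scale_act[OF _ that])
  have c1: "w \<star> sc (\<beta> * \<alpha>) \<oplus>\<^bsub>N\<^esub> w \<star> sc ((q - 1) * \<delta> * \<gamma>) = w \<star> sc (- 1 * \<delta> * \<gamma>)"
    using cl by (subst scale_add[symmetric]) (auto simp: \<alpha> \<gamma> algebra_simps)
  have c2: "q * \<delta> * \<gamma> = - 1 * \<beta> * \<alpha>" by (simp add: \<alpha> \<gamma>)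
  have "P \<star> t = A \<star> sc (- 1 * \<alpha>) \<oplus>\<^bsub>N\<^esub> (w \<star> sc (\<beta> * \<alpha>)
      \<oplus>\<^bsub>N\<^esub> (w \<star> sc ((q - 1) * \<delta> * \<gamma>) \<oplus>\<^bsub>N\<^esub> (w' \<star> sc (q * \<delta> * \<gamma>) \<oplus>\<^bsub>N\<^esub> D \<star> sc (- 1 * \<gamma>))))"
    unfolding P[OF cl(5)] A D w' w using cl by (simp add: N.ract_l_distr scale_scale N.M.a_assoc)
  also have "\<dots> = A \<star> sc (- 1 * \<alpha>) \<oplus>\<^bsub>N\<^esub> ((w \<star> sc (\<beta> * \<alpha>)
      \<oplus>\<^bsub>N\<^esub> w \<star> sc ((q - 1) * \<delta> * \<gamma>)) \<oplus>\<^bsub>N\<^esub> (w' \<star> sc (q * \<delta> * \<gamma>) \<oplus>\<^bsub>N\<^esub> D \<star> sc (- 1 * \<gamma>)))"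
    using cl by (simp add: N.M.a_assoc)
  also have "\<dots> = A \<star> sc (- 1 * \<alpha>) \<oplus>\<^bsub>N\<^esub> (w' \<star> sc (- 1 * \<beta> * \<alpha>)
      \<oplus>\<^bsub>N\<^esub> (w \<star> sc (- 1 * \<delta> * \<gamma>) \<oplus>\<^bsub>N\<^esub> D \<star> sc (- 1 * \<gamma>)))"
    unfolding c1 c2 using cl by (simp only: N.M.a_lcomm act_closed sc_closed N.M.a_closed)
  also have "\<dots> = P \<star> sc (- 1)"
    using cl by (subst P) (auto simp: N.ract_l_distr scale_scale N.M.a_assoc)
  finally show ?thesis .
qed

text \<open>Induction on $a + b$.  The generators other than the last one, $T_m$ with $m = a + b - 1$, respect
  the two summands of the recursion, and there the induction hypothesis applies.  For $T_m$ the
  recursion is unfolded twice, sorting the terms by the last two letters of a word.\<close>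

lemma sign_on_shuffle:
  assumes "sign_on ({1..<a + b} - {a}) x" "a + b \<le> n"
  shows "sign_on {1..<a + b} (x \<star> shuffle a b)"
  using assms
proof (induction "a + b" arbitrary: a b x rule: less_induct)
  case less
  have x: "x \<in> carrier N" using less.prems(1) by (rule sign_on_closed)
  show ?case
  proof (cases "a = 0 \<or> b = 0")
    case True
    moreover have "shuffle a b = \<one>\<^bsub>H\<^esub>" using True by (cases a; cases b) auto
    ultimately show ?thesis using less.prems x by (auto simp: N.ract_one sign_on_def)
  next
    case False
    then obtain a' b' where ab: "a = Suc a'" "b = Suc b'" by (metis not0_implies_Suc)
    define m where "m = a' + b"
    have m: "m = a + b'" "m + 1 = a + b" "m + 1 \<le> n" using ab less.prems(2) by (auto simp: m_def)
    have c [simp]: "shuffle a b' \<in> carrier H" "shuffle a' b \<in> carrier H" "shuffle a' b' \<in> carrier H"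
      "chain a b \<in> carrier H" "chain a b' \<in> carrier H" "chain a' b \<in> carrier H \<or> a' = 0" "T m \<in> carrier H"
      using ab m by (auto intro!: shuffle_closed chain_closed simp del: chain.simps)
    note scale_act_T = scale_act[OF _ c(7)]
    define y1 where "y1 = x \<star> shuffle a b'"
    define y2 where "y2 = x \<star> chain a b \<star> shuffle a' b"
    have yc: "y1 \<in> carrier N" "y2 \<in> carrier N" using x by (auto simp: y1_def y2_def)
    have split: "x \<star> shuffle a b = y1 \<star> sc (q ^ a) \<oplus>\<^bsub>N\<^esub> y2 \<star> sc ((- 1) ^ b)"
      unfolding ab shuffle.simps using x c unfolding y1_def y2_def ab
      by (simp add: N.ract_r_distr N.ract_assoc scale_act del: chain.simps power_Suc)
    have s1: "sign_on {1..<m} y1"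
      unfolding y1_def m(1) by (rule less.hyps) (use ab m less.prems in \<open>auto intro: sign_on_subset\<close>)
    have "sign_on ({1..<a' + b} - {a'}) (x \<star> chain a b)"
      unfolding sign_on_def
    proof (intro conjI ballI)
      fix k assume k: "k \<in> {1..<a' + b} - {a'}"
      show "x \<star> chain a b \<star> T k = x \<star> chain a b \<star> sc (- 1)"
      proof (cases "k < a'")
        case True
        show ?thesis
        proof (rule sign_on_commute[OF less.prems(1)])
          show "chain a b \<cdot> T k = T k \<cdot> chain a b"
            by (rule subalg_commute[OF chain_subalg]) (use True k ab m in auto)
        qed (use True k ab m c(4) in \<open>auto simp del: chain.simps\<close>)
      next
        case False
        have "chain a b \<cdot> T k = T (k + 1) \<cdot> chain a b"
          by (rule chain_shift) (use False k ab m in auto)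
        moreover have "T k \<in> carrier H" "T (k + 1) \<in> carrier H" using False k ab m by auto
        ultimately have "x \<star> chain a b \<star> T k = x \<star> T (k + 1) \<star> chain a b"
          using x c(4) by (simp only: N.ract_assoc[symmetric])
        also have "x \<star> T (k + 1) = x \<star> sc (- 1)"
          by (rule sign_onD[OF less.prems(1)]) (use False k ab in auto)
        finally show ?thesis using x by (simp add: scale_act)
      qed
    qed (use x in simp)
    then have s2: "sign_on {1..<m} y2"
      unfolding y2_def m_def by (rule less.hyps[rotated]) (use ab m in auto)
    \<comment> \<open>$A$ is zero if no word has two final letters $2$, that is, if $b = 1$; similarly for $D$ and $a = 1$.\<close>
    define A where "A = (case b' of 0 \<Rightarrow> \<zero>\<^bsub>N\<^esub> | Suc b0 \<Rightarrow> x \<star> shuffle a b0 \<star> sc (q ^ a))"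
    define D where "D = (case a' of 0 \<Rightarrow> \<zero>\<^bsub>N\<^esub>
      | Suc a0 \<Rightarrow> x \<star> (chain a b \<cdot> chain a' b) \<star> shuffle a0 b \<star> sc ((- 1) ^ b))"
    define w' where "w' = x \<star> chain a b' \<star> shuffle a' b'"
    define w where "w = x \<star> chain a b \<star> shuffle a' b'"
    have wc: "w \<in> carrier N" "w' \<in> carrier N" using x by (auto simp: w_def w'_def)
    have sh: "shuffle a' b' \<cdot> T m = T m \<cdot> shuffle a' b'"
      by (rule shuffle_commute) (use ab m in auto)
    have chain_b: "chain a b = chain a b' \<cdot> T m" by (simp add: ab m)
    have w'T: "w' \<star> T m = w"
      unfolding w'_def w_def chain_b using x sh by (simp add: N.ract_assoc[symmetric] H.m_assoc)
    have "w \<star> T m = x \<star> chain a b' \<star> (T m \<cdot> T m) \<star> shuffle a' b'"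
      unfolding w_def chain_b using x sh by (simp add: N.ract_assoc[symmetric] H.m_assoc)
    also have "\<dots> = w \<star> sc (q - 1) \<oplus>\<^bsub>N\<^esub> w' \<star> sc q"
    proof -
      have TT: "T m \<cdot> T m = sc (q - 1) \<cdot> T m \<oplus>\<^bsub>H\<^esub> sc q"
        by (rule T_quadratic) (use m ab in auto)
      show ?thesis
        using x unfolding w_def w'_def chain_b TT
        by (simp add: N.ract_r_distr N.ract_l_distr N.ract_assoc scale_act)
    qed
    finally have wT: "w \<star> T m = w \<star> sc (q - 1) \<oplus>\<^bsub>N\<^esub> w' \<star> sc q" .
    have zero: "\<zero>\<^bsub>N\<^esub> \<star> h = \<zero>\<^bsub>N\<^esub>" if "h \<in> carrier H" for h
      using N.ract_l_distr[of "\<zero>\<^bsub>N\<^esub>" "\<zero>\<^bsub>N\<^esub>" h] that by (simp add: N.M.add.r_cancel_one')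
    have A: "A \<in> carrier N" "A \<star> T m = A \<star> sc (- 1)" "y1 = A \<oplus>\<^bsub>N\<^esub> w' \<star> sc ((- 1) ^ b')"
    proof -
      have "A \<in> carrier N \<and> A \<star> T m = A \<star> sc (- 1) \<and> y1 = A \<oplus>\<^bsub>N\<^esub> w' \<star> sc ((- 1) ^ b')"
      proof (cases b')
        case 0
        then show ?thesis using x ab
          by (cases a') (auto simp: A_def y1_def w'_def zero N.ract_one scale_one)
      next
        case (Suc b0)
        have s: "shuffle a b0 \<in> carrier H" using Suc m ab by (intro shuffle_closed) auto
        have "x \<star> shuffle a b0 \<star> T m = x \<star> shuffle a b0 \<star> sc (- 1)"
          by (rule sign_on_commute[OF less.prems(1) _ s _ shuffle_commute]) (use Suc m ab in auto)
        then have "A \<star> T m = A \<star> sc (- 1)"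
          using x s by (simp add: A_def Suc scale_act_T scale_scale mult.commute)
        moreover have "y1 = A \<oplus>\<^bsub>N\<^esub> w' \<star> sc ((- 1) ^ b')"
          unfolding y1_def A_def w'_def Suc ab shuffle.simps using x c s unfolding ab Suc
          by (simp add: N.ract_r_distr N.ract_assoc scale_act del: chain.simps power_Suc)
        ultimately show ?thesis using x s by (simp add: A_def Suc)
      qed
      then show "A \<in> carrier N" "A \<star> T m = A \<star> sc (- 1)" "y1 = A \<oplus>\<^bsub>N\<^esub> w' \<star> sc ((- 1) ^ b')" by auto
    qed
    have D: "D \<in> carrier N" "D \<star> T m = D \<star> sc (- 1)" "y2 = w \<star> sc (q ^ a') \<oplus>\<^bsub>N\<^esub> D"
    proof -
      have "D \<in> carrier N \<and> D \<star> T m = D \<star> sc (- 1) \<and> y2 = w \<star> sc (q ^ a') \<oplus>\<^bsub>N\<^esub> D"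
      proof (cases a')
        case 0
        then show ?thesis using x by (auto simp: D_def y2_def w_def zero N.ract_one scale_one)
      next
        case (Suc a0)
        have s: "shuffle a0 b \<in> carrier H" "chain a' b \<in> carrier H" "T a' \<in> carrier H"
          using Suc m ab by (auto intro!: shuffle_closed chain_closed simp del: chain.simps)
        let ?cc = "chain a b \<cdot> chain a' b"
        have com: "shuffle a0 b \<cdot> T m = T m \<cdot> shuffle a0 b"
          by (rule shuffle_commute) (use Suc m ab in auto)
        have "?cc \<cdot> T m = T a' \<cdot> chain a b \<cdot> chain a' b"
          unfolding m_def ab(1) by (rule chain_swap) (use Suc m ab in auto)
        then have cc: "?cc \<cdot> T m = T a' \<cdot> ?cc" using s c by (simp add: H.m_assoc)
        have ccc: "?cc \<in> carrier H" using s c by simp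
        have "x \<star> ?cc \<star> shuffle a0 b \<star> T m = x \<star> (?cc \<cdot> T m) \<star> shuffle a0 b"
          using x s ccc com c(7) by (simp only: N.ract_assoc[symmetric] H.m_assoc H.m_closed act_closed)
        also have "\<dots> = x \<star> T a' \<star> ?cc \<star> shuffle a0 b"
          unfolding cc using x s ccc by (simp only: N.ract_assoc H.m_closed act_closed)
        also have "x \<star> T a' = x \<star> sc (- 1)"
          by (rule sign_onD[OF less.prems(1)]) (use Suc m ab in auto)
        also have "x \<star> sc (- 1) \<star> ?cc \<star> shuffle a0 b = x \<star> ?cc \<star> shuffle a0 b \<star> sc (- 1)"
          using x s ccc by (simp only: scale_act act_closed)
        finally have "D \<star> T m = D \<star> sc (- 1)"
          using x s ccc c(7) by (simp add: D_def Suc scale_act_T scale_scale mult.commute del: chain.simps)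
        moreover have "y2 = w \<star> sc (q ^ a') \<oplus>\<^bsub>N\<^esub> D"
          unfolding y2_def w_def D_def Suc ab shuffle.simps using x c s unfolding ab Suc
          by (simp add: N.ract_r_distr N.ract_assoc scale_act del: chain.simps power_Suc)
        ultimately show ?thesis using x s ccc by (simp add: D_def Suc del: chain.simps)
      qed
      then show "D \<in> carrier N" "D \<star> T m = D \<star> sc (- 1)" "y2 = w \<star> sc (q ^ a') \<oplus>\<^bsub>N\<^esub> D" by auto
    qed
    show ?thesis
      unfolding sign_on_def
    proof (intro conjI ballI)
      show "x \<star> shuffle a b \<in> carrier N" unfolding split using yc by simp
      fix i assume i: "i \<in> {1..<a + b}"
      show "x \<star> shuffle a b \<star> T i = x \<star> shuffle a b \<star> sc (- 1)"
      proof (cases "i = m")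
        case True
        have "q ^ a = q * q ^ a'" "(- 1 :: 'a) ^ b = - ((- 1) ^ b')" by (simp_all add: ab)
        from sign_combination[OF A(1) D(1) wc c(7) A(2) D(2) w'T wT this]
        show ?thesis unfolding split True A(3) D(3) .
      next
        case False
        then have "i \<in> {1..<m}" "T i \<in> carrier H" using i m by auto
        then show ?thesis
          unfolding split using yc sign_onD[OF s1] sign_onD[OF s2]
          by (simp add: N.ract_l_distr scale_act[of _ "T i"] scale_scale mult.commute)
      qed
    qed
  qed
qed

text \<open>Merging one block at a time: generators beyond the merged part commute with the shuffle element,
  and those inside it are covered by the statement for two blocks.\<close>

lemma sign_on_multishuffle:
  assumes "sign_on {i \<in> {1..<m + sum_list ks}. \<forall>j. i \<noteq> m + sum_list (take j ks)} x" "m + sum_list ks \<le> n"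
  shows "sign_on {1..<m + sum_list ks} (x \<star> multishuffle m ks)"
  using assms
proof (induction ks arbitrary: m x)
  case Nil
  then have x: "x \<in> carrier N" by (simp add: sign_on_def)
  have "{i \<in> {1..<m + sum_list []}. \<forall>j. i \<noteq> m + sum_list (take j [])} = {1..<m}" by auto
  then show ?case using Nil x by (simp add: N.ract_one)
next
  case (Cons k ks)
  have x: "x \<in> carrier N" using Cons.prems by (simp add: sign_on_def)
  have c: "shuffle m k \<in> carrier H" "multishuffle (m + k) ks \<in> carrier H"
    using Cons.prems by (auto intro!: shuffle_closed multishuffle_closed)
  have cut: "\<forall>j. i \<noteq> m + sum_list (take j (k # ks))"
    if "i \<noteq> m" "\<And>j. i \<noteq> m + k + sum_list (take j ks)" for i
  proof
    fix j show "i \<noteq> m + sum_list (take j (k # ks))"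
      using that by (cases j) (auto simp: add.assoc)
  qed
  have s: "sign_on {1..<m + k} (x \<star> shuffle m k)"
  proof (rule sign_on_shuffle)
    show "sign_on ({1..<m + k} - {m}) x"
    proof (rule sign_on_subset[OF Cons.prems(1)], rule subsetI)
      fix i assume "i \<in> {1..<m + k} - {m}"
      then show "i \<in> {i \<in> {1..<m + sum_list (k # ks)}. \<forall>j. i \<noteq> m + sum_list (take j (k # ks))}"
        using cut[of i] by auto
    qed
  qed (use Cons.prems in auto)
  have "sign_on {1..<m + k + sum_list ks} (x \<star> shuffle m k \<star> multishuffle (m + k) ks)"
  proof (rule Cons.IH)
    show "sign_on {i \<in> {1..<m + k + sum_list ks}. \<forall>j. i \<noteq> m + k + sum_list (take j ks)} (x \<star> shuffle m k)"
      unfolding sign_on_def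
    proof (intro conjI ballI)
      fix i assume i: "i \<in> {i \<in> {1..<m + k + sum_list ks}. \<forall>j. i \<noteq> m + k + sum_list (take j ks)}"
      have "i \<noteq> m + k" using i by (auto dest: spec[of _ 0])
      then consider "i < m + k" | "m + k < i" by linarith
      then show "x \<star> shuffle m k \<star> T i = x \<star> shuffle m k \<star> sc (- 1)"
      proof cases
        case 1
        then show ?thesis using i by (intro sign_onD[OF s]) auto
      next
        case 2
        have "i \<in> {i \<in> {1..<m + sum_list (k # ks)}. \<forall>j. i \<noteq> m + sum_list (take j (k # ks))}"
          using i 2 cut[of i] by auto
        then show ?thesis
          by (rule sign_on_commute[OF Cons.prems(1) _ c(1) _ shuffle_commute])
            (use i 2 Cons.prems in auto)
      qed
    qed (use x c in auto)
  qed (use Cons.prems in auto)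
  then show ?case using x c by (simp add: N.ract_assoc add.assoc)
qed

end

section \<open>The parabolic subalgebras\<close>

context hecke
begin

lemma foldr_T_subalg:
  "set is \<subseteq> J \<Longrightarrow> foldr (\<lambda>i h. T i \<cdot> h) is \<one>\<^bsub>H\<^esub> \<in> subalg J"
  by (induction "is") (auto simp: subalg_one intro!: subalg.mult subalg.T)

lemma reduced_expr_SOME:
  assumes "w permutes {1..n}"
  shows "reduced_expr n w (SOME is. reduced_expr n w is)"
  using ex_expr_length_inversions[OF assms] unfolding reduced_expr_iff[symmetric]
  by (metis reduced_expr_iff someI_ex)

lemma hecke_T_parabolic:
  assumes "sum_list \<nu> = n" "w \<in> parabolic \<nu>"
  shows "hecke_T n q w \<in> subalg (parabolic_gens \<nu>)"
proof -
  have "w permutes {1..n}" using assms by (simp add: parabolic_iff)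
  from reduced_expr_SOME[OF this] show ?thesis
    unfolding hecke_T_def using reduced_expr_parabolic[OF assms(2)] assms(1)
    by (intro foldr_T_subalg) simp
qed

lemma hecke_T_adjacent:
  assumes "i \<in> {1..<n}"
  shows "hecke_T n q (transpose i (i + 1)) = T i"
  unfolding hecke_T_def reduced_expr_adjacent[OF assms] using assms by simp

lemma hecke_T_id: "hecke_T n q id = \<one>\<^bsub>H\<^esub>"
  unfolding hecke_T_def reduced_expr_id by simp

lemma parabolic_gens_subset: "sum_list \<nu> = n \<Longrightarrow> parabolic_gens \<nu> \<subseteq> {1..<n}"
  by (auto simp: parabolic_gens_def)

lemma finite_parabolic: "finite (parabolic \<nu>)"
  by (rule finite_subset[OF _ finite_permutations[of "{1..sum_list \<nu>}"]]) (auto simp: parabolic_def)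

text \<open>A parabolic subalgebra is defined by the basis elements for chosen reduced expressions; such
  expressions use generators of the parabolic subgroup only.\<close>

lemma hecke_parabolic_subset:
  assumes "sum_list \<nu> = n"
  shows "hecke_parabolic n q \<nu> \<subseteq> subalg (parabolic_gens \<nu>)"
proof
  fix b assume "b \<in> hecke_parabolic n q \<nu>"
  then obtain c where b: "b = (\<Oplus>\<^bsub>H\<^esub>w\<in>parabolic \<nu>. sc (c w) \<cdot> hecke_T n q w)"
    unfolding hecke_parabolic_def by blast
  have t: "sc (c w) \<cdot> hecke_T n q w \<in> subalg (parabolic_gens \<nu>)" if "w \<in> parabolic \<nu>" for w
    using hecke_T_parabolic[OF assms that] by (intro subalg.intros)
  have cl: "x \<in> subalg (parabolic_gens \<nu>) \<Longrightarrow> x \<in> carrier H" for x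
    by (rule subalg_closed[OF _ parabolic_gens_subset[OF assms]])
  have "(\<Oplus>\<^bsub>H\<^esub>w\<in>S. sc (c w) \<cdot> hecke_T n q w) \<in> subalg (parabolic_gens \<nu>)"
    if "finite S" "S \<subseteq> parabolic \<nu>" for S
    using that
  proof (induction S)
    case (insert w S)
    then show ?case
      using t cl[OF t] by (subst H.finsum_insert) (auto intro!: subalg.add simp del: H.m_closed)
  qed (simp add: subalg_zero)
  then show "b \<in> subalg (parabolic_gens \<nu>)"
    unfolding b using finite_parabolic by blast
qed

lemma scaled_hecke_T_in_parabolic:
  assumes "sum_list \<nu> = n" "w \<in> parabolic \<nu>"
  shows "sc d \<cdot> hecke_T n q w \<in> hecke_parabolic n q \<nu>"
proof -
  have cl: "hecke_T n q v \<in> carrier H" if "v \<in> parabolic \<nu>" for v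
    using hecke_T_parabolic[OF assms(1) that] parabolic_gens_subset[OF assms(1)] by (rule subalg_closed)
  let ?c = "\<lambda>v. if w = v then d else 0"
  have "(\<Oplus>\<^bsub>H\<^esub>v\<in>parabolic \<nu>. sc (?c v) \<cdot> hecke_T n q v)
    = (\<Oplus>\<^bsub>H\<^esub>v\<in>parabolic \<nu>. if w = v then sc d \<cdot> hecke_T n q v else \<zero>\<^bsub>H\<^esub>)"
    by (rule H.finsum_cong') (auto simp: cl sc_zero)
  also have "\<dots> = sc d \<cdot> hecke_T n q w"
    by (rule H.finsum_singleton[OF assms(2) finite_parabolic]) (auto simp: cl)
  finally show ?thesis
    unfolding hecke_parabolic_def by (intro CollectI exI[of _ ?c] conjI TrueI) (rule sym)
qed

lemma sc_in_hecke_parabolic: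
  assumes "sum_list \<nu> = n"
  shows "sc c \<in> hecke_parabolic n q \<nu>"
proof -
  have "id \<in> parabolic \<nu>" unfolding parabolic_iff by (auto simp: permutes_id[unfolded id_def] id_def)
  from scaled_hecke_T_in_parabolic[OF assms this, of c] show ?thesis by (simp add: hecke_T_id)
qed

lemma T_in_hecke_parabolic:
  assumes "sum_list \<nu> = n" "i \<in> parabolic_gens \<nu>"
  shows "T i \<in> hecke_parabolic n q \<nu>"
proof -
  have i: "i \<in> {1..<n}" using parabolic_gens_subset[OF assms(1)] assms(2) by blast
  from scaled_hecke_T_in_parabolic[OF assms(1) transpose_in_parabolic[OF assms(2)], of 1]
  show ?thesis using i by (simp add: hecke_T_adjacent[OF i, simplified] sc_one)
qed

end

section \<open>The representation on words\<close>

context hecke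
begin

text \<open>The generator $T_i$ on functions of words, that is, the right action on linear combinations
  $\sum_g \varphi(g) \, g$ with $g T_i = -g$ if $g_i = g_{i+1}$, $g T_i = g s_i$ if
  $g_i < g_{i+1}$, and $g T_i = q \, g s_i + (q-1) g$ if $g_i > g_{i+1}$.  In terms of coefficients it
  makes sense without any finiteness condition on $\varphi$.\<close>

definition word_op :: "nat \<Rightarrow> ((nat \<Rightarrow> nat) \<Rightarrow> 'a) \<Rightarrow> (nat \<Rightarrow> nat) \<Rightarrow> 'a" where
  "word_op i \<phi> g =
    (if g i = g (i + 1) then - \<phi> g
     else if g i < g (i + 1) then q * \<phi> (g \<circ> transpose i (i + 1))
     else \<phi> (g \<circ> transpose i (i + 1)) + (q - 1) * \<phi> g)"

lemma word_op_add: "word_op i (\<lambda>g. \<phi> g + \<psi> g) = (\<lambda>g. word_op i \<phi> g + word_op i \<psi> g)"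
  and word_op_scale: "word_op i (\<lambda>g. c * \<phi> g) = (\<lambda>g. c * word_op i \<phi> g)"
  by (auto simp: word_op_def fun_eq_iff algebra_simps)

lemma word_op_quadratic: "word_op i (word_op i \<phi>) g = (q - 1) * word_op i \<phi> g + q * \<phi> g"
proof -
  have "g \<circ> transpose i (Suc i) \<circ> transpose i (Suc i) = g" by (simp add: comp_assoc)
  then show ?thesis by (auto simp: word_op_def algebra_simps)
qed

lemma word_op_commute:
  assumes "i + 1 < j"
  shows "word_op i (word_op j \<phi>) g = word_op j (word_op i \<phi>) g"
proof -
  have e: "transpose i (Suc i) j = j" "transpose i (Suc i) (Suc j) = Suc j"
    "transpose j (Suc j) i = i" "transpose j (Suc j) (Suc i) = Suc i"
    using assms by (auto simp: transpose_def)
  have c: "g \<circ> transpose i (Suc i) \<circ> transpose j (Suc j) = g \<circ> transpose j (Suc j) \<circ> transpose i (Suc i)"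
    using assms by (auto simp: fun_eq_iff transpose_def)
  show ?thesis by (simp add: word_op_def e c algebra_simps)
qed

text \<open>Only the relative order of the letters $x, y, z$ in the three positions matters.  In each case both
  sides unfold to combinations of the values at the rearrangements of the word; rearrangements that
  coincide because of equal letters have to be identified first.\<close>

lemma word_op_braid:
  "word_op i (word_op (i + 1) (word_op i \<phi>)) g = word_op (i + 1) (word_op i (word_op (i + 1) \<phi>)) g"
proof -
  let ?s = "transpose i (Suc i)" and ?t = "transpose (Suc i) (Suc (Suc i))"
  have e: "?s (Suc (Suc i)) = Suc (Suc i)" "?t i = i" by (auto simp: transpose_def)
  have sts: "g \<circ> ?s \<circ> ?t \<circ> ?s = g \<circ> ?t \<circ> ?s \<circ> ?t" by (auto simp: fun_eq_iff transpose_def)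
  have ss: "h \<circ> ?s \<circ> ?s = h" "h \<circ> ?t \<circ> ?t = h" for h :: "nat \<Rightarrow> nat" by (simp_all add: comp_assoc)
  have s: "h \<circ> ?s = h" if "h i = h (Suc i)" for h :: "nat \<Rightarrow> nat"
    using that by (auto simp: fun_eq_iff transpose_def)
  have t: "h \<circ> ?t = h" if "h (Suc i) = h (Suc (Suc i))" for h :: "nat \<Rightarrow> nat"
    using that by (auto simp: fun_eq_iff transpose_def)
  define x y z where xyz: "x = g i" "y = g (Suc i)" "z = g (Suc (Suc i))"
  have vals: "g i = x" "g (Suc i) = y" "g (Suc (Suc i)) = z" by (simp_all add: xyz)
  have W: "word_op k \<psi> h = (if h k = h (Suc k) then - \<psi> h
     else if h k < h (Suc k) then q * \<psi> (h \<circ> transpose k (Suc k))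
     else \<psi> (h \<circ> transpose k (Suc k)) + (q - 1) * \<psi> h)" for k \<psi> h
    by (simp add: word_op_def)
  have S: "g \<circ> ?s = g" if "x = y" using that s[of g] vals by simp
  have TT: "g \<circ> ?t = g" if "y = z" using that t[of g] vals by simp
  have ST: "g \<circ> ?s \<circ> ?t = g \<circ> ?s" if "x = z" using that t[of "g \<circ> ?s"] vals e by simp
  have TS: "g \<circ> ?t \<circ> ?s = g \<circ> ?t" if "x = z" using that s[of "g \<circ> ?t"] vals e by simp
  have STS: "g \<circ> ?t \<circ> ?s \<circ> ?t = g \<circ> ?t \<circ> ?s" if "x = y"
    using that t[of "g \<circ> ?t \<circ> ?s"] vals e by simp
  have STS': "g \<circ> ?t \<circ> ?s \<circ> ?t = g \<circ> ?s \<circ> ?t" if "y = z"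
    using that s[of "g \<circ> ?s \<circ> ?t"] vals e sts by simp
  note simps = W e ss sts vals
  show ?thesis
  proof (cases x y rule: linorder_cases)
    case xy: less
    show ?thesis
    proof (cases y z rule: linorder_cases)
      case less
      then have "x < z" using xy by simp
      then show ?thesis using xy less by (simp add: simps)
    next
      case equal
      then show ?thesis using xy by (simp add: simps TT STS' algebra_simps)
    next
      case yz: greater
      then show ?thesis using xy
        by (cases x z rule: linorder_cases) (simp_all add: simps ST TS algebra_simps)
    qed
  next
    case xy: equal
    then show ?thesis
      by (cases y z rule: linorder_cases) (simp_all add: simps S TT STS algebra_simps)
  next
    case xy: greater
    show ?thesis
    proof (cases y z rule: linorder_cases)
      case greater
      then have "z < x" using xy by simp
      then show ?thesis using xy greater by (simp add: simps algebra_simps)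
    next
      case equal
      then show ?thesis using xy by (simp add: simps TT STS' algebra_simps)
    next
      case yz: less
      then show ?thesis using xy
        by (cases x z rule: linorder_cases) (simp_all add: simps ST TS algebra_simps)
    qed
  qed
qed

definition words_act :: "((nat \<Rightarrow> nat) \<Rightarrow> 'a) \<Rightarrow> (gen_word \<Rightarrow>\<^sub>0 'a) \<Rightarrow> (nat \<Rightarrow> nat) \<Rightarrow> 'a" where
  "words_act \<phi> x g = (\<Sum>w\<in>Poly_Mapping.keys x. Poly_Mapping.lookup x w * fold word_op (letters w) \<phi> g)"

lemma words_act_superset:
  assumes "finite S" "Poly_Mapping.keys x \<subseteq> S"
  shows "words_act \<phi> x g = (\<Sum>w\<in>S. Poly_Mapping.lookup x w * fold word_op (letters w) \<phi> g)"
  unfolding words_act_def by (rule sum.mono_neutral_left) (use assms in \<open>auto simp: in_keys_iff\<close>)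

lemma words_act_add: "words_act \<phi> (x + y) g = words_act \<phi> x g + words_act \<phi> y g"
proof -
  let ?S = "Poly_Mapping.keys x \<union> Poly_Mapping.keys y"
  have "words_act \<phi> (x + y) g = (\<Sum>w\<in>?S. Poly_Mapping.lookup (x + y) w * fold word_op (letters w) \<phi> g)"
    by (rule words_act_superset) (use Poly_Mapping.keys_add[of x y] in auto)
  also have "\<dots> = words_act \<phi> x g + words_act \<phi> y g"
    by (subst (1 2) words_act_superset[of ?S]) (auto simp: lookup_add algebra_simps sum.distrib)
  finally show ?thesis .
qed

lemma words_act_zero: "words_act \<phi> 0 g = 0"
  by (simp add: words_act_def)

lemma words_act_uminus: "words_act \<phi> (- x) g = - words_act \<phi> x g"
  using words_act_add[of \<phi> x "- x" g] by (simp add: words_act_zero eq_neg_iff_add_eq_0 add.commute)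

lemma words_act_diff: "words_act \<phi> (x - y) g = words_act \<phi> x g - words_act \<phi> y g"
  using words_act_add[of \<phi> x "- y" g] by (simp add: words_act_uminus)

lemma words_act_single: "words_act \<phi> (Poly_Mapping.single w c) g = c * fold word_op (letters w) \<phi> g"
  by (simp add: words_act_def)

lemma fold_word_op_linear:
  "fold word_op is (\<lambda>g. \<phi> g + \<psi> g) = (\<lambda>g. fold word_op is \<phi> g + fold word_op is \<psi> g)"
  "fold word_op is (\<lambda>g. c * \<phi> g) = (\<lambda>g. c * fold word_op is \<phi> g)"
  by (induction "is" arbitrary: \<phi> \<psi>) (simp_all add: word_op_add word_op_scale)

lemma words_act_fun_add: "words_act (\<lambda>g. \<phi> g + \<psi> g) x g = words_act \<phi> x g + words_act \<psi> x g"
  and words_act_fun_scale: "words_act (\<lambda>g. c * \<phi> g) x g = c * words_act \<phi> x g"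
  unfolding words_act_def
  by (simp_all add: fold_word_op_linear algebra_simps sum.distrib sum_distrib_left)

lemma words_act_fun_zero: "words_act (\<lambda>g. 0) x g = 0"
  using words_act_fun_scale[of 0 "\<lambda>g. 0" x g] by simp

lemma words_act_mult:
  assumes "x \<in> carrier (free_algebra n)" "y \<in> carrier (free_algebra n)"
  shows "words_act \<phi> (x * y) = words_act (words_act \<phi> x) y"
  using assms(1)
proof (induction rule: free_algebra_induct)
  case (single w c)
  show ?case using assms(2)
  proof (induction rule: free_algebra_induct)
    case (single v d)
    have "words_act \<phi> (Poly_Mapping.single w c) = (\<lambda>g. c * fold word_op (letters w) \<phi> g)"
      by (simp add: words_act_single fun_eq_iff)
    then show ?case
      by (simp add: fun_eq_iff mult_single words_act_single fold_word_op_linear)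
  qed (auto simp: fun_eq_iff words_act_zero words_act_add distrib_left)
next
  case (add x z)
  have "words_act \<phi> (x + z) = (\<lambda>g. words_act \<phi> x g + words_act \<phi> z g)"
    by (simp add: fun_eq_iff words_act_add)
  then show ?case using add
    by (simp add: fun_eq_iff distrib_right words_act_add words_act_fun_add)
next
  case zero
  have "words_act \<phi> 0 = (\<lambda>g. 0)" by (simp add: fun_eq_iff words_act_zero)
  then show ?case by (simp add: words_act_fun_zero fun_eq_iff words_act_zero)
qed

lemma words_act_gen: "words_act \<phi> (free_gen i) = word_op i \<phi>"
  and words_act_const: "words_act \<phi> (free_const c) = (\<lambda>g. c * \<phi> g)"
  by (simp_all add: fun_eq_iff free_gen_def free_const_def words_act_single)

lemma words_act_one: "words_act \<phi> 1 = \<phi>"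
  using words_act_const[of \<phi> 1] by (simp add: free_const_simps)

text \<open>The elements of the free algebra that act as zero form an ideal, and it contains the relators.\<close>

lemma words_act_ideal:
  assumes "x \<in> hecke_ideal n q"
  shows "words_act \<phi> x g = 0"
proof -
  let ?K = "{x \<in> carrier (free_algebra n). \<forall>\<phi> g. words_act \<phi> x g = 0}"
  have "ideal ?K (free_algebra n)"
  proof (rule idealI[OF ring_free_algebra])
    have inv: "inv\<^bsub>add_monoid (free_algebra n)\<^esub> x = - x"
      if "x \<in> carrier (free_algebra n)" for x :: "gen_word \<Rightarrow>\<^sub>0 'a"
      using that by (intro group.inv_equality[OF I.a_group]) (auto simp: free_algebra_closed)
    have neg: "\<ominus>\<^bsub>free_algebra n\<^esub> x = - x"
      if "x \<in> carrier (free_algebra n)" for x :: "gen_word \<Rightarrow>\<^sub>0 'a"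
      unfolding a_inv_def by (rule inv[OF that])
    show "subgroup ?K (add_monoid (free_algebra n))"
      by (rule I.add.subgroupI)
        (auto simp: free_algebra_closed words_act_add words_act_zero words_act_uminus neg
          intro!: exI[of _ 0])
  next
    fix a x :: "gen_word \<Rightarrow>\<^sub>0 'a"
    assume a: "a \<in> ?K" and x: "x \<in> carrier (free_algebra n)"
    then have "words_act \<phi> a = (\<lambda>g. 0)" for \<phi> by (simp add: fun_eq_iff)
    then show "x \<otimes>\<^bsub>free_algebra n\<^esub> a \<in> ?K" "a \<otimes>\<^bsub>free_algebra n\<^esub> x \<in> ?K"
      using a x by (simp_all add: free_algebra_closed words_act_mult words_act_fun_zero)
  qed
  moreover have "hecke_relators n q \<subseteq> ?K"
  proof
    fix x assume x: "x \<in> hecke_relators n q"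
    note cl = free_algebra_closed free_gen_closed free_const_closed
    have "words_act \<phi> x g = 0" for \<phi> g
      using x unfolding hecke_relators_def
    proof (elim UnE CollectE exE conjE)
      fix i assume i: "x = (free_gen i - free_const q) * (free_gen i + 1)" "i \<in> {1..<n}"
      have "words_act \<phi> (free_gen i - free_const q) = (\<lambda>g. word_op i \<phi> g + (- q) * \<phi> g)"
        by (simp add: fun_eq_iff words_act_diff words_act_gen words_act_const)
      then show "words_act \<phi> x g = 0"
        unfolding i(1) using i(2)
        by (simp add: words_act_mult cl words_act_add words_act_gen words_act_one word_op_add
            word_op_scale word_op_quadratic del: mult_minus_left) (simp add: algebra_simps)
    next
      fix i j assume ij: "x = free_gen i * free_gen j - free_gen j * free_gen i"
        "i \<in> {1..<n}" "j \<in> {1..<n}" "1 < \<bar>int i - int j\<bar>"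
      then have "i + 1 < j \<or> j + 1 < i" by auto
      then show "words_act \<phi> x g = 0"
        unfolding ij(1) using ij(2,3) word_op_commute[of i j \<phi> g] word_op_commute[of j i \<phi> g]
        by (auto simp: words_act_diff words_act_mult cl words_act_gen)
    next
      fix i assume i: "x = free_gen i * free_gen (i + 1) * free_gen i
        - free_gen (i + 1) * free_gen i * free_gen (i + 1)" "i \<in> {1..<n}" "i + 1 \<in> {1..<n}"
      show "words_act \<phi> x g = 0"
        unfolding i(1) using i(2,3) word_op_braid[of i \<phi> g]
        by (simp add: words_act_diff words_act_mult cl words_act_gen)
    qed
    then show "x \<in> ?K" using subsetD[OF hecke_relators_closed x] by simp
  qed
  ultimately have "hecke_ideal n q \<subseteq> ?K"
    unfolding hecke_ideal_def by (rule ring.genideal_minimal[OF ring_free_algebra])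
  then show ?thesis using assms by auto
qed

text \<open>The action of a coset is computed from any representative in the free algebra.\<close>

definition words_module :: "('a, (nat \<Rightarrow> nat) \<Rightarrow> 'a) hecke_module" where
  "words_module = \<lparr>carrier = UNIV, mult = undefined, one = undefined,
     ring.zero = (\<lambda>g. 0), add = (\<lambda>\<phi> \<psi> g. \<phi> g + \<psi> g),
     ract = (\<lambda>\<phi> h. words_act \<phi> (SOME x. x \<in> carrier (free_algebra n) \<and> h = proj x))\<rparr>"

abbreviation words_ract (infixl \<open>\<bullet>\<close> 70) where "\<phi> \<bullet> h \<equiv> \<phi> \<star>\<^bsub>words_module\<^esub> h"

lemma words_module_simps [simp]:
  "carrier words_module = UNIV" "ring.zero words_module = (\<lambda>g. 0)"
  "add words_module \<phi> \<psi> = (\<lambda>g. \<phi> g + \<psi> g)"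
  by (simp_all add: words_module_def)

lemma words_module_act:
  assumes "x \<in> carrier (free_algebra n)"
  shows "\<phi> \<bullet> proj x = words_act \<phi> x"
proof -
  define y where "y = (SOME y. y \<in> carrier (free_algebra n) \<and> proj x = proj y)"
  have y: "y \<in> carrier (free_algebra n) \<and> proj x = proj y"
    unfolding y_def by (rule someI[of _ x]) (use assms in simp)
  have "x \<in> hecke_ideal n q +>\<^bsub>free_algebra n\<^esub> x"
    using I.a_rcos_self assms by simp
  then have "x \<in> hecke_ideal n q +>\<^bsub>free_algebra n\<^esub> y" using y by (simp add: proj_def)
  then obtain k where "k \<in> hecke_ideal n q" "x = k + y" by (auto simp: a_r_coset_def')
  then have "words_act \<phi> x = words_act \<phi> y"
    by (simp add: fun_eq_iff words_act_add words_act_ideal)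
  then show ?thesis by (simp add: words_module_def y_def)
qed

lemma right_module_words: "right_module H words_module"
proof (intro right_module.intro right_module_axioms.intro)
  show "ring H" ..
  show "abelian_group words_module"
  proof (rule abelian_groupI)
    fix \<phi> show "\<exists>\<psi>\<in>carrier words_module. \<psi> \<oplus>\<^bsub>words_module\<^esub> \<phi> = \<zero>\<^bsub>words_module\<^esub>"
      by (rule bexI[of _ "\<lambda>g. - \<phi> g"]) auto
  qed (auto simp: algebra_simps)
next
  fix \<phi> \<psi> r assume "r \<in> carrier H"
  then obtain x where "r = proj x" "x \<in> carrier (free_algebra n)" by (auto simp: carrier_H)
  then show "(\<phi> \<oplus>\<^bsub>words_module\<^esub> \<psi>) \<bullet> r
    = \<phi> \<bullet> r \<oplus>\<^bsub>words_module\<^esub> \<psi> \<bullet> r"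
    by (simp add: words_module_act words_act_fun_add fun_eq_iff)
next
  fix \<phi> r s assume "r \<in> carrier H" "s \<in> carrier H"
  then obtain x y where xy: "r = proj x" "x \<in> carrier (free_algebra n)" "s = proj y" "y \<in> carrier (free_algebra n)"
    by (auto simp: carrier_H)
  show "\<phi> \<bullet> (r \<oplus>\<^bsub>H\<^esub> s)
    = \<phi> \<bullet> r \<oplus>\<^bsub>words_module\<^esub> \<phi> \<bullet> s"
    using xy by (simp add: proj_add[symmetric] words_module_act words_act_add fun_eq_iff free_algebra_closed)
  show "\<phi> \<bullet> (r \<cdot> s)
    = \<phi> \<bullet> r \<bullet> s"
    using xy by (simp add: proj_mult[symmetric] words_module_act words_act_mult free_algebra_closed)
next
  fix \<phi> show "\<phi> \<bullet> \<one>\<^bsub>H\<^esub> = \<phi>"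
    by (simp add: proj_one[symmetric] words_module_act words_act_one free_algebra_closed)
qed simp

sublocale W: hecke_rep n q words_module
  by (intro hecke_rep.intro right_module_words)

lemma words_act_T: "i \<in> {1..<n} \<Longrightarrow> \<phi> \<bullet> T i = word_op i \<phi>"
  by (simp add: T_eq words_module_act free_gen_closed words_act_gen)

lemma words_act_sc: "\<phi> \<bullet> sc c = (\<lambda>g. c * \<phi> g)"
  by (simp add: sc_eq words_module_act free_const_closed words_act_const)

text \<open>The weight $q^{\ell}$ compensates for the asymmetry between ascents and descents in the action
  of $T_i$.  It is used for finite sets of words closed under adjacent
  transpositions.\<close>

definition word_form :: "(nat \<Rightarrow> nat) set \<Rightarrow> ((nat \<Rightarrow> nat) \<Rightarrow> 'a) \<Rightarrow> ((nat \<Rightarrow> nat) \<Rightarrow> 'a) \<Rightarrow> 'a" where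
  "word_form A \<phi> \<psi> = (\<Sum>g\<in>A. q ^ word_inversions n g * \<phi> g * \<psi> g)"

lemma word_form_selfadjoint:
  assumes i: "i \<in> {1..<n}" and A: "\<And>g. g \<in> A \<Longrightarrow> g \<circ> transpose i (i + 1) \<in> A"
  shows "word_form A (word_op i \<phi>) \<psi> = word_form A \<phi> (word_op i \<psi>)"
proof -
  let ?s = "transpose i (i + 1)"
  define \<alpha> where "\<alpha> g = (if g i = g (i + 1) then - 1 else if g i < g (i + 1) then 0 else q - 1)" for g :: "nat \<Rightarrow> nat"
  define \<beta> where "\<beta> g = (if g i = g (i + 1) then 0 else if g i < g (i + 1) then q else 1)" for g :: "nat \<Rightarrow> nat"
  define wt where "wt g = q ^ word_inversions n g" for g
  have op: "word_op i \<phi> g = \<alpha> g * \<phi> g + \<beta> g * \<phi> (g \<circ> ?s)" for \<phi> g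
    by (simp add: word_op_def \<alpha>_def \<beta>_def)
  have ss: "g \<circ> ?s \<circ> ?s = g" for g :: "nat \<Rightarrow> nat" by (simp add: comp_assoc)
  \<comment> \<open>The off-diagonal part of the operator becomes symmetric after weighting.\<close>
  have wt: "wt (g \<circ> ?s) * \<beta> (g \<circ> ?s) = wt g * \<beta> g" for g
  proof (cases "g i" "g (i + 1)" rule: linorder_cases)
    case less
    then show ?thesis using word_inversions_swap[OF i less] by (simp add: wt_def \<beta>_def)
  next
    case equal
    then show ?thesis by (simp add: \<beta>_def)
  next
    case greater
    then have "word_inversions n (g \<circ> ?s \<circ> ?s) = Suc (word_inversions n (g \<circ> ?s))"
      by (intro word_inversions_swap[OF i]) simp
    then show ?thesis using greater unfolding ss by (simp add: wt_def \<beta>_def)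
  qed
  have bij: "bij_betw (\<lambda>g. g \<circ> ?s) A A"
    by (rule bij_betw_byWitness[of _ "\<lambda>g. g \<circ> ?s"]) (use A ss in auto)
  have "(\<Sum>g\<in>A. wt g * (\<beta> g * \<phi> (g \<circ> ?s)) * \<psi> g) = (\<Sum>g\<in>A. wt g * \<phi> g * (\<beta> g * \<psi> (g \<circ> ?s)))"
  proof -
    have "(\<Sum>g\<in>A. wt g * (\<beta> g * \<phi> (g \<circ> ?s)) * \<psi> g)
      = (\<Sum>g\<in>A. wt (g \<circ> ?s) * (\<beta> (g \<circ> ?s) * \<phi> (g \<circ> ?s \<circ> ?s)) * \<psi> (g \<circ> ?s))"
      by (rule sum.reindex_bij_betw[OF bij, symmetric])
    also have "\<dots> = (\<Sum>g\<in>A. (wt (g \<circ> ?s) * \<beta> (g \<circ> ?s)) * \<phi> g * \<psi> (g \<circ> ?s))"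
      unfolding ss by (simp only: mult.assoc)
    also have "\<dots> = (\<Sum>g\<in>A. wt g * \<phi> g * (\<beta> g * \<psi> (g \<circ> ?s)))"
      unfolding wt by (simp only: mult_ac)
    finally show ?thesis .
  qed
  then show ?thesis
    unfolding word_form_def op wt_def[symmetric] by (simp add: algebra_simps sum.distrib)
qed

text \<open>Elements that involve only the $T_i$ with $i < m$ rearrange letters in positions up to $m$ only.\<close>

lemma words_support:
  assumes h: "h \<in> subalg {1..<m}" and m: "m \<le> n"
    and P: "\<And>i g. i \<in> {1..<m} \<Longrightarrow> P (g \<circ> transpose i (i + 1)) \<Longrightarrow> P g"
    and supp: "\<And>g. \<phi> g \<noteq> 0 \<Longrightarrow> P g"
  shows "(\<phi> \<bullet> h) g \<noteq> 0 \<Longrightarrow> P g"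
  using h supp
proof (induction arbitrary: \<phi> g rule: subalg.induct)
  case (sc c)
  then show ?case by (auto simp: words_act_sc)
next
  case (T i)
  then have "i \<in> {1..<n}" using m by auto
  then have "\<phi> g \<noteq> 0 \<or> \<phi> (g \<circ> transpose i (i + 1)) \<noteq> 0"
    using T.prems(1) by (auto simp: words_act_T word_op_def split: if_splits)
  then show ?case using T P by blast
next
  case (add x y)
  have "x \<in> carrier H" "y \<in> carrier H" using add.hyps m by (auto intro!: subalg_closed)
  then have "(\<phi> \<bullet> x) g \<noteq> 0 \<or> (\<phi> \<bullet> y) g \<noteq> 0"
    using add.prems(1) by (auto simp: W.N.ract_r_distr)
  then show ?case using add by blast
next
  case (mult x y)
  have "x \<in> carrier H" "y \<in> carrier H" using mult.hyps m by (auto intro!: subalg_closed)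
  then have "((\<phi> \<bullet> x) \<bullet> y) g \<noteq> 0"
    using mult.prems(1) by (simp add: W.N.ract_assoc)
  then show ?case using mult.IH mult.prems(2) by blast
qed

lemma chain_support:
  assumes "1 \<le> a" "a + b \<le> n" "l \<le> b"
    and supp: "\<And>g. \<phi> g \<noteq> 0 \<Longrightarrow> (\<forall>i\<in>{1..a}. g i < c) \<and> (\<forall>i\<in>{a<..a + b}. g i = c)"
  shows "(\<phi> \<bullet> chain a l) g \<noteq> 0 \<Longrightarrow> g (a + l) < c \<and> (\<forall>i\<in>{a + l<..a + b}. g i = c)"
  using assms(3)
proof (induction l arbitrary: g)
  case 0
  then show ?case using supp[of g] assms(1) by (simp add: W.N.ract_one)
next
  case (Suc l)
  let ?\<psi> = "\<phi> \<bullet> chain a l" and ?k = "a + l"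
  have k: "?k \<in> {1..<n}" using Suc.prems assms by auto
  have IH: "h ?k < c" "h (Suc ?k) = c" "\<forall>i\<in>{?k<..a + b}. h i = c" if "?\<psi> h \<noteq> 0" for h
    using Suc.IH[OF that] Suc.prems(2) by auto
  have ne: "word_op ?k ?\<psi> g \<noteq> 0"
    using Suc.prems(1) k assms chain_closed[of a l] Suc.prems(2)
    by (simp add: W.N.ract_assoc words_act_T)
  have sw: "g (Suc ?k) < c \<and> (\<forall>i\<in>{Suc ?k<..a + b}. g i = c)" if "?\<psi> (g \<circ> transpose ?k (Suc ?k)) \<noteq> 0"
  proof (intro conjI ballI)
    show "g (Suc ?k) < c" using IH(1)[OF that] by simp
    fix i assume "i \<in> {Suc ?k<..a + b}"
    then have "i \<in> {?k<..a + b}" "transpose ?k (Suc ?k) i = i" by (auto simp: transpose_def)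
    then show "g i = c" using bspec[OF IH(3)[OF that], of i] by simp
  qed
  consider "g ?k < g (Suc ?k)" | "g (Suc ?k) \<le> g ?k" by linarith
  then show ?case
  proof cases
    case 1
    then show ?thesis using ne sw by (auto simp: word_op_def split: if_splits)
  next
    case 2
    have "?\<psi> g = 0"
    proof (rule ccontr)
      assume "?\<psi> g \<noteq> 0"
      from IH(1,2)[OF this] 2 show False by simp
    qed
    then show ?thesis using ne sw by (auto simp: word_op_def split: if_splits)
  qed
qed

text \<open>In the recursion the second summand moves one of the first $a$ letters, which are smaller than
  $c$, to position $a + b$, where it stays; so only the first summand reaches a word with letters $c$
  in the positions $a+1, \dots, a+b$.\<close>

lemma shuffle_coefficient:
  assumes "a + b \<le> n" and u: "\<And>i. i \<in> {a<..a + b} \<Longrightarrow> u i = c"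
    and supp: "\<And>g. \<phi> g \<noteq> 0 \<Longrightarrow> (\<forall>i\<in>{1..a}. g i < c) \<and> (\<forall>i\<in>{a<..a + b}. g i = c)"
  shows "(\<phi> \<bullet> shuffle a b) u = q ^ (a * b) * \<phi> u"
proof (cases a)
  case 0
  then show ?thesis by (simp add: W.N.ract_one)
next
  case (Suc a')
  show ?thesis
    using assms
  proof (induction b)
    case 0
    then show ?case by (simp add: Suc W.N.ract_one)
  next
    case (Suc b)
    let ?\<psi> = "\<phi> \<bullet> chain a (Suc b)"
    have c: "chain a (Suc b) \<in> carrier H" "shuffle a b \<in> carrier H" "shuffle a' (Suc b) \<in> carrier H"
      using Suc.prems \<open>a = Suc a'\<close> by (auto intro!: chain_closed shuffle_closed simp del: chain.simps)
    have s: "shuffle a (Suc b) = sc (q ^ a) \<cdot> shuffle a b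
      \<oplus>\<^bsub>H\<^esub> sc ((- 1) ^ Suc b) \<cdot> (chain a (Suc b) \<cdot> shuffle a' (Suc b))"
      by (simp add: \<open>a = Suc a'\<close>)
    have "\<phi> \<bullet> shuffle a (Suc b)
      = (\<phi> \<bullet> shuffle a b) \<bullet> sc (q ^ a)
        \<oplus>\<^bsub>words_module\<^esub> (?\<psi> \<bullet> shuffle a' (Suc b)) \<bullet> sc ((- 1) ^ Suc b)"
      unfolding s using c
      by (simp add: W.N.ract_r_distr W.N.ract_assoc W.scale_act del: chain.simps power_Suc words_module_simps(3))
    then have "(\<phi> \<bullet> shuffle a (Suc b)) u
      = q ^ a * (\<phi> \<bullet> shuffle a b) u
        + (- 1) ^ Suc b * (?\<psi> \<bullet> shuffle a' (Suc b)) u"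
      by (simp add: words_act_sc del: chain.simps power_Suc)
    also have "(?\<psi> \<bullet> shuffle a' (Suc b)) u = 0"
    proof (rule ccontr)
      assume "(?\<psi> \<bullet> shuffle a' (Suc b)) u \<noteq> 0"
      then have "u (a + Suc b) < c"
      proof (rule words_support[OF shuffle_subalg, rotated 3])
        show "a' + Suc b \<le> n" using Suc.prems \<open>a = Suc a'\<close> by simp
        show "g (a + Suc b) < c" if "?\<psi> g \<noteq> 0" for g
          using chain_support[of a "Suc b" "Suc b" \<phi> c g] that Suc.prems \<open>a = Suc a'\<close> by auto
        show "g (a + Suc b) < c" if "i \<in> {1..<a' + Suc b}" "(g \<circ> transpose i (i + 1)) (a + Suc b) < c" for i g
          using that \<open>a = Suc a'\<close> by (auto simp: transpose_def split: if_splits)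
      qed
      then show False using Suc.prems(2)[of "a + Suc b"] by simp
    qed
    also have "(\<phi> \<bullet> shuffle a b) u = q ^ (a * b) * \<phi> u"
      by (rule Suc.IH) (use Suc.prems in auto)
    finally show ?case by (simp add: power_add)
  qed
qed

lemma multishuffle_coefficient:
  assumes "q \<noteq> 0" "\<nu> = pre @ ks" "sum_list \<nu> = n" "\<phi> (block_index \<nu>) \<noteq> 0"
    and "\<And>g. \<phi> g \<noteq> 0 \<Longrightarrow> (\<forall>i\<in>{1..sum_list pre}. g i < length pre) \<and>
      (\<forall>i\<in>{sum_list pre<..n}. g i = block_index \<nu> i)"
  shows "(\<phi> \<bullet> multishuffle (sum_list pre) ks) (block_index \<nu>) \<noteq> 0"
  using assms
proof (induction ks arbitrary: pre \<phi>)
  case Nil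
  then show ?case by (simp add: W.N.ract_one)
next
  case (Cons k ks)
  let ?m = "sum_list pre" and ?u = "block_index \<nu>"
  let ?\<psi> = "\<phi> \<bullet> shuffle ?m k"
  have mk: "?m + k \<le> n" using Cons.prems(2,3) by simp
  have u: "?u i = length pre" if "i \<in> {?m<..?m + k}" for i
    by (rule block_index_eq) (use that Cons.prems(2) in \<open>simp add: block_def\<close>)
  have psi_u: "?\<psi> ?u = q ^ (?m * k) * \<phi> ?u"
  proof (rule shuffle_coefficient[OF mk])
    fix g assume "\<phi> g \<noteq> 0"
    then show "(\<forall>i\<in>{1..?m}. g i < length pre) \<and> (\<forall>i\<in>{?m<..?m + k}. g i = length pre)"
      using Cons.prems(5)[of g] u mk by auto
  qed (rule u)
  have "(?\<psi> \<bullet> multishuffle (sum_list (pre @ [k])) ks) ?u \<noteq> 0"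
  proof (rule Cons.IH)
    show "?\<psi> ?u \<noteq> 0" unfolding psi_u using Cons.prems(1,4) by simp
    fix g assume "?\<psi> g \<noteq> 0"
    then show "(\<forall>i\<in>{1..sum_list (pre @ [k])}. g i < length (pre @ [k])) \<and>
      (\<forall>i\<in>{sum_list (pre @ [k])<..n}. g i = ?u i)"
    proof (rule words_support[OF shuffle_subalg mk, rotated 2])
      fix g assume "\<phi> g \<noteq> 0"
      from Cons.prems(5)[OF this]
      have g: "\<And>i. i \<in> {1..?m} \<Longrightarrow> g i < length pre" "\<And>i. i \<in> {?m<..n} \<Longrightarrow> g i = ?u i" by auto
      have "g i < Suc (length pre)" if "i \<in> {1..?m + k}" for i
        using g(1)[of i] g(2)[of i] u[of i] that mk by (cases "i \<le> ?m") auto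
      then show "(\<forall>i\<in>{1..sum_list (pre @ [k])}. g i < length (pre @ [k])) \<and>
        (\<forall>i\<in>{sum_list (pre @ [k])<..n}. g i = ?u i)" using g(2) by simp
    next
      fix i g assume i: "i \<in> {1..<?m + k}"
        and g: "(\<forall>j\<in>{1..sum_list (pre @ [k])}. (g \<circ> transpose i (i + 1)) j < length (pre @ [k])) \<and>
          (\<forall>j\<in>{sum_list (pre @ [k])<..n}. (g \<circ> transpose i (i + 1)) j = ?u j)"
      have "g j < Suc (length pre)" if "j \<in> {1..?m + k}" for j
      proof -
        have "transpose i (i + 1) j \<in> {1..?m + k}" using that i by (auto simp: transpose_def)
        then have "(g \<circ> transpose i (i + 1)) (transpose i (i + 1) j) < length (pre @ [k])"
          using g by (simp del: o_apply)
        then show ?thesis by simp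
      qed
      moreover have "g j = ?u j" if "j \<in> {?m + k<..n}" for j
        using g that i by (auto simp: transpose_def split: if_splits)
      ultimately show "(\<forall>i\<in>{1..sum_list (pre @ [k])}. g i < length (pre @ [k])) \<and>
        (\<forall>i\<in>{sum_list (pre @ [k])<..n}. g i = ?u i)" by simp
    qed
  qed (use Cons.prems in auto)
  moreover have "shuffle ?m k \<in> carrier H" "multishuffle (?m + k) ks \<in> carrier H"
    using Cons.prems(2,3) by (intro shuffle_closed[OF mk], intro multishuffle_closed, simp)
  ultimately show ?case by (simp add: W.N.ract_assoc)
qed

definition word_delta :: "(nat \<Rightarrow> nat) \<Rightarrow> (nat \<Rightarrow> nat) \<Rightarrow> 'a" where
  "word_delta u g = (if g = u then 1 else 0)"

lemma sign_on_word_delta: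
  assumes "sum_list \<nu> = n"
  shows "W.sign_on (parabolic_gens \<nu>) (word_delta (block_index \<nu>))"
  unfolding W.sign_on_def
proof (intro conjI ballI)
  fix i assume i: "i \<in> parabolic_gens \<nu>"
  then have u: "block_index \<nu> i = block_index \<nu> (i + 1)" and "i \<in> {1..<n}"
    using assms by (auto simp: parabolic_gens_def)
  have "word_op i (word_delta (block_index \<nu>)) g = - word_delta (block_index \<nu>) g" for g
  proof (cases "g i = g (i + 1)")
    case False
    have "g \<circ> transpose i (i + 1) \<noteq> block_index \<nu>"
    proof
      assume eq: "g \<circ> transpose i (i + 1) = block_index \<nu>"
      have "g (i + 1) = block_index \<nu> i" "g i = block_index \<nu> (i + 1)"
        using fun_cong[OF eq, of i] fun_cong[OF eq, of "i + 1"] by simp_all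
      then show False using False u by simp
    qed
    moreover have "g \<noteq> block_index \<nu>" using False u by auto
    ultimately show ?thesis by (simp add: word_op_def word_delta_def)
  qed (simp add: word_op_def)
  then show "word_delta (block_index \<nu>) \<bullet> T i
    = word_delta (block_index \<nu>) \<bullet> sc (- 1)"
    using \<open>i \<in> {1..<n}\<close> by (simp add: words_act_T words_act_sc fun_eq_iff)
qed simp

end

section \<open>The sign module\<close>

context hecke
begin

text \<open>Sign vectors in any two modules are eigenvectors with the same eigenvalue.  Stating this for a pair
  of modules serves in place of a sign character on the Hecke algebra.\<close>

lemma sign_on_character:
  assumes N: "hecke_rep n q N" and N': "hecke_rep n q N'"
    and h: "h \<in> subalg J" and J: "J \<subseteq> {1..<n}"
  shows "\<exists>c. (\<forall>x. hecke_rep.sign_on n q N J x \<longrightarrow> x \<star>\<^bsub>N\<^esub> h = x \<star>\<^bsub>N\<^esub> sc c) \<and>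
    (\<forall>x. hecke_rep.sign_on n q N' J x \<longrightarrow> x \<star>\<^bsub>N'\<^esub> h = x \<star>\<^bsub>N'\<^esub> sc c)"
proof -
  interpret N: hecke_rep n q N by fact
  interpret N': hecke_rep n q N' by fact
  show ?thesis
    using h
  proof (induction rule: subalg.induct)
    case (sc c)
    then show ?case by blast
  next
    case (T i)
    then show ?case using N.sign_onD N'.sign_onD by blast
  next
    case (add h k)
    then obtain c d where
      "\<forall>x. N.sign_on J x \<longrightarrow> x \<star>\<^bsub>N\<^esub> h = x \<star>\<^bsub>N\<^esub> sc c"
      "\<forall>x. N'.sign_on J x \<longrightarrow> x \<star>\<^bsub>N'\<^esub> h = x \<star>\<^bsub>N'\<^esub> sc c"
      "\<forall>x. N.sign_on J x \<longrightarrow> x \<star>\<^bsub>N\<^esub> k = x \<star>\<^bsub>N\<^esub> sc d"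
      "\<forall>x. N'.sign_on J x \<longrightarrow> x \<star>\<^bsub>N'\<^esub> k = x \<star>\<^bsub>N'\<^esub> sc d" by blast
    moreover have "h \<in> carrier H" "k \<in> carrier H" using add subalg_closed J by auto
    ultimately show ?case
      by (intro exI[of _ "c + d"])
        (simp add: N.N.ract_r_distr N'.N.ract_r_distr N.scale_add N'.scale_add
          N.sign_on_closed N'.sign_on_closed)
  next
    case (mult h k)
    then obtain c d where cd:
      "\<And>x. N.sign_on J x \<Longrightarrow> x \<star>\<^bsub>N\<^esub> h = x \<star>\<^bsub>N\<^esub> sc c"
      "\<And>x. N'.sign_on J x \<Longrightarrow> x \<star>\<^bsub>N'\<^esub> h = x \<star>\<^bsub>N'\<^esub> sc c"
      "\<And>x. N.sign_on J x \<Longrightarrow> x \<star>\<^bsub>N\<^esub> k = x \<star>\<^bsub>N\<^esub> sc d"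
      "\<And>x. N'.sign_on J x \<Longrightarrow> x \<star>\<^bsub>N'\<^esub> k = x \<star>\<^bsub>N'\<^esub> sc d" by blast
    have c: "h \<in> carrier H" "k \<in> carrier H" using mult subalg_closed J by auto
    have "x \<star>\<^bsub>N\<^esub> (h \<cdot> k) = x \<star>\<^bsub>N\<^esub> sc (d * c)" if s: "N.sign_on J x" for x
    proof -
      have x: "x \<in> carrier N" using s by (rule N.sign_on_closed)
      have "x \<star>\<^bsub>N\<^esub> (h \<cdot> k) = x \<star>\<^bsub>N\<^esub> sc c \<star>\<^bsub>N\<^esub> k"
        using x c by (simp add: N.N.ract_assoc cd(1)[OF s])
      also have "\<dots> = x \<star>\<^bsub>N\<^esub> sc d \<star>\<^bsub>N\<^esub> sc c"
        unfolding N.scale_act[OF x c(2)] cd(3)[OF s] ..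
      finally show ?thesis using x by (simp add: N.scale_scale)
    qed
    moreover have "x \<star>\<^bsub>N'\<^esub> (h \<cdot> k) = x \<star>\<^bsub>N'\<^esub> sc (d * c)" if s: "N'.sign_on J x" for x
    proof -
      have x: "x \<in> carrier N'" using s by (rule N'.sign_on_closed)
      have "x \<star>\<^bsub>N'\<^esub> (h \<cdot> k) = x \<star>\<^bsub>N'\<^esub> sc c \<star>\<^bsub>N'\<^esub> k"
        using x c by (simp add: N'.N.ract_assoc cd(2)[OF s])
      also have "\<dots> = x \<star>\<^bsub>N'\<^esub> sc d \<star>\<^bsub>N'\<^esub> sc c"
        unfolding N'.scale_act[OF x c(2)] cd(4)[OF s] ..
      finally show ?thesis using x by (simp add: N'.scale_scale)
    qed
    ultimately show ?case by blast
  qed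
qed

lemma word_form_scale:
  "word_form A (\<lambda>g. c * \<phi> g) \<psi> = c * word_form A \<phi> \<psi>"
  by (simp add: word_form_def sum_distrib_left mult_ac)

lemma word_form_add:
  "word_form A (\<lambda>g. \<phi> g + \<phi>' g) \<psi> = word_form A \<phi> \<psi> + word_form A \<phi>' \<psi>"
  by (simp add: word_form_def sum.distrib algebra_simps)

lemma word_form_sym: "word_form A \<phi> \<psi> = word_form A \<psi> \<phi>"
  by (simp add: word_form_def mult_ac)

text \<open>Pairing with a sign vector $\psi$ transforms under $h$ by the value of the sign character, because
  the generators are self-adjoint; the common eigenvalue $c$ is read off from $x$.\<close>

lemma word_form_character:
  assumes N: "hecke_rep n q N" and x: "hecke_rep.sign_on n q N {1..<n} x"
    and \<psi>: "W.sign_on {1..<n} \<psi>" and h: "h \<in> carrier H"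
    and A: "\<And>g i. g \<in> A \<Longrightarrow> i \<in> {1..<n} \<Longrightarrow> g \<circ> transpose i (i + 1) \<in> A"
  shows "\<exists>c. x \<star>\<^bsub>N\<^esub> h = x \<star>\<^bsub>N\<^esub> sc c \<and>
    (\<forall>\<phi>. word_form A (\<phi> \<bullet> h) \<psi> = c * word_form A \<phi> \<psi>)"
proof -
  interpret N: hecke_rep n q N by fact
  have xc: "x \<in> carrier N" using x by (rule N.sign_on_closed)
  show ?thesis
    using h unfolding carrier_eq_subalg
  proof (induction rule: subalg.induct)
    case (sc c)
    then show ?case by (intro exI[of _ c]) (simp add: words_act_sc word_form_scale)
  next
    case (T i)
    have "word_form A (word_op i \<phi>) \<psi> = - word_form A \<phi> \<psi>" for \<phi>
    proof -
      have "word_op i \<psi> = (\<lambda>g. - 1 * \<psi> g)"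
        using W.sign_onD[OF \<psi> T] T by (simp add: words_act_T words_act_sc)
      then show ?thesis
        using word_form_selfadjoint[OF T, of A \<phi> \<psi>] A T
        by (simp add: word_form_sym[of A \<phi>] word_form_scale del: mult_minus1 mult_minus_left)
    qed
    then show ?case
      using N.sign_onD[OF x T] T by (intro exI[of _ "- 1"]) (simp add: words_act_T)
  next
    case (add h k)
    then obtain c d where
      "x \<star>\<^bsub>N\<^esub> h = x \<star>\<^bsub>N\<^esub> sc c" "x \<star>\<^bsub>N\<^esub> k = x \<star>\<^bsub>N\<^esub> sc d"
      "\<forall>\<phi>. word_form A (\<phi> \<bullet> h) \<psi> = c * word_form A \<phi> \<psi>"
      "\<forall>\<phi>. word_form A (\<phi> \<bullet> k) \<psi> = d * word_form A \<phi> \<psi>" by blast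
    moreover have "h \<in> carrier H" "k \<in> carrier H" using add unfolding carrier_eq_subalg by auto
    ultimately show ?case
      using xc by (intro exI[of _ "c + d"])
        (simp add: N.N.ract_r_distr W.N.ract_r_distr N.scale_add word_form_add algebra_simps)
  next
    case (mult h k)
    then obtain c d where cd:
      "x \<star>\<^bsub>N\<^esub> h = x \<star>\<^bsub>N\<^esub> sc c" "x \<star>\<^bsub>N\<^esub> k = x \<star>\<^bsub>N\<^esub> sc d"
      "\<forall>\<phi>. word_form A (\<phi> \<bullet> h) \<psi> = c * word_form A \<phi> \<psi>"
      "\<forall>\<phi>. word_form A (\<phi> \<bullet> k) \<psi> = d * word_form A \<phi> \<psi>" by blast
    have c: "h \<in> carrier H" "k \<in> carrier H" using mult unfolding carrier_eq_subalg by auto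
    have "x \<star>\<^bsub>N\<^esub> (h \<cdot> k) = x \<star>\<^bsub>N\<^esub> sc d \<star>\<^bsub>N\<^esub> sc c"
      using xc c cd(1,2) by (simp add: N.N.ract_assoc N.scale_act[OF xc c(2)])
    then show ?case
      using xc c cd(3,4) by (intro exI[of _ "d * c"]) (simp add: N.scale_scale W.N.ract_assoc)
  qed
qed

end

locale sign_rep = hecke_rep n q N
  for n and q :: "'a::field" and N :: "('a, 'm) hecke_module" (structure) +
  fixes v
  assumes v: "v \<in> carrier N" "v \<noteq> \<zero>\<^bsub>N\<^esub>" and span: "carrier N = {v \<star> sc c | c. True}"
    and sign: "\<And>x. x \<in> carrier N \<Longrightarrow> sign_on {1..<n} x"
begin

lemma scale_eq_0: "v \<star> sc c = \<zero>\<^bsub>N\<^esub> \<longleftrightarrow> c = 0"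
proof
  assume z: "v \<star> sc c = \<zero>\<^bsub>N\<^esub>"
  show "c = 0"
  proof (rule ccontr)
    assume "c \<noteq> 0"
    then have "v = v \<star> sc c \<star> sc (inverse c)" using v by (simp add: scale_scale scale_one)
    then show False using z v by (simp add: N.ract_zero_left)
  qed
qed (use v in \<open>simp add: sc_zero act_zero\<close>)

lemma scale_inj: "v \<star> sc c = v \<star> sc d \<longleftrightarrow> c = d"
proof
  assume eq: "v \<star> sc c = v \<star> sc d"
  have "v \<star> sc (c + - d) = v \<star> sc (d + - d)"
    unfolding scale_add[OF v(1)] eq ..
  then have "v \<star> sc (c + - d) = \<zero>\<^bsub>N\<^esub>"
    using v by (simp add: sc_zero act_zero)
  then show "c = d" by (simp only: scale_eq_0) simp
qed simp

definition coord :: "'m \<Rightarrow> 'a" where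
  "coord x = (THE c. x = v \<star> sc c)"

lemma coord_scale [simp]: "coord (v \<star> sc c) = c"
  unfolding coord_def scale_inj by auto

lemma coord: "x \<in> carrier N \<Longrightarrow> x = v \<star> sc (coord x)"
  using span by auto

lemma coord_add:
  assumes "x \<in> carrier N" "y \<in> carrier N"
  shows "coord (x \<oplus>\<^bsub>N\<^esub> y) = coord x + coord y"
proof -
  have "x \<oplus>\<^bsub>N\<^esub> y = v \<star> sc (coord x + coord y)"
    using coord[OF assms(1)] coord[OF assms(2)] v by (simp add: scale_add)
  then show ?thesis by simp
qed

lemma coord_act_scale: "x \<in> carrier N \<Longrightarrow> coord (x \<star> sc c) = coord x * c"
  using coord[of x] v by (metis coord_scale scale_scale)

context
  fixes \<kappa> :: "nat list"
  assumes \<kappa>: "sum_list \<kappa> = n"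
begin

abbreviation "Par \<equiv> hecke_parabolic n q \<kappa>"

lemma Par_closed: "Par \<subseteq> carrier H"
  using hecke_parabolic_subset[OF \<kappa>] subalg_closed[OF _ parabolic_gens_subset[OF \<kappa>]] by blast

interpretation D: induction_data H N Par
  by (intro induction_data.intro induction_data_axioms.intro N.right_module_axioms Par_closed)

interpretation Ind: hecke_rep n q D.Ind
  by (intro hecke_rep.intro D.right_module_Ind)

lemma Ind_eq_tens: "y \<in> carrier D.Ind \<Longrightarrow> \<exists>h\<in>carrier H. y = D.tens v h"
proof (induction rule: D.Ind_induct)
  case (tens x r)
  have "D.tens x r = D.tens (v \<star> sc (coord x)) r" using coord[OF tens(1)] by simp
  also have "\<dots> = D.tens v (sc (coord x) \<cdot> r)"
    by (rule D.tens_balanced) (use v tens sc_in_hecke_parabolic[OF \<kappa>] in auto)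
  finally show ?case using tens by auto
next
  case (diff y z)
  then obtain h k where hk: "h \<in> carrier H" "y = D.tens v h" "k \<in> carrier H" "z = D.tens v k" by auto
  have t: "D.tens v r = D.tens v \<one>\<^bsub>H\<^esub> \<star>\<^bsub>D.Ind\<^esub> r" if "r \<in> carrier H" for r
    using that v by (simp add: D.tens_act)
  have o: "D.tens v \<one>\<^bsub>H\<^esub> \<in> carrier D.Ind" using v by (intro D.tens_closed) auto
  have "\<ominus>\<^bsub>D.Ind\<^esub> z = z \<star>\<^bsub>D.Ind\<^esub> sc (- 1)" using diff by (simp add: Ind.scale_uminus)
  also have "\<dots> = D.tens v (k \<cdot> sc (- 1))" using hk v by (simp add: D.tens_act)
  finally have "y \<ominus>\<^bsub>D.Ind\<^esub> z = D.tens v \<one>\<^bsub>H\<^esub> \<star>\<^bsub>D.Ind\<^esub> (h \<oplus>\<^bsub>H\<^esub> k \<cdot> sc (- 1))"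
    using hk o v by (simp add: Ind.N.M.minus_eq Ind.N.ract_r_distr t[of h] t[of "k \<cdot> sc (- 1)"])
  also have "\<dots> = D.tens v (h \<oplus>\<^bsub>H\<^esub> k \<cdot> sc (- 1))"
    by (rule t[symmetric]) (use hk in auto)
  finally show ?case using hk by blast
qed

text \<open>Up to normalisation, $x \mapsto (x \otimes 1) z$ with $z$ the element \<open>multishuffle\<close> splits
  the evaluation map.\<close>

lemma relatively_projective_if_gauss:
  assumes "gauss_list q 0 \<kappa> \<noteq> 0"
  shows "relatively_projective n q \<kappa> N"
proof -
  let ?z = "multishuffle 0 \<kappa>" and ?c = "inverse (gauss_list q 0 \<kappa>)"
  define y where "y x = D.tens x \<one>\<^bsub>H\<^esub>" for x
  define f where "f x = y x \<star>\<^bsub>D.Ind\<^esub> ?z \<star>\<^bsub>D.Ind\<^esub> sc ?c" for x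
  have z: "?z \<in> carrier H" using \<kappa> by (intro multishuffle_closed) simp
  have yc: "y x \<in> carrier D.Ind" if "x \<in> carrier N" for x
    using that unfolding y_def by (intro D.tens_closed) auto
  have y_bal: "y (x \<star> b) = y x \<star>\<^bsub>D.Ind\<^esub> b" if "x \<in> carrier N" "b \<in> Par" for x b
    using that Par_closed D.tens_balanced[of x b "\<one>\<^bsub>H\<^esub>"] D.tens_act[of x "\<one>\<^bsub>H\<^esub>" b]
    by (auto simp: y_def subsetD)
  have y_sign: "Ind.sign_on (parabolic_gens \<kappa>) (y x)" if x: "x \<in> carrier N" for x
    unfolding Ind.sign_on_def
  proof (intro conjI ballI yc x)
    fix i assume i: "i \<in> parabolic_gens \<kappa>"
    then have "x \<star> T i = x \<star> sc (- 1)"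
      using sign[OF x] parabolic_gens_subset[OF \<kappa>] by (auto intro: sign_onD)
    then show "y x \<star>\<^bsub>D.Ind\<^esub> T i = y x \<star>\<^bsub>D.Ind\<^esub> sc (- 1)"
      using y_bal[OF x T_in_hecke_parabolic[OF \<kappa> i]] y_bal[OF x sc_in_hecke_parabolic[OF \<kappa>]] by simp
  qed
  have z_sign: "Ind.sign_on {1..<n} (y x \<star>\<^bsub>D.Ind\<^esub> ?z)" if x: "x \<in> carrier N" for x
  proof -
    have "Ind.sign_on {1..<0 + sum_list \<kappa>} (y x \<star>\<^bsub>D.Ind\<^esub> ?z)"
    proof (rule Ind.sign_on_multishuffle)
      show "Ind.sign_on {i \<in> {1..<0 + sum_list \<kappa>}. \<forall>j. i \<noteq> 0 + sum_list (take j \<kappa>)} (y x)"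
        by (rule Ind.sign_on_subset[OF y_sign[OF x]]) (auto simp: mem_parabolic_gens_iff)
    qed (use \<kappa> in simp)
    then show ?thesis using \<kappa> by simp
  qed
  have f_sign: "Ind.sign_on {1..<n} (f x)" if x: "x \<in> carrier N" for x
    using Ind.sign_onD[OF z_sign[OF x]] yc[OF x] z
    by (auto simp: Ind.sign_on_def f_def Ind.scale_act[OF _ T_closed] Ind.scale_scale mult.commute)
  obtain g where g: "module_hom H D.Ind N g"
    "\<And>x r. x \<in> carrier N \<Longrightarrow> r \<in> carrier H \<Longrightarrow> g (D.tens x r) = x \<star> r"
    using D.evaluation by blast
  have "module_hom H N D.Ind f"
    unfolding module_hom_def
  proof (intro conjI ballI funcsetI)
    fix x assume x: "x \<in> carrier N"
    show "f x \<in> carrier D.Ind" using f_sign[OF x] by (rule Ind.sign_on_closed)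
    show "f (x \<oplus>\<^bsub>N\<^esub> x') = f x \<oplus>\<^bsub>D.Ind\<^esub> f x'" if "x' \<in> carrier N" for x'
    proof -
      have "y (x \<oplus>\<^bsub>N\<^esub> x') = y x \<oplus>\<^bsub>D.Ind\<^esub> y x'"
        unfolding y_def by (rule D.tens_add_left) (use x that in auto)
      then show ?thesis using yc[OF x] yc[OF that] z by (simp add: f_def Ind.N.ract_l_distr)
    qed
    fix h assume h: "h \<in> carrier H"
    then obtain c where c: "\<forall>x. sign_on {1..<n} x \<longrightarrow> x \<star> h = x \<star> sc c"
      "\<forall>x. Ind.sign_on {1..<n} x \<longrightarrow> x \<star>\<^bsub>D.Ind\<^esub> h = x \<star>\<^bsub>D.Ind\<^esub> sc c"
      using sign_on_character[OF hecke_rep_axioms Ind.hecke_rep_axioms, of h "{1..<n}"]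
      unfolding carrier_eq_subalg by blast
    have "f (x \<star> h) = f (x \<star> sc c)" using c(1) sign[OF x] by simp
    also have "\<dots> = y x \<star>\<^bsub>D.Ind\<^esub> sc c \<star>\<^bsub>D.Ind\<^esub> ?z \<star>\<^bsub>D.Ind\<^esub> sc ?c"
      unfolding f_def y_bal[OF x sc_in_hecke_parabolic[OF \<kappa>]] ..
    also have "\<dots> = f x \<star>\<^bsub>D.Ind\<^esub> sc c"
      using yc[OF x] z by (simp add: f_def Ind.scale_act[OF _ z] Ind.scale_scale mult.commute)
    also have "\<dots> = f x \<star>\<^bsub>D.Ind\<^esub> h" using c(2) f_sign[OF x] by simp
    finally show "f (x \<star> h) = f x \<star>\<^bsub>D.Ind\<^esub> h" .
  qed
  moreover have "g (f x) = x" if x: "x \<in> carrier N" for x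
  proof -
    have "g (f x) = x \<star> ?z \<star> sc ?c"
      using x yc[OF x] z g(2)[of x "\<one>\<^bsub>H\<^esub>"]
      by (simp add: f_def module_homD(3)[OF g(1)] y_def N.ract_one)
    also have "x \<star> ?z = x \<star> sc (gauss_list q 0 \<kappa>)"
      by (rule sign_on_multishuffle_eq[OF sign[OF x]]) (use \<kappa> in simp)
    finally show ?thesis using x assms by (simp add: scale_scale scale_one)
  qed
  ultimately show ?thesis
    unfolding relatively_projective_def
    by (rule iso_direct_summandI[OF N.right_module_axioms D.right_module_Ind _ g(1)])
qed

text \<open>The map $vc \otimes h \mapsto c \, u h$ is balanced because parabolic elements act on $u$ and on $v$ by
  the same scalars.\<close>

lemma ex_words_hom:
  assumes u: "W.sign_on (parabolic_gens \<kappa>) u"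
  obtains \<Theta> where
    "\<And>h. h \<in> carrier H \<Longrightarrow> \<Theta> (D.tens v h) = u \<bullet> h"
proof -
  have "comm_group (add_monoid words_module)" by (rule W.N.M.a_comm_group)
  then obtain \<Theta> where \<Theta>: "\<And>x r. x \<in> carrier N \<Longrightarrow> r \<in> carrier H \<Longrightarrow>
      \<Theta> (D.tens x r) = u \<bullet> r \<bullet> sc (coord x)"
  proof (rule D.Ind_universal[of "add_monoid words_module"
        "\<lambda>x r. u \<bullet> r \<bullet> sc (coord x)"])
    fix x b r assume x: "x \<in> carrier N" and b: "b \<in> Par" and r: "r \<in> carrier H"
    have bH: "b \<in> carrier H" using b Par_closed by blast
    obtain c where c: "\<forall>x. sign_on (parabolic_gens \<kappa>) x \<longrightarrow> x \<star> b = x \<star> sc c"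
      "\<forall>x. W.sign_on (parabolic_gens \<kappa>) x \<longrightarrow> x \<bullet> b = x \<bullet> sc c"
      using sign_on_character[OF hecke_rep_axioms W.hecke_rep_axioms _ parabolic_gens_subset[OF \<kappa>]]
        hecke_parabolic_subset[OF \<kappa>] b by blast
    have "sign_on (parabolic_gens \<kappa>) x"
      using sign_on_subset[OF sign[OF x] parabolic_gens_subset[OF \<kappa>]] .
    then have 1: "coord (x \<star> b) = c * coord x" using c(1) x by (simp add: coord_act_scale mult.commute)
    have "u \<bullet> (b \<cdot> r) = u \<bullet> sc c \<bullet> r"
      using c(2) u bH r by (simp add: W.N.ract_assoc)
    also have "\<dots> = u \<bullet> r \<bullet> sc c"
      using r by (simp add: W.scale_act)
    finally show "u \<bullet> r \<bullet> sc (coord (x \<star> b))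
      = u \<bullet> (b \<cdot> r) \<bullet> sc (coord x)"
      using 1 by (simp add: W.scale_scale)
  qed (auto simp: coord_add words_act_sc W.N.ract_r_distr algebra_simps)
  have "\<Theta> (D.tens v h) = u \<bullet> h" if "h \<in> carrier H" for h
    using \<Theta>[OF v(1) that] coord_scale[of 1] v by (simp add: scale_one words_act_sc)
  then show ?thesis using that by blast
qed

text \<open>Let $f$ embed the module as a direct summand and write $f(v) = v \otimes h$.  If the multinomial
  coefficient vanishes, then the two evaluations of the pairing of $\delta_u h$ with $\delta_u z$ show
  that $h$ acts on $v$ as zero.  Then the projection sends $f(v) = (v \otimes 1) h$ to zero, which
  contradicts that it sends $f(v)$ to $v$.\<close>

lemma gauss_if_relatively_projective:
  assumes q: "q \<noteq> 0" and proj: "relatively_projective n q \<kappa> N"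
  shows "gauss_list q 0 \<kappa> \<noteq> 0"
proof
  assume zero: "gauss_list q 0 \<kappa> = 0"
  obtain f g where f: "module_hom H N D.Ind f" and g: "module_hom H D.Ind N g"
    and gf: "\<And>x. x \<in> carrier N \<Longrightarrow> g (f x) = x"
    using iso_direct_summandE[OF N.right_module_axioms D.right_module_Ind
        proj[unfolded relatively_projective_def]] by blast
  obtain h where h: "h \<in> carrier H" "f v = D.tens v h"
    using Ind_eq_tens[of "f v"] module_homD(1)[OF f v(1)] by blast
  let ?u = "block_index \<kappa>" and ?z = "multishuffle 0 \<kappa>"
  let ?\<delta> = "word_delta ?u"
  \<comment> \<open>The form is taken over the rearrangements of the sorted word, a finite set.\<close>
  define A where "A = (\<lambda>w. ?u \<circ> w) ` {w. w permutes {1..n}}"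
  have finA: "finite A" unfolding A_def by (intro finite_imageI finite_permutations) simp
  have A: "g \<circ> transpose i (i + 1) \<in> A" if "g \<in> A" "i \<in> {1..<n}" for g i
  proof -
    obtain w where w: "w permutes {1..n}" "g = ?u \<circ> w" using \<open>g \<in> A\<close> by (auto simp: A_def)
    have "w \<circ> transpose i (i + 1) permutes {1..n}"
      using that(2) by (intro permutes_compose[OF _ w(1)] permutes_swap_id) auto
    then show ?thesis unfolding A_def w(2) by (auto simp: comp_assoc)
  qed
  have uA: "?u \<in> A"
    unfolding A_def by (rule image_eqI[of _ _ id]) (auto simp: permutes_id)
  have form_delta: "word_form A ?\<delta> \<chi> = q ^ word_inversions n ?u * \<chi> ?u" for \<chi>
    unfolding word_form_def using finA uA
    by (subst sum.remove[of _ ?u]) (auto simp: word_delta_def intro!: sum.neutral)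
  have z: "?z \<in> carrier H" using \<kappa> by (intro multishuffle_closed) simp
  let ?\<psi> = "?\<delta> \<bullet> ?z" and ?\<phi> = "?\<delta> \<bullet> h"
  have \<psi>: "W.sign_on {1..<n} ?\<psi>"
  proof -
    have "W.sign_on {1..<0 + sum_list \<kappa>} ?\<psi>"
    proof (rule W.sign_on_multishuffle)
      show "W.sign_on {i \<in> {1..<0 + sum_list \<kappa>}. \<forall>j. i \<noteq> 0 + sum_list (take j \<kappa>)} ?\<delta>"
        by (rule W.sign_on_subset[OF sign_on_word_delta[OF \<kappa>]]) (auto simp: mem_parabolic_gens_iff)
    qed (use \<kappa> in simp)
    then show ?thesis using \<kappa> by simp
  qed
  have \<phi>: "W.sign_on {1..<n} ?\<phi>"
    unfolding W.sign_on_def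
  proof (intro conjI ballI)
    fix i assume i: "i \<in> {1..<n}"
    obtain \<Theta> where \<Theta>: "\<And>h. h \<in> carrier H \<Longrightarrow> \<Theta> (D.tens v h) = ?\<delta> \<bullet> h"
      using ex_words_hom[OF sign_on_word_delta[OF \<kappa>]] by blast
    have "f v \<star>\<^bsub>D.Ind\<^esub> T i = f v \<star>\<^bsub>D.Ind\<^esub> sc (- 1)"
      using module_homD(3)[OF f v(1)] sign_onD[OF sign[OF v(1)] i] i by (metis T_closed sc_closed)
    then have "D.tens v (h \<cdot> T i) = D.tens v (h \<cdot> sc (- 1))"
      using h v i by (simp add: D.tens_act)
    then have "?\<delta> \<bullet> (h \<cdot> T i) = ?\<delta> \<bullet> (h \<cdot> sc (- 1))"
      using \<Theta> h i by (metis H.m_closed T_closed sc_closed)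
    then show "?\<phi> \<bullet> T i = ?\<phi> \<bullet> sc (- 1)"
      using h i by (simp add: W.N.ract_assoc)
  qed simp
  have \<psi>_u: "?\<psi> ?u \<noteq> 0"
  proof -
    have "(?\<delta> \<bullet> multishuffle (sum_list []) \<kappa>) ?u \<noteq> 0"
      by (rule multishuffle_coefficient[OF q _ \<kappa>]) (auto simp: word_delta_def split: if_splits)
    then show ?thesis by simp
  qed
  obtain c where c: "v \<star> h = v \<star> sc c"
    "\<forall>\<phi>. word_form A (\<phi> \<bullet> h) ?\<psi> = c * word_form A \<phi> ?\<psi>"
    using word_form_character[OF hecke_rep_axioms sign[OF v(1)] \<psi> h(1) A] by blast
  obtain d where d: "v \<star> ?z = v \<star> sc d"
    "\<forall>\<phi>'. word_form A (\<phi>' \<bullet> ?z) ?\<phi> = d * word_form A \<phi>' ?\<phi>"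
    using word_form_character[OF hecke_rep_axioms sign[OF v(1)] \<phi> z A] by blast
  \<comment> \<open>The element $z$ acts on $v$ by the multinomial coefficient, which is zero by assumption.\<close>
  have "v \<star> ?z = v \<star> sc 0"
    using sign_on_multishuffle_eq[OF sign[OF v(1)], of 0 \<kappa>] \<kappa> zero by simp
  then have "d = 0" using d(1) by (simp add: scale_inj)
  then have "word_form A ?\<psi> ?\<phi> = 0" using d(2) by simp
  moreover have "word_form A ?\<phi> ?\<psi> = c * (q ^ word_inversions n ?u * ?\<psi> ?u)"
    using c(2) by (simp add: form_delta)
  ultimately have "c = 0" using q \<psi>_u by (simp add: word_form_sym[of A ?\<psi>])
  have "g (D.tens v \<one>\<^bsub>H\<^esub>) \<in> carrier N"
    using module_homD(1)[OF g D.tens_closed[OF v(1)]] by simp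
  then obtain b where b: "g (D.tens v \<one>\<^bsub>H\<^esub>) = v \<star> sc b" using span by blast
  have "v = g (D.tens v \<one>\<^bsub>H\<^esub> \<star>\<^bsub>D.Ind\<^esub> h)"
    using gf[OF v(1)] h v by (simp add: D.tens_act)
  also have "\<dots> = v \<star> sc b \<star> h"
    using module_homD(3)[OF g D.tens_closed[OF v(1)], of "\<one>\<^bsub>H\<^esub>" h] h(1) b by simp
  also have "\<dots> = v \<star> sc 0 \<star> sc b"
    using scale_act[OF v(1) h(1)] c(1) \<open>c = 0\<close> by simp
  also have "\<dots> = \<zero>\<^bsub>N\<^esub>" using v by (simp add: sc_zero act_zero N.ract_zero_left)
  finally show False using v by simp
qed

end

end

lemma sign_module_sign_rep:
  fixes q :: "'a::field" and M :: "('a, 'm) hecke_module"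
  assumes "sign_module n q M"
  obtains v where "sign_rep n q M v"
proof -
  interpret hecke n q .
  obtain v where M: "right_module H M" and v: "v \<in> carrier M" "v \<noteq> \<zero>\<^bsub>M\<^esub>"
    "carrier M = {v \<star>\<^bsub>M\<^esub> sc c | c. True}"
    and T: "\<And>i x. i \<in> {1..<n} \<Longrightarrow> x \<in> carrier M \<Longrightarrow> x \<star>\<^bsub>M\<^esub> T i = \<ominus>\<^bsub>M\<^esub> x"
    using assms unfolding sign_module_def by blast
  interpret M: hecke_rep n q M by (intro hecke_rep.intro M)
  have "sign_rep n q M v"
    by (intro sign_rep.intro sign_rep_axioms.intro M.hecke_rep_axioms v)
      (simp add: M.sign_on_def T M.scale_uminus)
  then show ?thesis by (rule that)
qed

lemma relatively_projective_sign_module_iff: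
  fixes q :: "'a::field" and M :: "('a, 'm) hecke_module"
  assumes "sign_module n q M" "q \<noteq> 0" "sum_list \<kappa> = n"
  shows "relatively_projective n q \<kappa> M \<longleftrightarrow> gauss_list q 0 \<kappa> \<noteq> 0"
proof -
  obtain v where "sign_rep n q M v" using sign_module_sign_rep[OF assms(1)] .
  then interpret sign_rep n q M v .
  show ?thesis
    using gauss_if_relatively_projective[OF assms(3,2)] relatively_projective_if_gauss[OF assms(3)] by blast
qed

theorem theorem7p11:
  fixes q :: "'a::alg_closed_field"
    and M :: "('a, 'm) hecke_module"
    and n e p a :: nat and as :: "nat list"
  assumes "prime p" and "CHAR('a) = p"
    and "n \<ge> 1"
    and "q \<noteq> 0"
    and "quantum_characteristic q e" and "e > 1"
    and "ep_adic_expansion e p n a as"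
    and "sign_module n q M"
  shows "has_vertex n q M (standard_ep_composition e p a as)"
proof -
  let ?\<nu> = "standard_ep_composition e p a as"
  note setting = assms(1,2,5,6,7)
  have sum: "sum_list ?\<nu> = n"
    using standard_ep_composition_composition[OF assms(6) prime_gt_1_nat[OF assms(1)] assms(7)]
    by (simp add: composition_def)
  note crit = relatively_projective_sign_module_iff[OF assms(8,4)]
  have "relatively_projective n q ?\<nu> M"
    unfolding crit[OF sum] by (rule gauss_list_standard_ep_composition[OF setting])
  moreover have "\<exists>g. g permutes {1..n} \<and>
      (\<lambda>w. g \<circ> w \<circ> Hilbert_Choice.inv g) ` parabolic ?\<nu> \<subseteq> parabolic \<kappa>"
    if "composition n \<kappa>" "relatively_projective n q \<kappa> M" for \<kappa>
  proof -
    have "gauss_list q 0 \<kappa> \<noteq> 0"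
      using that crit[of \<kappa>] by (simp add: composition_def)
    with that(1) show ?thesis by (intro standard_parabolic_conj_subset[OF setting])
  qed
  ultimately show ?thesis unfolding has_vertex_def by blast
qed

end
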